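(* The set $$Irr(S)=\left\{[w]\in NLSW(\{P\};\Delta(X))\ \middle|\ w\neq\pi|_{P(u)P(v)}\text{ for all }\pi\in\langle\{P\};\Delta(X)\rangle^\star,\ u,v\in ALSW(\{P\};\Delta(X))\text{ with }u>_{Dl}v\right\}$$ is a linear basis of the free $\lambda$-differential Lie Rota-Baxter algebra $DRBL(X)$ on $X$.
   Context: $k$ is a field, $\lambda\in k$, $X$ is a well-ordered set. A $\lambda$-differential Lie Rota-Baxter algebra is a Lie algebra $L$ over $k$ with two linear operators $P,D:L\to L$ such that for all $x,y\in L$: (a) $[P(x)P(y)]=P([xP(y)])+P([P(x)y])+\lambda P([xy])$; (b) $D([xy])=[D(x)y]+[xD(y)]+\lambda[D(x)D(y)]$; (c) $D(P(x))=x$. $DRBL(X)$ is the free such algebra on the set $X$. Bracketed words below are evaluated in $DRBL(X)$ using its Lie bracket and operators $P$, $D$ (so the letter $D^m(x)$ is $D$ applied $m$ times to the generator $x$). Words. For a set $Y$, $S(Y)$ is the set of nonempty associative words on $Y$ and $Y^*=S(Y)\cup\{1\}$; $P(Y)=\{P(y)\mid y\in Y\}$ (formal symbols). $\Delta(X)=\{D^m(x)\mid x\in X,m\ge0\}$ (formal symbols, $D^0(x)=x$). Put $\langle\{P\};\Delta(X)\rangle_0=S(\Delta(X))$, $\langle\{P\};\Delta(X)\rangle_n=S(\Delta(X)\cup P(\langle\{P\};\Delta(X)\rangle_{n-1}))$, $\langle\{P\};\Delta(X)\rangle=\bigcup_n\langle\{P\};\Delta(X)\rangle_n$. Each such word is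 uniquely $u=u_1\cdots u_n$ with $u_i\in\Delta(X)\cup P(\langle\{P\};\Delta(X)\rangle)$ (prime words); put $bre(u)=n$. $\langle\{P\};\Delta(X)\rangle^\star$ is the set of words in $\langle\{P\};\Delta(X)\cup\{\star\}\rangle$ with exactly one occurrence of the new symbol $\star$, and $\pi|_u$ is $\pi$ with $\star$ replaced by $u$. Order. $\deg(u)$ is the total number of occurrences in $u$ of elements of $X$, of $P$, and of $D$ (so $D^m(x)$ has degree $m+1$). For $u=u_1\cdots u_n$ ($u_i$ prime) let $wt(u)=(\deg(u),bre(u),u_1,\dots,u_n)$, and $u>_{Dl}v$ iff $wt(u)>wt(v)$ lexicographically, where primes are compared first by $\deg$; primes of degree 1 (elements of $X$) by the order of $X$; and primes $\omega(a),\theta(b)$ of the same degree ($\omega,\theta\in\{D,P\}$, where $P>D$ and $D^m(x)=D(D^{m-1}(x))$) by comparing $(\omega,a)$ and $(\theta,b)$ lexicographically (recursively). Let $\succ$ be the restriction of $>_{Dl}$ to prime words and $\succ_{lex}$ the induced lex-order. Lyndon-Shirshov words. For a well-ordered set $(Y,>)$, $>_{lex}$ on $Y^*$ is the lexicographic order with $1>_{lex}u$ for each nonempty $u$. A nonempty word $w$ is associative Lyndon-Shirshov, $w\in ALSW(Y)$, if $uv>_{lex}vu$ for every $w=uv$ with $u,v\ne1$. A bracketed word $(u)$ is nonassociative Lyndon-Shirshov, $(u)\in NLSW(Y)$, if $u\in ALSW(Y)$; whenever $(u)=((v)(w))$, both $(v),(w)$ are nonassociative Lyndon-Shirshov; and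 if moreover $(v)=((v_1)(v_2))$ then $v_2\le_{lex}w$. Each $u\in ALSW(Y)$ has a unique bracketing $[u]\in NLSW(Y)$ (Shirshov standard bracketing). Put $Y_0=\Delta(X)$, $ALSW(\{P\};\Delta(X))_n=ALSW(Y_n)$ with respect to $\succ_{lex}$, where $Y_n=\Delta(X)\cup P(ALSW(\{P\};\Delta(X))_{n-1})$ for $n\ge1$, and $ALSW(\{P\};\Delta(X))=\bigcup_nALSW(\{P\};\Delta(X))_n$. Bracketing: $[u]=u$ for $u\in\Delta(X)$, $[P(u_1)]=P([u_1])$, and for $u=u_1\cdots u_m$ with $u_i\in Y_n$, $[u]$ is the Shirshov standard bracketing of the word $[u_1]\cdots[u_m]$ in the letters $[u_i]$, ordered by $[a]\succ[b]$ iff $a\succ b$. $NLSW(\{P\};\Delta(X))=\{[u]\mid u\in ALSW(\{P\};\Delta(X))\}$. *)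

theory Defs
  imports "Jordan_Normal_Form.VS_Connect"
begin

section \<open>Differential Lie Rota-Baxter algebras\<close>

text \<open>The ring fields \<open>mult\<close> and \<open>one\<close> inherited from \<^type>\<open>module\<close> are not used.
  The ground field is a type of class \<^class>\<open>field\<close>, seen as a ring record through \<open>class_ring\<close>.\<close>

record ('k, 'a) drb_alg = "('k, 'a) module" +
  lie :: "'a \<Rightarrow> 'a \<Rightarrow> 'a"
  rb :: "'a \<Rightarrow> 'a"
  df :: "'a \<Rightarrow> 'a"

locale diff_lie_rb_algebra =
  vectorspace "class_ring :: 'k::field ring" L
  for lam :: "'k::field" and L :: "('k, 'a, 'm) drb_alg_scheme" (structure) +
  assumes lie_closed: "\<lbrakk>x \<in> carrier L; y \<in> carrier L\<rbrakk> \<Longrightarrow> lie L x y \<in> carrier L"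
    and lie_add_left: "\<lbrakk>x \<in> carrier L; y \<in> carrier L; z \<in> carrier L\<rbrakk> \<Longrightarrow>
          lie L (x \<oplus> y) z = lie L x z \<oplus> lie L y z"
    and lie_add_right: "\<lbrakk>x \<in> carrier L; y \<in> carrier L; z \<in> carrier L\<rbrakk> \<Longrightarrow>
          lie L x (y \<oplus> z) = lie L x y \<oplus> lie L x z"
    and lie_smult_left: "\<lbrakk>x \<in> carrier L; y \<in> carrier L\<rbrakk> \<Longrightarrow>
          lie L (c \<odot> x) y = c \<odot> lie L x y"
    and lie_smult_right: "\<lbrakk>x \<in> carrier L; y \<in> carrier L\<rbrakk> \<Longrightarrow>
          lie L x (c \<odot> y) = c \<odot> lie L x y"
    and lie_self: "x \<in> carrier L \<Longrightarrow> lie L x x = \<zero>"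
    and jacobi: "\<lbrakk>x \<in> carrier L; y \<in> carrier L; z \<in> carrier L\<rbrakk> \<Longrightarrow>
          lie L x (lie L y z) \<oplus> lie L y (lie L z x) \<oplus> lie L z (lie L x y) = \<zero>"
    and rb_closed: "x \<in> carrier L \<Longrightarrow> rb L x \<in> carrier L"
    and rb_add: "\<lbrakk>x \<in> carrier L; y \<in> carrier L\<rbrakk> \<Longrightarrow> rb L (x \<oplus> y) = rb L x \<oplus> rb L y"
    and rb_smult: "x \<in> carrier L \<Longrightarrow> rb L (c \<odot> x) = c \<odot> rb L x"
    and df_closed: "x \<in> carrier L \<Longrightarrow> df L x \<in> carrier L"
    and df_add: "\<lbrakk>x \<in> carrier L; y \<in> carrier L\<rbrakk> \<Longrightarrow> df L (x \<oplus> y) = df L x \<oplus> df L y"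
    and df_smult: "x \<in> carrier L \<Longrightarrow> df L (c \<odot> x) = c \<odot> df L x"
    and rota_baxter: "\<lbrakk>x \<in> carrier L; y \<in> carrier L\<rbrakk> \<Longrightarrow>
          lie L (rb L x) (rb L y)
            = rb L (lie L x (rb L y)) \<oplus> rb L (lie L (rb L x) y) \<oplus> lam \<odot> rb L (lie L x y)"
    and leibniz: "\<lbrakk>x \<in> carrier L; y \<in> carrier L\<rbrakk> \<Longrightarrow>
          df L (lie L x y)
            = lie L (df L x) y \<oplus> lie L x (df L y) \<oplus> lam \<odot> lie L (df L x) (df L y)"
    and df_rb: "x \<in> carrier L \<Longrightarrow> df L (rb L x) = x"

definition drb_hom :: "('k, 'a, 'm) drb_alg_scheme \<Rightarrow> ('k, 'b, 'n) drb_alg_scheme \<Rightarrow> ('a \<Rightarrow> 'b) set"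
  where "drb_hom L M = {h \<in> carrier L \<rightarrow> carrier M.
    (\<forall>x\<in>carrier L. \<forall>y\<in>carrier L. h (x \<oplus>\<^bsub>L\<^esub> y) = h x \<oplus>\<^bsub>M\<^esub> h y) \<and>
    (\<forall>c. \<forall>x\<in>carrier L. h (c \<odot>\<^bsub>L\<^esub> x) = c \<odot>\<^bsub>M\<^esub> h x) \<and>
    (\<forall>x\<in>carrier L. \<forall>y\<in>carrier L. h (lie L x y) = lie M (h x) (h y)) \<and>
    (\<forall>x\<in>carrier L. h (rb L x) = rb M (h x)) \<and>
    (\<forall>x\<in>carrier L. h (df L x) = df M (h x))}"


section \<open>The free algebra\<close>

text \<open>\<open>DRBL lam X\<close> is the algebra of all formal expressions in the generators \<open>X\<close> modulo the
  congruence generated by the axioms. It is shown to be a differential Lie Rota-Baxter algebra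
  of weight \<open>lam\<close> and to have the universal property in \<open>DRBL_algebra\<close> and \<open>DRBL_free\<close> below.\<close>

datatype ('k, 'x) tm =
    Gen 'x
  | Zero
  | Add "('k, 'x) tm" "('k, 'x) tm"
  | Scale 'k "('k, 'x) tm"
  | Lie "('k, 'x) tm" "('k, 'x) tm"
  | RB "('k, 'x) tm"
  | Df "('k, 'x) tm"

inductive drb_eq :: "'k::field \<Rightarrow> ('k, 'x) tm \<Rightarrow> ('k, 'x) tm \<Rightarrow> bool" for lam where
  refl: "drb_eq lam s s"
| sym: "drb_eq lam s t \<Longrightarrow> drb_eq lam t s"
| trans: "drb_eq lam s t \<Longrightarrow> drb_eq lam t u \<Longrightarrow> drb_eq lam s u"
| Add_cong: "drb_eq lam s s' \<Longrightarrow> drb_eq lam t t' \<Longrightarrow> drb_eq lam (Add s t) (Add s' t')"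
| Scale_cong: "drb_eq lam s s' \<Longrightarrow> drb_eq lam (Scale c s) (Scale c s')"
| Lie_cong: "drb_eq lam s s' \<Longrightarrow> drb_eq lam t t' \<Longrightarrow> drb_eq lam (Lie s t) (Lie s' t')"
| RB_cong: "drb_eq lam s s' \<Longrightarrow> drb_eq lam (RB s) (RB s')"
| Df_cong: "drb_eq lam s s' \<Longrightarrow> drb_eq lam (Df s) (Df s')"
| Add_assoc: "drb_eq lam (Add (Add s t) u) (Add s (Add t u))"
| Add_comm: "drb_eq lam (Add s t) (Add t s)"
| Add_Zero: "drb_eq lam (Add Zero s) s"
| Scale_0: "drb_eq lam (Scale 0 s) Zero"
| Scale_1: "drb_eq lam (Scale 1 s) s"
| Scale_Scale: "drb_eq lam (Scale (a * b) s) (Scale a (Scale b s))"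
| Scale_add_left: "drb_eq lam (Scale (a + b) s) (Add (Scale a s) (Scale b s))"
| Scale_add_right: "drb_eq lam (Scale a (Add s t)) (Add (Scale a s) (Scale a t))"
| Lie_add_left: "drb_eq lam (Lie (Add s t) u) (Add (Lie s u) (Lie t u))"
| Lie_add_right: "drb_eq lam (Lie s (Add t u)) (Add (Lie s t) (Lie s u))"
| Lie_Scale_left: "drb_eq lam (Lie (Scale a s) t) (Scale a (Lie s t))"
| Lie_Scale_right: "drb_eq lam (Lie s (Scale a t)) (Scale a (Lie s t))"
| Lie_self: "drb_eq lam (Lie s s) Zero"
| Jacobi: "drb_eq lam (Add (Add (Lie s (Lie t u)) (Lie t (Lie u s))) (Lie u (Lie s t))) Zero"
| RB_Add: "drb_eq lam (RB (Add s t)) (Add (RB s) (RB t))"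
| RB_Scale: "drb_eq lam (RB (Scale a s)) (Scale a (RB s))"
| Df_Add: "drb_eq lam (Df (Add s t)) (Add (Df s) (Df t))"
| Df_Scale: "drb_eq lam (Df (Scale a s)) (Scale a (Df s))"
| Rota_Baxter: "drb_eq lam (Lie (RB s) (RB t))
    (Add (Add (RB (Lie s (RB t))) (RB (Lie (RB s) t))) (Scale lam (RB (Lie s t))))"
| Leibniz: "drb_eq lam (Df (Lie s t))
    (Add (Add (Lie (Df s) t) (Lie s (Df t))) (Scale lam (Lie (Df s) (Df t))))"
| Df_RB: "drb_eq lam (Df (RB s)) s"

primrec gens :: "('k, 'x) tm \<Rightarrow> 'x set" where
  "gens (Gen x) = {x}"
| "gens Zero = {}"
| "gens (Add s t) = gens s \<union> gens t"
| "gens (Scale c s) = gens s"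
| "gens (Lie s t) = gens s \<union> gens t"
| "gens (RB s) = gens s"
| "gens (Df s) = gens s"

definition tms :: "'x set \<Rightarrow> ('k, 'x) tm set"
  where "tms X = {t. gens t \<subseteq> X}"

definition drb_rel :: "'k::field \<Rightarrow> 'x set \<Rightarrow> (('k, 'x) tm \<times> ('k, 'x) tm) set"
  where "drb_rel lam X = {(s, t). s \<in> tms X \<and> t \<in> tms X \<and> drb_eq lam s t}"

definition drb_class :: "'k::field \<Rightarrow> 'x set \<Rightarrow> ('k, 'x) tm \<Rightarrow> ('k, 'x) tm set"
  where "drb_class lam X s = drb_rel lam X `` {s}"

definition DRBL :: "'k::field \<Rightarrow> 'x set \<Rightarrow> ('k, ('k, 'x) tm set) drb_alg" where
  "DRBL lam X =
   \<lparr>carrier = tms X // drb_rel lam X,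
    mult = undefined,
    one = undefined,
    zero = drb_class lam X Zero,
    add = (\<lambda>A B. \<Union>s\<in>A. \<Union>t\<in>B. drb_class lam X (Add s t)),
    smult = (\<lambda>c A. \<Union>s\<in>A. drb_class lam X (Scale c s)),
    lie = (\<lambda>A B. \<Union>s\<in>A. \<Union>t\<in>B. drb_class lam X (Lie s t)),
    rb = (\<lambda>A. \<Union>s\<in>A. drb_class lam X (RB s)),
    df = (\<lambda>A. \<Union>s\<in>A. drb_class lam X (Df s))\<rparr>"

definition gen :: "'k::field \<Rightarrow> 'x set \<Rightarrow> 'x \<Rightarrow> ('k, 'x) tm set"
  where "gen lam X x = drb_class lam X (Gen x)"

lemma equiv_drb_rel: "equiv (tms X) (drb_rel lam X)"
  by (rule equivI)
    (auto simp: drb_rel_def refl_on_def sym_def trans_def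
      intro: drb_eq.refl drb_eq.sym drb_eq.trans)

lemma tms_simps [simp]:
  "Gen x \<in> tms X \<longleftrightarrow> x \<in> X" "Zero \<in> tms X" "Add s t \<in> tms X \<longleftrightarrow> s \<in> tms X \<and> t \<in> tms X"
  "Scale c s \<in> tms X \<longleftrightarrow> s \<in> tms X" "Lie s t \<in> tms X \<longleftrightarrow> s \<in> tms X \<and> t \<in> tms X"
  "RB s \<in> tms X \<longleftrightarrow> s \<in> tms X" "Df s \<in> tms X \<longleftrightarrow> s \<in> tms X"
  by (auto simp: tms_def)

lemma drb_class_eq_iff:
  "s \<in> tms X \<Longrightarrow> t \<in> tms X \<Longrightarrow> drb_class lam X s = drb_class lam X t \<longleftrightarrow> drb_eq lam s t"
  using eq_equiv_class_iff[OF equiv_drb_rel, of s X t lam]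
  by (auto simp: drb_rel_def drb_class_def)

lemma drb_class_UN:
  assumes "\<And>s. f s \<in> tms X \<longleftrightarrow> s \<in> tms X"
    and "\<And>s s'. drb_eq lam s s' \<Longrightarrow> drb_eq lam (f s) (f s')" and "s \<in> tms X"
  shows "(\<Union>s\<in>drb_class lam X s. drb_class lam X (f s)) = drb_class lam X (f s)"
  unfolding drb_class_def[of _ _ s]
  by (rule UN_equiv_class[OF equiv_drb_rel _ assms(3)], rule congruentI)
    (use assms in \<open>auto simp: drb_rel_def drb_class_eq_iff\<close>)

lemma drb_class_UN2:
  assumes "\<And>s t. f s t \<in> tms X \<longleftrightarrow> s \<in> tms X \<and> t \<in> tms X"
    and "\<And>s s' t t'. drb_eq lam s s' \<Longrightarrow> drb_eq lam t t' \<Longrightarrow> drb_eq lam (f s t) (f s' t')"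
    and "s \<in> tms X" "t \<in> tms X"
  shows "(\<Union>s\<in>drb_class lam X s. \<Union>t\<in>drb_class lam X t. drb_class lam X (f s t))
    = drb_class lam X (f s t)"
  unfolding drb_class_def[of _ _ s] drb_class_def[of _ _ t]
  by (rule UN_equiv_class2[OF equiv_drb_rel equiv_drb_rel _ assms(3,4)], rule congruent2I')
    (use assms in \<open>auto simp: drb_rel_def drb_class_eq_iff\<close>)

lemma DRBL_simps [simp]:
  "\<zero>\<^bsub>DRBL lam X\<^esub> = drb_class lam X Zero"
  "s \<in> tms X \<Longrightarrow> t \<in> tms X \<Longrightarrow>
    drb_class lam X s \<oplus>\<^bsub>DRBL lam X\<^esub> drb_class lam X t = drb_class lam X (Add s t)"
  "s \<in> tms X \<Longrightarrow> c \<odot>\<^bsub>DRBL lam X\<^esub> drb_class lam X s = drb_class lam X (Scale c s)"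
  "s \<in> tms X \<Longrightarrow> t \<in> tms X \<Longrightarrow>
    lie (DRBL lam X) (drb_class lam X s) (drb_class lam X t) = drb_class lam X (Lie s t)"
  "s \<in> tms X \<Longrightarrow> rb (DRBL lam X) (drb_class lam X s) = drb_class lam X (RB s)"
  "s \<in> tms X \<Longrightarrow> df (DRBL lam X) (drb_class lam X s) = drb_class lam X (Df s)"
  by (simp_all add: DRBL_def drb_class_UN drb_class_UN2 drb_eq.intros)

lemma carrier_DRBL: "carrier (DRBL lam X) = drb_class lam X ` tms X"
  by (auto simp: DRBL_def drb_class_def quotient_def)

lemma drb_eq_neg: "drb_eq lam (Add (Scale (- 1) s) s) Zero"
proof -
  have "drb_eq lam (Add (Scale (- 1) s) s) (Add (Scale (- 1) s) (Scale 1 s))"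
    by (intro drb_eq.Add_cong drb_eq.refl drb_eq.sym[OF drb_eq.Scale_1])
  moreover have "drb_eq lam (Add (Scale (- 1) s) (Scale 1 s)) (Scale (- 1 + 1) s)"
    by (rule drb_eq.sym[OF drb_eq.Scale_add_left])
  moreover have "drb_eq lam (Scale (- 1 + 1) s) Zero"
    using drb_eq.Scale_0 by simp
  ultimately show ?thesis by (blast intro: drb_eq.trans)
qed

lemmas drb_eq_axioms =
  drb_eq.Add_assoc drb_eq.Add_comm drb_eq.Add_Zero drb_eq.Scale_0 drb_eq.Scale_1
  drb_eq.Scale_Scale drb_eq.Scale_add_left drb_eq.Scale_add_right drb_eq.Lie_add_left
  drb_eq.Lie_add_right drb_eq.Lie_Scale_left drb_eq.Lie_Scale_right drb_eq.Lie_self drb_eq.Jacobi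
  drb_eq.RB_Add drb_eq.RB_Scale drb_eq.Df_Add drb_eq.Df_Scale drb_eq.Rota_Baxter drb_eq.Leibniz
  drb_eq.Df_RB

theorem DRBL_algebra: "diff_lie_rb_algebra lam (DRBL lam X)"
proof -
  have neg: "\<exists>y\<in>tms X. drb_eq lam (Add y s) Zero" if "s \<in> tms X" for s
    using that drb_eq_neg by (intro bexI[of _ "Scale (- 1) s"]) auto
  have "abelian_group (DRBL lam X)"
    by (rule abelian_groupI)
      (auto simp: carrier_DRBL drb_class_eq_iff drb_eq_axioms neg
        intro!: drb_class_eq_iff[THEN iffD2] del: equalityI)
  then have "module (class_ring :: 'a ring) (DRBL lam X)"
    by (intro moduleI class_cring.is_cring)
      (auto simp: carrier_DRBL drb_class_eq_iff drb_eq_axioms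
        intro!: drb_class_eq_iff[THEN iffD2] del: equalityI)
  then have "vectorspace (class_ring :: 'a ring) (DRBL lam X)"
    by (intro vectorspace.intro class_field.field_axioms)
  then show ?thesis
    by (intro diff_lie_rb_algebra.intro diff_lie_rb_algebra_axioms.intro)
      (auto simp: carrier_DRBL drb_class_eq_iff drb_eq_axioms
        intro!: drb_class_eq_iff[THEN iffD2] del: equalityI)
qed

primrec tm_eval :: "('k, 'a, 'm) drb_alg_scheme \<Rightarrow> ('x \<Rightarrow> 'a) \<Rightarrow> ('k, 'x) tm \<Rightarrow> 'a" where
  "tm_eval M f (Gen x) = f x"
| "tm_eval M f Zero = \<zero>\<^bsub>M\<^esub>"
| "tm_eval M f (Add s t) = tm_eval M f s \<oplus>\<^bsub>M\<^esub> tm_eval M f t"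
| "tm_eval M f (Scale c s) = c \<odot>\<^bsub>M\<^esub> tm_eval M f s"
| "tm_eval M f (Lie s t) = lie M (tm_eval M f s) (tm_eval M f t)"
| "tm_eval M f (RB s) = rb M (tm_eval M f s)"
| "tm_eval M f (Df s) = df M (tm_eval M f s)"

context diff_lie_rb_algebra
begin

lemma tm_eval_closed:
  assumes "range f \<subseteq> carrier L"
  shows "tm_eval L f s \<in> carrier L"
  using assms
  by (induction s) (auto simp: lie_closed rb_closed df_closed intro!: smult_closed)

lemma tm_eval_sound:
  assumes f: "range f \<subseteq> carrier L" and "drb_eq lam s t"
  shows "tm_eval L f s = tm_eval L f t"
  using assms(2)
proof induction
  case (Add_assoc s t u)
  then show ?case by (simp add: tm_eval_closed[OF f] a_assoc)
next
  case (Add_comm s t)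
  then show ?case by (simp add: tm_eval_closed[OF f] a_comm)
next
  case (Scale_0 s)
  then show ?case using smult_l_null[OF tm_eval_closed[OF f, of s]] by simp
next
  case (Scale_1 s)
  then show ?case using smult_one[OF tm_eval_closed[OF f, of s]] by simp
next
  case (Scale_Scale a b s)
  then show ?case using smult_assoc1[OF _ _ tm_eval_closed[OF f, of s], of a b] by simp
next
  case (Scale_add_left a b s)
  then show ?case using smult_l_distr[OF _ _ tm_eval_closed[OF f, of s], of a b] by simp
next
  case (Scale_add_right a s t)
  then show ?case
    using smult_r_distr[OF _ tm_eval_closed[OF f, of s] tm_eval_closed[OF f, of t], of a] by simp
qed (simp_all add: tm_eval_closed[OF f] lie_add_left lie_add_right lie_smult_left lie_smult_right
    lie_self jacobi rb_add rb_smult df_add df_smult rota_baxter leibniz df_rb)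

end

theorem DRBL_free:
  fixes M :: "('k::field, 'a, 'm) drb_alg_scheme"
  assumes M: "diff_lie_rb_algebra lam M" and f: "f \<in> X \<rightarrow> carrier M"
  shows "\<exists>h\<in>drb_hom (DRBL lam X) M. (\<forall>x\<in>X. h (gen lam X x) = f x) \<and>
    (\<forall>h'\<in>drb_hom (DRBL lam X) M. (\<forall>x\<in>X. h' (gen lam X x) = f x) \<longrightarrow>
       (\<forall>A\<in>carrier (DRBL lam X). h' A = h A))"
proof -
  interpret M: diff_lie_rb_algebra lam M by (rule M)
  define g where "g x = (if x \<in> X then f x else \<zero>\<^bsub>M\<^esub>)" for x
  have g: "range g \<subseteq> carrier M" using f by (auto simp: g_def)
  define h where "h A = tm_eval M g (SOME s. s \<in> tms X \<and> A = drb_class lam X s)" for A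
  have h: "h (drb_class lam X s) = tm_eval M g s" if "s \<in> tms X" for s
  proof -
    define t where "t = (SOME t. t \<in> tms X \<and> drb_class lam X s = drb_class lam X t)"
    have "t \<in> tms X \<and> drb_class lam X s = drb_class lam X t"
      unfolding t_def by (rule someI[of _ s]) (simp add: that)
    then have "drb_eq lam s t" using that drb_class_eq_iff by blast
    then show ?thesis using M.tm_eval_sound[OF g] by (simp add: h_def t_def)
  qed
  have 1: "h \<in> drb_hom (DRBL lam X) M"
    by (auto simp: drb_hom_def carrier_DRBL h M.tm_eval_closed[OF g])
  have 2: "\<forall>x\<in>X. h (gen lam X x) = f x"
    by (simp add: gen_def h g_def)
  have 3: "h' (drb_class lam X s) = tm_eval M g s"
    if h': "h' \<in> drb_hom (DRBL lam X) M" "\<forall>x\<in>X. h' (gen lam X x) = f x" and "s \<in> tms X" for h' s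
    using \<open>s \<in> tms X\<close>
  proof (induction s)
    case (Gen x)
    then show ?case using h'(2) by (simp add: gen_def g_def)
  next
    case Zero
    have "h' (0 \<odot>\<^bsub>DRBL lam X\<^esub> drb_class lam X Zero) = 0 \<odot>\<^bsub>M\<^esub> h' (drb_class lam X Zero)"
      and cl: "h' (drb_class lam X Zero) \<in> carrier M"
      using h'(1) by (auto simp: drb_hom_def carrier_DRBL Pi_iff)
    moreover have "drb_class lam X (Scale 0 Zero) = drb_class lam X Zero"
      by (simp add: drb_class_eq_iff drb_eq.Scale_0)
    ultimately show ?case using M.smult_l_null[OF cl] by simp
  next
    case (Add s t)
    have "h' (drb_class lam X s \<oplus>\<^bsub>DRBL lam X\<^esub> drb_class lam X t)
        = h' (drb_class lam X s) \<oplus>\<^bsub>M\<^esub> h' (drb_class lam X t)"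
      using h'(1) Add.prems by (simp add: drb_hom_def carrier_DRBL del: DRBL_simps)
    then show ?case using Add by simp
  next
    case (Scale c s)
    have "h' (c \<odot>\<^bsub>DRBL lam X\<^esub> drb_class lam X s) = c \<odot>\<^bsub>M\<^esub> h' (drb_class lam X s)"
      using h'(1) Scale.prems by (simp add: drb_hom_def carrier_DRBL del: DRBL_simps)
    then show ?case using Scale by simp
  next
    case (Lie s t)
    have "h' (lie (DRBL lam X) (drb_class lam X s) (drb_class lam X t))
        = lie M (h' (drb_class lam X s)) (h' (drb_class lam X t))"
      using h'(1) Lie.prems by (simp add: drb_hom_def carrier_DRBL del: DRBL_simps)
    then show ?case using Lie by simp
  next
    case (RB s)
    have "h' (rb (DRBL lam X) (drb_class lam X s)) = rb M (h' (drb_class lam X s))"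
      using h'(1) RB.prems by (simp add: drb_hom_def carrier_DRBL del: DRBL_simps)
    then show ?case using RB by simp
  next
    case (Df s)
    have "h' (df (DRBL lam X) (drb_class lam X s)) = df M (h' (drb_class lam X s))"
      using h'(1) Df.prems by (simp add: drb_hom_def carrier_DRBL del: DRBL_simps)
    then show ?case using Df by simp
  qed
  show ?thesis
    by (rule bexI[OF _ 1]) (use 2 3 h in \<open>auto simp: carrier_DRBL\<close>)
qed


section \<open>Words\<close>

text \<open>Words are lists of prime words over an alphabet of type \<^typ>\<open>'a\<close>. A letter \<open>D\<^sup>m(x)\<close> is the
  pair \<open>(m, x)\<close>; for words with a hole the alphabet is \<^typ>\<open>(nat \<times> 'x) option\<close> with \<open>None\<close> as the
  symbol \<open>\<star>\<close>.\<close>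

datatype 'a prime_word = Letter 'a | PW "'a prime_word list"

type_synonym 'a opword = "'a prime_word list"

definition Delta :: "'x set \<Rightarrow> (nat \<times> 'x) set"
  where "Delta X = UNIV \<times> X"

definition nonempty_words :: "'y set \<Rightarrow> 'y list set"
  where "nonempty_words Y = {w. w \<noteq> [] \<and> set w \<subseteq> Y}"

primrec opwords_upto :: "'a set \<Rightarrow> nat \<Rightarrow> 'a opword set" where
  "opwords_upto Z 0 = nonempty_words (Letter ` Z)"
| "opwords_upto Z (Suc n) = nonempty_words (Letter ` Z \<union> PW ` opwords_upto Z n)"

definition opwords :: "'a set \<Rightarrow> 'a opword set"
  where "opwords Z = (\<Union>n. opwords_upto Z n)"

primrec stars :: "'a option prime_word \<Rightarrow> nat" where
  "stars (Letter a) = (if a = None then 1 else 0)"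
| "stars (PW w) = sum_list (map stars w)"

definition star_words :: "'x set \<Rightarrow> (nat \<times> 'x) option opword set"
  where "star_words X =
    {\<pi> \<in> opwords (insert None (Some ` Delta X)). sum_list (map stars \<pi>) = 1}"

primrec plug_prime :: "'a opword \<Rightarrow> 'a option prime_word \<Rightarrow> 'a opword" where
  "plug_prime u (Letter a) = (case a of None \<Rightarrow> u | Some d \<Rightarrow> [Letter d])"
| "plug_prime u (PW w) = [PW (concat (map (plug_prime u) w))]"

definition plug :: "'a option opword \<Rightarrow> 'a opword \<Rightarrow> 'a opword"
  where "plug \<pi> u = concat (map (plug_prime u) \<pi>)"


section \<open>The order\<close>

primrec pdeg :: "(nat \<times> 'x) prime_word \<Rightarrow> nat" where
  "pdeg (Letter d) = fst d + 1"
| "pdeg (PW w) = sum_list (map pdeg w) + 1"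

definition wdeg :: "(nat \<times> 'x) opword \<Rightarrow> nat"
  where "wdeg w = sum_list (map pdeg w)"

text \<open>\<open>word_gt\<close> is \<open>>\<^sub>D\<^sub>l\<close> and \<open>prime_gt\<close> is the comparison of primes used in it. The argument of
  \<open>D\<close> in \<open>D\<^sup>m\<^sup>+\<^sup>1(x) = D(D\<^sup>m(x))\<close> is the one-letter word \<open>D\<^sup>m(x)\<close>.\<close>

inductive prime_gt :: "(nat \<times> 'x::wellorder) prime_word \<Rightarrow> (nat \<times> 'x) prime_word \<Rightarrow> bool"
  and word_gt :: "(nat \<times> 'x) opword \<Rightarrow> (nat \<times> 'x) opword \<Rightarrow> bool" where
  prime_deg: "pdeg p > pdeg q \<Longrightarrow> prime_gt p q"
| prime_gen: "x > y \<Longrightarrow> prime_gt (Letter (0, x)) (Letter (0, y))"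
| prime_P_D: "pdeg (PW a) = pdeg (Letter (Suc m, x)) \<Longrightarrow> prime_gt (PW a) (Letter (Suc m, x))"
| prime_P_P: "pdeg (PW a) = pdeg (PW b) \<Longrightarrow> word_gt a b \<Longrightarrow> prime_gt (PW a) (PW b)"
| prime_D_D: "pdeg (Letter (Suc m, x)) = pdeg (Letter (Suc n, y)) \<Longrightarrow>
    word_gt [Letter (m, x)] [Letter (n, y)] \<Longrightarrow>
    prime_gt (Letter (Suc m, x)) (Letter (Suc n, y))"
| word_deg: "wdeg u > wdeg v \<Longrightarrow> word_gt u v"
| word_bre: "wdeg u = wdeg v \<Longrightarrow> length u > length v \<Longrightarrow> word_gt u v"
| word_lex: "wdeg u = wdeg v \<Longrightarrow> length u = length v \<Longrightarrow>
    u = c @ p # u' \<Longrightarrow> v = c @ q # v' \<Longrightarrow> prime_gt p q \<Longrightarrow> word_gt u v"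

definition succ_prime :: "(nat \<times> 'x::wellorder) prime_word \<Rightarrow> (nat \<times> 'x) prime_word \<Rightarrow> bool"
  where "succ_prime p q \<longleftrightarrow> word_gt [p] [q]"


section \<open>Lyndon-Shirshov words\<close>

text \<open>The empty word is the largest one, so a proper prefix of a word is larger than the word.\<close>

fun lex_gt :: "('y \<Rightarrow> 'y \<Rightarrow> bool) \<Rightarrow> 'y list \<Rightarrow> 'y list \<Rightarrow> bool" where
  "lex_gt gt u [] = False"
| "lex_gt gt [] (b # v) = True"
| "lex_gt gt (a # u) (b # v) = (gt a b \<or> a = b \<and> lex_gt gt u v)"

definition ALSW :: "('y \<Rightarrow> 'y \<Rightarrow> bool) \<Rightarrow> 'y set \<Rightarrow> 'y list set" where
  "ALSW gt Y = {w \<in> nonempty_words Y.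
     \<forall>u v. w = u @ v \<longrightarrow> u \<noteq> [] \<longrightarrow> v \<noteq> [] \<longrightarrow> lex_gt gt (u @ v) (v @ u)}"

datatype 'y bracketing = Atom 'y | Br "'y bracketing" "'y bracketing"

primrec und :: "'y bracketing \<Rightarrow> 'y list" where
  "und (Atom a) = [a]"
| "und (Br s t) = und s @ und t"

fun is_NLSW :: "('y \<Rightarrow> 'y \<Rightarrow> bool) \<Rightarrow> 'y set \<Rightarrow> 'y bracketing \<Rightarrow> bool" where
  "is_NLSW gt Y (Atom a) \<longleftrightarrow> und (Atom a) \<in> ALSW gt Y"
| "is_NLSW gt Y (Br v w) \<longleftrightarrow> und (Br v w) \<in> ALSW gt Y \<and> is_NLSW gt Y v \<and> is_NLSW gt Y w \<and>
     (\<forall>v1 v2. v = Br v1 v2 \<longrightarrow> und v2 = und w \<or> lex_gt gt (und w) (und v2))"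

definition shirshov :: "('y \<Rightarrow> 'y \<Rightarrow> bool) \<Rightarrow> 'y list \<Rightarrow> 'y bracketing"
  where "shirshov gt u = (THE t. is_NLSW gt (set u) t \<and> und t = u)"

primrec alsw_upto :: "'x::wellorder set \<Rightarrow> nat \<Rightarrow> (nat \<times> 'x) opword set" where
  "alsw_upto X 0 = ALSW succ_prime (Letter ` Delta X)"
| "alsw_upto X (Suc n) = ALSW succ_prime (Letter ` Delta X \<union> PW ` alsw_upto X n)"

definition alsw :: "'x::wellorder set \<Rightarrow> (nat \<times> 'x) opword set"
  where "alsw X = (\<Union>n. alsw_upto X n)"

datatype 'a bword = BLetter 'a | BP "'a bword" | BLie "'a bword" "'a bword"

primrec graft :: "'a bword bracketing \<Rightarrow> 'a bword" where
  "graft (Atom t) = t"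
| "graft (Br s t) = BLie (graft s) (graft t)"

text \<open>The argument lists each prime \<open>u\<^sub>i\<close> of a word with its bracketing \<open>[u\<^sub>i]\<close>; the
  letters \<open>[u\<^sub>i]\<close> are compared as the \<open>u\<^sub>i\<close> are.\<close>

definition assemble :: "((nat \<times> 'x::wellorder) prime_word \<times> (nat \<times> 'x) bword) list \<Rightarrow>
    (nat \<times> 'x) bword"
  where "assemble ps =
    graft (map_bracketing snd (shirshov (\<lambda>a b. succ_prime (fst a) (fst b)) ps))"

fun bracket_prime :: "(nat \<times> 'x::wellorder) prime_word \<Rightarrow> (nat \<times> 'x) bword" where
  "bracket_prime (Letter d) = BLetter d"
| "bracket_prime (PW w) = BP (assemble (map (\<lambda>p. (p, bracket_prime p)) w))"

definition bracket :: "(nat \<times> 'x::wellorder) opword \<Rightarrow> (nat \<times> 'x) bword"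
  where "bracket w = assemble (map (\<lambda>p. (p, bracket_prime p)) w)"

definition Irr :: "'x::wellorder set \<Rightarrow> (nat \<times> 'x) bword set" where
  "Irr X = {bracket w | w. w \<in> alsw X \<and>
     (\<forall>\<pi>\<in>star_words X. \<forall>u\<in>alsw X. \<forall>v\<in>alsw X. word_gt u v \<longrightarrow> w \<noteq> plug \<pi> [PW u, PW v])}"

primrec beval :: "('k, 'a, 'm) drb_alg_scheme \<Rightarrow> ('x \<Rightarrow> 'a) \<Rightarrow> (nat \<times> 'x) bword \<Rightarrow> 'a" where
  "beval L f (BLetter d) = (df L ^^ fst d) (f (snd d))"
| "beval L f (BP t) = rb L (beval L f t)"
| "beval L f (BLie s t) = lie L (beval L f s) (beval L f t)"

end

(* Put {x, y} = [P x, y] + [x, P y] + lam [x, y] on the free algebra F. The words are compared in the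
   classical way, so that the reducible words are those with an ascent P(u)P(v) at some depth.

   Spanning: [[u], [v]] with u < v is expanded as for the Lyndon basis of a free Lie algebra, by the
   Jacobi identity along standard factorizations. The only new case is that u v is a standard
   factorization with an ascent at the junction. Then u = P(p) is a letter; either v = P(q), and
   [P p, P q] = P {p, q} has fewer letters and reduces to a bracket of lower degree, or ad u is
   distributed over the standard factors of v. Both increase u v or shorten it.

   Independence: {x, y} = D [P x, P y] is a Lie bracket on F. Let U be the product of the enveloping
   algebra of (F, { , }) with the free associative algebra on the letters D^m(x). By
   Poincare-Birkhoff-Witt, words without ascents in these letters and a basis of F are independent
   in U. To obtain a homomorphism F -> U with D^m(x) -> D^m(x) and P(f) -> f, the product of F and the
   Hurwitz series over U is made a differential Lie Rota-Baxter algebra, where P(f, s) is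
   (P f, (f, s_0, s_1, ...)) and D shifts. The image of [w] has leading term w as soon as the
   letters P(v) of w come from basis elements [v]; as deg v < deg w, this allows an induction on
   the degree, extending the independent set of each step to a basis of F. *)

theory Submission
  imports Defs "HOL-Library.Poly_Mapping" "HOL-Library.Function_Algebras"
begin

text \<open>Normal forms in an enveloping algebra can be sorted in either direction. Turning ascents
  into descents raises a word classically, and a Lyndon word is smaller than its rotations. So in
  \<open>u v - v u\<close> the word \<open>u v\<close> comes before everything that rewriting makes
  of \<open>v u\<close>; sorting the other way would destroy these leading terms.
  Poincare-Birkhoff-Witt asks for a basis of F, which is the very thing sought. The circle is broken
  because only the letters P(v) of the words under test need a known v in the basis; how the basis
  continues is left to Zorn's lemma. U carries no operators D and P. For series over U the shift
  serves as D, and P has to put a constant term in front of a series. If that term is iota(f), the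
  Rota-Baxter identity at index 0 reads [iota(f), iota(g)] = iota({f, g}): this is the origin of { ,
  }, and since iota(f) depends on f, the factor F has to be carried along.\<close>

section \<open>Lyndon words\<close>

text \<open>\<open>lex_gt gt\<close> is the classical lexicographic order in which \<open>gt a b\<close> means that \<open>a\<close> is the smaller
  letter, and a proper prefix is smaller. Read this way, \<open>lyndon\<close> is the classical notion, and
  \<open>\<sqsubset>\<close> and \<open>\<lless>\<close> below point from the smaller word to the larger one.\<close>

definition lex_diff :: "('y \<Rightarrow> 'y \<Rightarrow> bool) \<Rightarrow> 'y list \<Rightarrow> 'y list \<Rightarrow> bool" where
  "lex_diff gt u v \<longleftrightarrow> (\<exists>c a b u' v'. u = c @ a # u' \<and> v = c @ b # v' \<and> gt a b)"

lemma lex_diff_Nil [simp]: "\<not> lex_diff gt [] v" "\<not> lex_diff gt u []"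
  by (auto simp: lex_diff_def)

lemma lex_diff_Cons:
  "lex_diff gt (a # u) (b # v) \<longleftrightarrow> gt a b \<or> a = b \<and> lex_diff gt u v"
proof
  assume "lex_diff gt (a # u) (b # v)"
  then obtain c x y u' v' where "a # u = c @ x # u'" "b # v = c @ y # v'" "gt x y"
    unfolding lex_diff_def by blast
  then show "gt a b \<or> a = b \<and> lex_diff gt u v"
    unfolding lex_diff_def by (cases c) auto
next
  assume "gt a b \<or> a = b \<and> lex_diff gt u v"
  then show "lex_diff gt (a # u) (b # v)"
  proof
    assume "gt a b"
    then show ?thesis unfolding lex_diff_def by (intro exI[of _ "[]"]) auto
  next
    assume "a = b \<and> lex_diff gt u v"
    then obtain c x y u' v' where "a = b" "u = c @ x # u'" "v = c @ y # v'" "gt x y"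
      unfolding lex_diff_def by blast
    then show ?thesis unfolding lex_diff_def by (intro exI[of _ "a # c"]) auto
  qed
qed

lemma lex_gt_iff: "lex_gt gt u v \<longleftrightarrow> lex_diff gt u v \<or> (\<exists>b r. v = u @ b # r)"
  by (induction gt u v rule: lex_gt.induct) (auto simp: lex_diff_Cons)

text \<open>The first difference survives whatever is appended, whereas a comparison by proper
  prefix may be reversed. Hence the stronger relation is kept wherever words are going to be
  extended.\<close>

lemma lex_diff_append: "lex_diff gt u v \<Longrightarrow> lex_diff gt (u @ x) (v @ y)"
  unfolding lex_diff_def by fastforce

lemma lex_diff_prepend: "lex_diff gt u v \<Longrightarrow> lex_diff gt (c @ u) (c @ v)"
  by (induction c) (auto simp: lex_diff_Cons)

lemma lex_diff_imp_gt: "lex_diff gt u v \<Longrightarrow> lex_gt gt u v"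
  by (simp add: lex_gt_iff)

lemma lex_gt_prefix: "r \<noteq> [] \<Longrightarrow> lex_gt gt u (u @ r)"
  by (cases r) (auto simp: lex_gt_iff)

lemma lex_gt_imp_diff: "lex_gt gt u v \<Longrightarrow> length v \<le> length u \<Longrightarrow> lex_diff gt u v"
  by (auto simp: lex_gt_iff)

lemma lex_gt_append: "lex_gt gt u v \<Longrightarrow> length v \<le> length u \<Longrightarrow> lex_diff gt (u @ x) (v @ y)"
  by (auto intro!: lex_diff_append dest: lex_gt_imp_diff)

lemma lex_gt_prepend: "lex_gt gt u v \<Longrightarrow> lex_gt gt (c @ u) (c @ v)"
  by (auto simp: lex_gt_iff lex_diff_prepend)

definition lyndon :: "('y \<Rightarrow> 'y \<Rightarrow> bool) \<Rightarrow> 'y list \<Rightarrow> bool" where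
  "lyndon gt w \<longleftrightarrow> w \<noteq> [] \<and> (\<forall>u v. w = u @ v \<longrightarrow> u \<noteq> [] \<longrightarrow> v \<noteq> [] \<longrightarrow> lex_gt gt (u @ v) (v @ u))"

lemma ALSW_iff: "w \<in> ALSW gt Y \<longleftrightarrow> set w \<subseteq> Y \<and> lyndon gt w"
  by (auto simp: ALSW_def lyndon_def nonempty_words_def)

lemma lyndon_single [simp]: "lyndon gt [a]"
  by (auto simp: lyndon_def append_eq_Cons_conv Cons_eq_append_conv)

lemma und_nonempty [simp]: "und t \<noteq> []"
  by (induction t) auto

locale letter_order =
  fixes gt :: "'y \<Rightarrow> 'y \<Rightarrow> bool" and Y :: "'y set"
  assumes gt_irrefl: "\<not> gt a a"
    and gt_trans: "gt a b \<Longrightarrow> gt b c \<Longrightarrow> gt a c"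
    and gt_total: "a \<in> Y \<Longrightarrow> b \<in> Y \<Longrightarrow> a = b \<or> gt a b \<or> gt b a"
begin

abbreviation lex_less :: "'y list \<Rightarrow> 'y list \<Rightarrow> bool" (infix "\<sqsubset>" 50) where "u \<sqsubset> v \<equiv> lex_gt gt u v"
abbreviation diff_less :: "'y list \<Rightarrow> 'y list \<Rightarrow> bool" (infix "\<lless>" 50) where "u \<lless> v \<equiv> lex_diff gt u v"

lemma lex_irrefl: "\<not> u \<sqsubset> u"
  by (induction u) (auto simp: gt_irrefl)

lemma lex_trans: "u \<sqsubset> v \<Longrightarrow> v \<sqsubset> w \<Longrightarrow> u \<sqsubset> w"
proof (induction u arbitrary: v w)
  case Nil
  then show ?case by (cases v; cases w) auto
next
  case (Cons a u)
  then show ?case by (cases v; cases w) (auto intro: gt_trans)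
qed

lemma lex_total: "set u \<subseteq> Y \<Longrightarrow> set v \<subseteq> Y \<Longrightarrow> u = v \<or> u \<sqsubset> v \<or> v \<sqsubset> u"
proof (induction u arbitrary: v)
  case Nil
  then show ?case by (cases v) auto
next
  case (Cons a u)
  show ?case
  proof (cases v)
    case (Cons b v')
    with Cons.prems gt_total[of a b] Cons.IH[of v'] show ?thesis by auto
  qed simp
qed

lemma lex_asym: "u \<sqsubset> v \<Longrightarrow> \<not> v \<sqsubset> u"
  using lex_irrefl lex_trans by blast

lemma diff_gt_trans: "u \<lless> v \<Longrightarrow> v \<sqsubset> w \<Longrightarrow> u \<lless> w"
proof (induction u arbitrary: v w)
  case (Cons a u)
  then show ?case by (cases v; cases w) (auto simp: lex_diff_Cons intro: gt_trans)
qed simp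

lemma diff_trans: "u \<lless> v \<Longrightarrow> v \<lless> w \<Longrightarrow> u \<lless> w"
  using diff_gt_trans lex_diff_imp_gt by blast

lemma lex_gt_prepend_iff: "c @ u \<sqsubset> c @ v \<longleftrightarrow> u \<sqsubset> v"
  by (induction c) (auto simp: gt_irrefl)

lemma lex_diff_prepend_iff: "c @ u \<lless> c @ v \<longleftrightarrow> u \<lless> v"
  by (induction c) (auto simp: lex_diff_Cons gt_irrefl)

text \<open>A Lyndon word has no border, so it already differs from each of its proper suffixes.\<close>

lemma lyndon_suffix:
  assumes "lyndon gt (u @ v)" "u \<noteq> []" "v \<noteq> []"
  shows "u @ v \<lless> v"
proof -
  have rot: "u @ v \<sqsubset> v @ u" using assms by (auto simp: lyndon_def)
  \<comment> \<open>If \<open>u v = v t\<close>, the rotation of \<open>u v\<close> at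
    \<open>v\<close> gives \<open>u = t\<close> or \<open>u \<sqsubset> t\<close>, and the rotation
    at \<open>u\<close>, with \<open>v\<close> cancelled, gives
    \<open>t \<sqsubset> u\<close>.\<close>
  have no_border: False if "u @ v = v @ t" for t
  proof -
    have len: "length t = length u" using arg_cong[OF that, of length] by simp
    then have "t \<noteq> []" using assms by auto
    then have "v @ t \<sqsubset> t @ v" using assms that unfolding lyndon_def by metis
    then have "u @ v \<sqsubset> t @ v" using that by simp
    then have "u = t \<or> u \<lless> t"
      using len by (auto simp: lex_gt_iff lex_diff_def append_eq_append_conv2 append_eq_Cons_conv Cons_eq_append_conv gt_irrefl)
    moreover have "t \<sqsubset> u" using rot that by (simp add: lex_gt_prepend_iff)
    ultimately show False using lex_asym lex_irrefl lex_diff_imp_gt by blast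
  qed
  have "u @ v \<lless> v @ u" using rot by (rule lex_gt_imp_diff) simp
  then obtain c a b u' v' where c: "u @ v = c @ a # u'" "v @ u = c @ b # v'" "gt a b"
    unfolding lex_diff_def by blast
  show ?thesis
  proof (cases "length c < length v")
    case True
    then have "v = c @ b # take (length v - Suc (length c)) v'"
      using arg_cong[OF c(2), of "take (length v)"] by (auto simp: take_Cons' )
    then show ?thesis using c unfolding lex_diff_def by blast
  next
    case False
    then have "take (length v) (u @ v) = v"
      using arg_cong[OF c(2), of "take (length v)"] c(1) by simp
    then show ?thesis using no_border by (metis append_take_drop_id)
  qed
qed

lemma lyndonI:
  assumes "w \<noteq> []" "\<And>u v. w = u @ v \<Longrightarrow> u \<noteq> [] \<Longrightarrow> v \<noteq> [] \<Longrightarrow> w \<sqsubset> v"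
  shows "lyndon gt w"
  unfolding lyndon_def
proof (intro conjI allI impI assms(1))
  fix u v assume "w = u @ v" "u \<noteq> []" "v \<noteq> []"
  moreover from this have "w \<sqsubset> v" by (rule assms(2))
  ultimately show "u @ v \<sqsubset> v @ u"
    using lex_gt_append[of gt "u @ v" v "[]" u] by (auto intro: lex_diff_imp_gt)
qed

text \<open>When \<open>v = u r\<close>, cancelling \<open>u\<close> leaves the comparison of
  \<open>v\<close> with its suffix \<open>r\<close>, which holds because \<open>v\<close> is Lyndon.
  A suffix of \<open>u v\<close> that starts inside \<open>u\<close> is decided by a suffix of
  \<open>u\<close>, any other one by passing through \<open>v\<close>.\<close>

lemma lyndon_concat:
  assumes u: "lyndon gt u" and v: "lyndon gt v" and uv: "u \<sqsubset> v"
  shows "u @ v \<lless> v" and "lyndon gt (u @ v)"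
proof -
  have ne: "u \<noteq> []" "v \<noteq> []" using u v by (auto simp: lyndon_def)
  show 1: "u @ v \<lless> v"
  proof (cases "u \<lless> v")
    case True
    then show ?thesis using lex_diff_append[of gt u v v "[]"] by simp
  next
    case False
    then obtain r where r: "v = u @ r" "r \<noteq> []" using uv by (auto simp: lex_gt_iff)
    then have "v \<lless> r" using lyndon_suffix[of u r] v ne by simp
    then show ?thesis using r by (simp add: lex_diff_prepend_iff)
  qed
  show "lyndon gt (u @ v)"
  proof (rule lyndonI)
    fix p s assume ps: "u @ v = p @ s" "p \<noteq> []" "s \<noteq> []"
    then consider (a) r where "u = p @ r" "s = r @ v" | (b) r where "p = u @ r" "v = r @ s"
      by (auto simp: append_eq_append_conv2)
    then show "u @ v \<sqsubset> s"
    proof cases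
      case a
      then show ?thesis
      proof (cases "r = []")
        case True
        then show ?thesis using a 1 by (auto intro: lex_diff_imp_gt)
      next
        case False
        then have "u \<lless> r" using lyndon_suffix[of p r] u ps a by simp
        then show ?thesis
          using lex_diff_append[of gt u r v v] a(2) by (simp add: lex_diff_imp_gt)
      qed
    next
      case b
      then show ?thesis
      proof (cases "r = []")
        case True
        then show ?thesis using b 1 by (auto intro: lex_diff_imp_gt)
      next
        case False
        then have "v \<lless> s" using lyndon_suffix[of r s] v ps b by simp
        then show ?thesis using 1 diff_trans lex_diff_imp_gt by blast
      qed
    qed
  qed (use ne in simp)
qed

lemma lyndon_concat_rot:
  assumes "lyndon gt u" "lyndon gt v" "u \<sqsubset> v"
  shows "u @ v \<sqsubset> v @ u"
  using lyndon_concat[OF assms] assms(1,2) unfolding lyndon_def[of gt "u @ v"]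
  by (auto simp: lyndon_def)

text \<open>The standard factorization of a Lyndon word splits off its least proper suffix.\<close>

definition min_suffix :: "'y list \<Rightarrow> 'y list \<Rightarrow> bool" where
  "min_suffix v w \<longleftrightarrow> (\<exists>u. u \<noteq> [] \<and> v \<noteq> [] \<and> w = u @ v) \<and>
     (\<forall>p s. w = p @ s \<longrightarrow> p \<noteq> [] \<longrightarrow> s \<noteq> [] \<longrightarrow> s = v \<or> v \<sqsubset> s)"

lemma min_suffix_unique:
  assumes "min_suffix v w" "min_suffix v' w"
  shows "v = v'"
  using assms lex_asym unfolding min_suffix_def by metis

text \<open>The only proper suffix of \<open>a # w\<close> that is not one of \<open>w\<close> is
  \<open>w\<close> itself, so the smaller of \<open>w\<close> and its least proper suffix is the
  least one.\<close>

lemma min_suffix_exists: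
  assumes "length w \<ge> 2" "set w \<subseteq> Y"
  shows "\<exists>v. min_suffix v w"
  using assms
proof (induction w)
  case (Cons a w)
  show ?case
  proof (cases "length w \<ge> 2")
    case True
    then obtain v where v: "min_suffix v w" using Cons by auto
    then have sub: "set v \<subseteq> Y" "set w \<subseteq> Y" "w \<noteq> []"
      using Cons.prems by (auto simp: min_suffix_def)
    then consider "w = v \<or> v \<sqsubset> w" | "w \<sqsubset> v" using lex_total[of v w] by auto
    then show ?thesis
    proof cases
      case 1
      have "min_suffix v (a # w)"
        unfolding min_suffix_def
      proof (intro conjI allI impI)
        from v obtain u where "v \<noteq> []" "w = u @ v" by (auto simp: min_suffix_def)
        then show "\<exists>u. u \<noteq> [] \<and> v \<noteq> [] \<and> a # w = u @ v" by (intro exI[of _ "a # u"]) simp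
        fix p s assume "a # w = p @ s" "p \<noteq> []" "s \<noteq> []"
        then obtain p' where "w = p' @ s" by (auto simp: Cons_eq_append_conv)
        then show "s = v \<or> v \<sqsubset> s" using 1 v \<open>s \<noteq> []\<close>
          by (cases "p' = []") (auto simp: min_suffix_def)
      qed
      then show ?thesis ..
    next
      case 2
      have "min_suffix w (a # w)"
        unfolding min_suffix_def
      proof (intro conjI allI impI)
        show "\<exists>u. u \<noteq> [] \<and> w \<noteq> [] \<and> a # w = u @ w" using sub by (intro exI[of _ "[a]"]) simp
        fix p s assume "a # w = p @ s" "p \<noteq> []" "s \<noteq> []"
        then obtain p' where "w = p' @ s" by (auto simp: Cons_eq_append_conv)
        then have "s = w \<or> s = v \<or> v \<sqsubset> s" using v \<open>s \<noteq> []\<close>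
          by (cases "p' = []") (auto simp: min_suffix_def)
        then show "s = w \<or> w \<sqsubset> s" using 2 lex_trans by blast
      qed
      then show ?thesis ..
    qed
  next
    case False
    then obtain b where b: "w = [b]" using Cons.prems by (cases w; cases "tl w") auto
    have "min_suffix [b] (a # w)"
      unfolding min_suffix_def b
      by (auto simp: Cons_eq_append_conv intro!: exI[of _ "[a]"])
    then show ?thesis ..
  qed
qed simp

lemma min_suffix_lyndon:
  assumes ms: "min_suffix v (u @ v)" and u: "u \<noteq> []"
  shows "lyndon gt v"
proof (rule lyndonI)
  show "v \<noteq> []" using ms by (auto simp: min_suffix_def)
  fix p s assume "v = p @ s" "p \<noteq> []" "s \<noteq> []"
  then have "u @ v = (u @ p) @ s" "u @ p \<noteq> []" by auto
  then have "s = v \<or> v \<sqsubset> s" using ms \<open>s \<noteq> []\<close> unfolding min_suffix_def by blast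
  then show "v \<sqsubset> s" using \<open>v = p @ s\<close> \<open>p \<noteq> []\<close> by auto
qed

text \<open>Let a proper suffix \<open>s\<close> of \<open>u\<close> not be above \<open>u\<close>.
  If the two differ, \<open>s v\<close> lies below \<open>u v\<close>. If \<open>u = s r\<close>,
  cancelling \<open>s\<close> in \<open>u v \<lless> s v\<close> puts the suffix \<open>r v\<close>
  below the least suffix \<open>v\<close>.\<close>

lemma min_suffix_lyndon_left:
  assumes ms: "min_suffix v (u @ v)" and u: "u \<noteq> []" and w: "lyndon gt (u @ v)" and Y: "set u \<subseteq> Y"
  shows "lyndon gt u"
proof (rule lyndonI[OF u])
  fix p s assume ps: "u = p @ s" "p \<noteq> []" "s \<noteq> []"
  have v: "v \<noteq> []" using ms by (auto simp: min_suffix_def)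
  have *: "p @ s @ v \<lless> s @ v" using lyndon_suffix[of p "s @ v"] w ps v by simp
  have "u \<noteq> s" using ps by simp
  then consider "u \<sqsubset> s" | "s \<lless> u" | r where "u = s @ r" "r \<noteq> []"
    using lex_total[of u s] Y ps by (auto simp: lex_gt_iff)
  then show "u \<sqsubset> s"
  proof cases
    case 2
    then have "s @ v \<lless> u @ v" by (rule lex_diff_append)
    then show ?thesis using * ps diff_trans lex_irrefl lex_diff_imp_gt by (metis append.assoc)
  next
    case 3
    then have "r @ v \<lless> v" using * ps by (metis append.assoc lex_diff_prepend_iff)
    moreover have "r @ v = v \<or> v \<sqsubset> r @ v"
      using ms 3 ps v unfolding min_suffix_def by (metis append.assoc append_is_Nil_conv)
    ultimately have False using lex_asym[of v "r @ v"] lex_irrefl[of v] lex_diff_imp_gt by metis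
    then show ?thesis ..
  qed simp
qed

definition std :: "'y list \<Rightarrow> 'y list \<Rightarrow> bool" where
  "std u v \<longleftrightarrow> lyndon gt u \<and> lyndon gt v \<and> u \<sqsubset> v \<and> min_suffix v (u @ v)"

lemma std_exists:
  assumes "lyndon gt w" "set w \<subseteq> Y" "length w \<noteq> 1"
  shows "\<exists>u v. std u v \<and> w = u @ v"
proof -
  have "length w \<ge> 2" using assms by (cases w; cases "tl w") (auto simp: lyndon_def)
  then obtain v where v: "min_suffix v w" using min_suffix_exists assms by blast
  then obtain u where u: "u \<noteq> []" "v \<noteq> []" "w = u @ v" by (auto simp: min_suffix_def)
  have "u \<sqsubset> u @ v" "u @ v \<lless> v" using u assms lyndon_suffix by (auto intro: lex_gt_prefix)
  then have "u \<sqsubset> v" using lex_trans lex_diff_imp_gt by blast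
  then show ?thesis
    using v u assms min_suffix_lyndon[of v u] min_suffix_lyndon_left[of v u]
    by (intro exI[of _ u] exI[of _ v]) (auto simp: std_def)
qed

text \<open>Otherwise \<open>u2 v\<close> would be a suffix of \<open>u v\<close> below its least
  suffix. This is the side condition in the definition of nonassociative Lyndon-Shirshov
  words.\<close>

lemma std_right_le:
  assumes "std u v" "std u1 u2" "u = u1 @ u2"
  shows "\<not> u2 \<sqsubset> v"
proof
  assume "u2 \<sqsubset> v"
  then have 1: "u2 @ v \<lless> v"
    using assms lyndon_concat(1)[of u2 v] by (auto simp: std_def)
  have "u1 \<noteq> []" "u2 \<noteq> []" using assms by (auto simp: std_def lyndon_def)
  then have "u2 @ v = v \<or> v \<sqsubset> u2 @ v"
    using assms unfolding std_def min_suffix_def by (metis append.assoc append_is_Nil_conv)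
  then show False using 1 lex_asym[of v "u2 @ v"] lex_irrefl[of v] lex_diff_imp_gt by metis
qed

text \<open>Converse of \<open>std_right_le\<close>. The critical suffixes of \<open>u v\<close> are
  the words \<open>r v\<close> with \<open>r\<close> a proper suffix of \<open>u\<close>; as
  \<open>u2\<close> is the least such \<open>r\<close>, they satisfy
  \<open>r \<ge> u2 \<ge> v\<close>.\<close>

lemma stdI:
  assumes u: "lyndon gt u" and v: "lyndon gt v" and uv: "u \<sqsubset> v"
    and std: "length u \<noteq> 1 \<Longrightarrow> \<exists>u1 u2. std u1 u2 \<and> u = u1 @ u2 \<and> (u2 = v \<or> v \<sqsubset> u2)"
  shows "std u v"
  unfolding std_def min_suffix_def
proof (intro conjI allI impI u v uv)
  have ne: "u \<noteq> []" "v \<noteq> []" using u v by (auto simp: lyndon_def)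
  then show "\<exists>ua. ua \<noteq> [] \<and> v \<noteq> [] \<and> u @ v = ua @ v" by auto
  fix p s assume ps: "u @ v = p @ s" "p \<noteq> []" "s \<noteq> []"
  then consider (a) r where "u = p @ r" "s = r @ v" | (b) r where "p = u @ r" "v = r @ s"
    by (auto simp: append_eq_append_conv2)
  then show "s = v \<or> v \<sqsubset> s"
  proof cases
    case b
    then show ?thesis using lyndon_suffix[of r s] v ps lex_diff_imp_gt by (cases "r = []") auto
  next
    case a
    show ?thesis
    proof (cases "r = []")
      case False
      then have "length u \<noteq> 1" using a ps by (cases p; cases r) auto
      then obtain u1 u2 where u12: "std u1 u2" "u = u1 @ u2" "u2 = v \<or> v \<sqsubset> u2"
        using std by blast
      then have "r = u2 \<or> u2 \<sqsubset> r"
        using a ps False unfolding std_def min_suffix_def by blast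
      then have "r = v \<or> v \<sqsubset> r" using u12 lex_trans by blast
      then consider "r = v" | "v \<lless> r" | t where "r = v @ t" by (auto simp: lex_gt_iff)
      then show ?thesis
      proof cases
        case 2
        then have "v \<lless> r @ v" using lex_diff_append[of gt v r "[]" v] by simp
        then show ?thesis using a by (auto intro: lex_diff_imp_gt)
      qed (use a ne in \<open>auto intro: lex_gt_prefix\<close>)
    qed (use a in simp)
  qed
qed

lemma std_unique: "std u v \<Longrightarrow> std u' v' \<Longrightarrow> u @ v = u' @ v' \<Longrightarrow> u = u' \<and> v = v'"
  using min_suffix_unique[of v "u @ v" v'] by (auto simp: std_def)

lemma std_lyndon: "std u v \<Longrightarrow> lyndon gt (u @ v)"
  using lyndon_concat by (auto simp: std_def)

section \<open>Shirshov bracketings follow standard factorizations\<close>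

lemma is_NLSW_lyndon: "is_NLSW gt Z t \<Longrightarrow> lyndon gt (und t) \<and> set (und t) \<subseteq> Z"
  by (cases t) (auto simp: ALSW_iff)

text \<open>The conditions on a Lyndon-Shirshov bracketing are those of \<open>stdI\<close>, so
  every bracket cuts its word at the standard factorization. Uniqueness and the recursion for
  \<open>shirshov\<close> rest on this.\<close>

lemma is_NLSW_Br_std:
  "is_NLSW gt Z (Br s t) \<Longrightarrow> std (und s) (und t)"
proof (induction s arbitrary: t)
  case (Atom a)
  then have l: "lyndon gt (a # und t)" "lyndon gt (und t)" using is_NLSW_lyndon by (auto simp: ALSW_iff)
  then have "[a] @ und t \<lless> und t"
    using lyndon_suffix[of "[a]" "und t"] by (auto simp: lyndon_def[of _ "und t"])
  moreover have "[a] \<sqsubset> [a] @ und t" using l(2) by (intro lex_gt_prefix) (simp add: lyndon_def)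
  ultimately have "[a] \<sqsubset> und t" using lex_trans lex_diff_imp_gt by blast
  then show ?case using l by (intro stdI) auto
next
  case (Br s1 s2)
  then have l: "lyndon gt (und (Br s1 s2) @ und t)" "lyndon gt (und t)"
      "lyndon gt (und (Br s1 s2))"
    using is_NLSW_lyndon by (auto simp: ALSW_iff)
  then have "und (Br s1 s2) @ und t \<lless> und t"
    using lyndon_suffix[of "und (Br s1 s2)" "und t"] by (auto simp: lyndon_def[of _ "und t"]
        lyndon_def[of _ "und s1 @ und s2"])
  moreover have "und (Br s1 s2) \<sqsubset> und (Br s1 s2) @ und t"
    using l(2) by (intro lex_gt_prefix) (simp add: lyndon_def)
  ultimately have "und (Br s1 s2) \<sqsubset> und t" using lex_trans lex_diff_imp_gt by blast
  moreover have "std (und s1) (und s2)" using Br by simp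
  moreover have "und s2 = und t \<or> und t \<sqsubset> und s2" using Br.prems by simp
  ultimately show ?case using l by (intro stdI) auto
qed

lemma is_NLSW_unique:
  "is_NLSW gt Z s \<Longrightarrow> is_NLSW gt Z' t \<Longrightarrow> und s = und t \<Longrightarrow> s = t"
proof (induction s arbitrary: t)
  case (Atom a)
  then show ?case by (cases t) (auto simp: Cons_eq_append_conv)
next
  case (Br s1 s2)
  obtain t1 t2 where t: "t = Br t1 t2"
    using Br.prems(3) by (cases t) (auto simp: append_eq_Cons_conv)
  have "std (und s1) (und s2)" "std (und t1) (und t2)"
    using is_NLSW_Br_std Br.prems(1,2) unfolding t by blast+
  then have "und s1 = und t1 \<and> und s2 = und t2"
    by (rule std_unique) (use Br.prems(3) t in simp)
  then show ?case using Br t by auto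
qed

lemma is_NLSW_exists:
  assumes "lyndon gt w" "set w \<subseteq> Y" "set w \<subseteq> Z"
  shows "\<exists>t. is_NLSW gt Z t \<and> und t = w"
  using assms
proof (induction w rule: length_induct)
  case (1 w)
  show ?case
  proof (cases "length w = 1")
    case True
    then obtain a where "w = [a]" by (cases w) auto
    then show ?thesis using 1 by (intro exI[of _ "Atom a"]) (auto simp: ALSW_iff)
  next
    case False
    then obtain u v where uv: "std u v" "w = u @ v" using std_exists 1 by blast
    then have l: "lyndon gt u" "lyndon gt v" by (auto simp: std_def)
    then have ne: "u \<noteq> []" "v \<noteq> []" by (auto simp: lyndon_def)
    have "length u < length w" "length v < length w" "set u \<subseteq> Y" "set v \<subseteq> Y" "set u \<subseteq> Z" "set v \<subseteq> Z"
      using uv ne "1.prems" by auto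
    then obtain s t where s: "is_NLSW gt Z s" "und s = u" and t: "is_NLSW gt Z t" "und t = v"
      using "1.IH" l by metis
    have "und s2 = und t \<or> und t \<sqsubset> und s2" if "s = Br s1 s2" for s1 s2
    proof -
      have "std (und s1) (und s2)" using is_NLSW_Br_std s that by blast
      then have "\<not> und s2 \<sqsubset> v" using std_right_le uv s that by fastforce
      then show ?thesis using lex_total[of "und s2" v] 1 uv s t that by auto
    qed
    then have "is_NLSW gt Z (Br s t)" using s t uv 1 by (auto simp: ALSW_iff)
    then show ?thesis using s t uv by (intro exI[of _ "Br s t"]) auto
  qed
qed

lemma shirshov_NLSW:
  assumes "lyndon gt w" "set w \<subseteq> Y"
  shows "is_NLSW gt (set w) (shirshov gt w) \<and> und (shirshov gt w) = w"
  unfolding shirshov_def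
proof (rule theI')
  show "\<exists>!t. is_NLSW gt (set w) t \<and> und t = w"
    using is_NLSW_exists[OF assms, of "set w"] is_NLSW_unique by blast
qed

lemma shirshov_eqI:
  assumes "is_NLSW gt Z t" "und t = w" "set w \<subseteq> Y"
  shows "shirshov gt w = t"
  using shirshov_NLSW[of w] is_NLSW_lyndon[OF assms(1)] assms is_NLSW_unique by metis

lemma shirshov_single: "a \<in> Y \<Longrightarrow> shirshov gt [a] = Atom a"
  by (rule shirshov_eqI[of "{a}"]) (auto simp: ALSW_iff)

lemma shirshov_std:
  assumes uv: "std u v" and Y: "set u \<subseteq> Y" "set v \<subseteq> Y"
  shows "shirshov gt (u @ v) = Br (shirshov gt u) (shirshov gt v)"
proof -
  have w: "lyndon gt (u @ v)" "set (u @ v) \<subseteq> Y" using assms std_lyndon by auto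
  obtain s t where st: "shirshov gt (u @ v) = Br s t"
  proof (cases "shirshov gt (u @ v)")
    case (Atom a)
    then have "u @ v = [a]" using shirshov_NLSW[OF w] by simp
    then show ?thesis using uv by (auto simp: std_def lyndon_def append_eq_Cons_conv)
  qed
  then have *: "is_NLSW gt (set (u @ v)) (Br s t)" "und s @ und t = u @ v"
    using shirshov_NLSW[OF w] by auto
  then have "und s = u" "und t = v" using std_unique is_NLSW_Br_std uv by blast+
  then have "shirshov gt u = s" "shirshov gt v = t"
    using * Y by (auto intro!: shirshov_eqI[of "set u \<union> set v"])
  then show ?thesis using st by simp
qed

end


section \<open>Linear extension\<close>

text \<open>A copy of \<^locale>\<open>vector_space\<close>, which is interpreted for real vector spaces: a definition made
  there would be shadowed by its real instance.\<close>

locale lin_space = vector_space scale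
  for scale :: "'a::field \<Rightarrow> 'b::ab_group_add \<Rightarrow> 'b" (infixr "*s" 75)
begin

definition lin_ext :: "('c \<Rightarrow> 'b) \<Rightarrow> ('c \<Rightarrow>\<^sub>0 'a) \<Rightarrow> 'b" where
  "lin_ext f t = (\<Sum>a\<in>Poly_Mapping.keys t. Poly_Mapping.lookup t a *s f a)"

lemma lin_ext_superset:
  fixes t :: "'c \<Rightarrow>\<^sub>0 'a"
  shows "finite A \<Longrightarrow> Poly_Mapping.keys t \<subseteq> A \<Longrightarrow> lin_ext f t = (\<Sum>a\<in>A. Poly_Mapping.lookup t a *s f a)"
  unfolding lin_ext_def by (rule sum.mono_neutral_left) (auto simp: in_keys_iff)

lemma lin_ext_zero [simp]: "lin_ext f 0 = 0"
  by (simp add: lin_ext_def)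

lemma lin_ext_add: "lin_ext f (s + t) = lin_ext f s + lin_ext f t"
proof -
  let ?A = "Poly_Mapping.keys s \<union> Poly_Mapping.keys t"
  have "Poly_Mapping.keys (s + t) \<subseteq> ?A" by (rule Poly_Mapping.keys_add)
  then show ?thesis
    by (simp add: lin_ext_superset[of ?A] lookup_add scale_left_distrib sum.distrib)
qed

lemma lin_ext_uminus: "lin_ext f (- t) = - lin_ext f t"
  by (metis add.right_inverse add_eq_0_iff lin_ext_add lin_ext_zero)

lemma lin_ext_diff: "lin_ext f (s - t) = lin_ext f s - lin_ext f t"
  using lin_ext_add[of f s "- t"] by (simp add: lin_ext_uminus)

lemma lin_ext_single [simp]: "lin_ext f (Poly_Mapping.single a c) = c *s f a"
  by (simp add: lin_ext_def)

lemma lin_ext_cong: "(\<And>a. a \<in> Poly_Mapping.keys t \<Longrightarrow> f a = g a) \<Longrightarrow> lin_ext f t = lin_ext g t"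
  by (simp add: lin_ext_def)

lemma lin_ext_fun_add: "lin_ext (\<lambda>a. f a + g a) t = lin_ext f t + lin_ext g t"
  by (simp add: lin_ext_def scale_right_distrib sum.distrib)

lemma lin_ext_fun_diff: "lin_ext (\<lambda>a. f a - g a) t = lin_ext f t - lin_ext g t"
  by (simp add: lin_ext_def scale_right_diff_distrib sum_subtractf)

lemma lin_ext_fun_zero [simp]: "lin_ext (\<lambda>a. 0) t = 0"
  by (simp add: lin_ext_def)

lemma lin_ext_fun_scale: "lin_ext (\<lambda>a. c *s f a) t = c *s lin_ext f t"
  by (simp add: lin_ext_def scale_sum_right mult.commute)

lemma lin_ext_swap:
  "lin_ext (\<lambda>a. lin_ext (\<lambda>b. f a b) t) s = lin_ext (\<lambda>b. lin_ext (\<lambda>a. f a b) s) t"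
  unfolding lin_ext_def
  by (simp add: scale_sum_right mult.commute) (rule sum.swap)

end

definition smul :: "'k::field \<Rightarrow> ('a \<Rightarrow>\<^sub>0 'k) \<Rightarrow> ('a \<Rightarrow>\<^sub>0 'k)" where
  "smul c = Poly_Mapping.map ((*) c)"

lemma lookup_smul [simp]: "Poly_Mapping.lookup (smul c t) a = c * Poly_Mapping.lookup t a"
  by (simp add: smul_def Poly_Mapping.map.rep_eq when_def)

lemma smul_minus_one: "smul (- 1) t = - t"
  by (rule poly_mapping_eqI) (simp add: lookup_uminus)

interpretation pm: lin_space smul
  by unfold_locales (auto intro!: poly_mapping_eqI simp: lookup_add algebra_simps)

lemma keys_smul_subset: "Poly_Mapping.keys (smul c t) \<subseteq> Poly_Mapping.keys t"
  by (auto simp: in_keys_iff)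

lemma keys_pm_ext:
  assumes "b \<in> Poly_Mapping.keys (pm.lin_ext f t)"
  obtains a where "a \<in> Poly_Mapping.keys t" "b \<in> Poly_Mapping.keys (f a)"
proof -
  have "Poly_Mapping.lookup (pm.lin_ext f t) b = (\<Sum>a\<in>Poly_Mapping.keys t. Poly_Mapping.lookup t a * Poly_Mapping.lookup (f a) b)"
    by (simp add: pm.lin_ext_def lookup_sum)
  then have "\<exists>a\<in>Poly_Mapping.keys t. Poly_Mapping.lookup (f a) b \<noteq> 0"
    using assms by (metis (no_types, lifting) in_keys_iff mult_zero_right sum.neutral)
  then show ?thesis using that by (auto simp: in_keys_iff)
qed

lemma (in lin_space) lin_ext_smul: "lin_ext f (smul c t) = c *s lin_ext f t"
  using keys_smul_subset[of c t]
  by (simp add: lin_ext_superset[of "Poly_Mapping.keys t"] scale_sum_right)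

lemma (in lin_space) lin_ext_lin_ext:
  fixes g :: "'d \<Rightarrow> 'c \<Rightarrow>\<^sub>0 'a"
  shows "lin_ext f (pm.lin_ext g t) = lin_ext (\<lambda>a. lin_ext f (g a)) t"
proof -
  have "lin_ext f (sum h A) = (\<Sum>a\<in>A. lin_ext f (h a))" if "finite A" for h :: "'d \<Rightarrow> 'c \<Rightarrow>\<^sub>0 'a" and A
    using that by (induction A rule: finite_induct) (auto simp: lin_ext_add)
  then show ?thesis by (simp add: pm.lin_ext_def lin_ext_def[of _ t] lin_ext_smul)
qed


section \<open>Normal forms in an enveloping algebra\<close>

text \<open>The letters in \<open>B\<close> stand for a basis of a Lie algebra with structure constants \<open>c\<close>, the other
  letters are free. That the normal form \<open>sg\<close> does not depend on the order in which ascents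
  are resolved (\<open>sg_asc\<close> below) is the Poincare-Birkhoff-Witt theorem.\<close>

locale pbw = letter_order gt B for gt :: "'l \<Rightarrow> 'l \<Rightarrow> bool" and B :: "'l set" +
  fixes c :: "'l \<Rightarrow> 'l \<Rightarrow> ('l \<Rightarrow>\<^sub>0 'k::field)"
  assumes c_keys: "a \<in> B \<Longrightarrow> b \<in> B \<Longrightarrow> Poly_Mapping.keys (c a b) \<subseteq> B"
    and c_self: "a \<in> B \<Longrightarrow> c a a = 0"
    and c_anti: "a \<in> B \<Longrightarrow> b \<in> B \<Longrightarrow> c b a = - c a b"
    and c_jacobi: "a \<in> B \<Longrightarrow> b \<in> B \<Longrightarrow> d \<in> B \<Longrightarrow>
      pm.lin_ext (\<lambda>e. c e a) (c b d) + pm.lin_ext (\<lambda>e. c e b) (c d a) + pm.lin_ext (\<lambda>e. c e d) (c a b) = 0"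
begin

text \<open>Letters outside \<open>B\<close> are free and never exchanged. Without ascents, adjacent
  letters of \<open>B\<close> are classically nonincreasing; these words are the normal
  forms.\<close>

definition asc :: "'l list \<Rightarrow> 'l list \<Rightarrow> 'l \<Rightarrow> 'l \<Rightarrow> 'l list \<Rightarrow> bool" where
  "asc w u a b v \<longleftrightarrow> w = u @ a # b # v \<and> a \<in> B \<and> b \<in> B \<and> gt a b"

primrec inversions :: "'l list \<Rightarrow> nat" where
  "inversions [] = 0"
| "inversions (a # w) = (if a \<in> B then length (filter (\<lambda>b. b \<in> B \<and> gt a b) w) else 0) + inversions w"

lemma inv_swap: "a \<in> B \<Longrightarrow> b \<in> B \<Longrightarrow> gt a b \<Longrightarrow> inversions (u @ b # a # v) < inversions (u @ a # b # v)"
  by (induction u) (auto dest: gt_trans simp: gt_irrefl)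

text \<open>An exchange keeps the length and removes an inversion; replacing \<open>a b\<close> by a
  letter of its bracket shortens the word.\<close>

definition wrel :: "('l list \<times> 'l list) set" where
  "wrel = measures [length, inversions]"

lemma wf_wrel: "wf wrel"
  by (simp add: wrel_def)

lemma wrelI: "length w' < length w \<Longrightarrow> (w', w) \<in> wrel"
  by (simp add: wrel_def)

lemma wrel_swap: "a \<in> B \<Longrightarrow> b \<in> B \<Longrightarrow> gt a b \<Longrightarrow> (u @ b # a # v, u @ a # b # v) \<in> wrel"
  using inv_swap by (simp add: wrel_def)

text \<open>The relations \<open>a b = b a + c a b\<close> of the enveloping algebra, read as
  rewriting rules. The ascent to be resolved is an arbitrary choice, shown to be immaterial
  afterwards.\<close>

function sg :: "'l list \<Rightarrow> ('l list \<Rightarrow>\<^sub>0 'k)" where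
  "sg w = (if \<exists>u a b v. asc w u a b v then
      let (u, a, b, v) = (SOME (u, a, b, v). asc w u a b v) in
        sg (u @ b # a # v) + (\<Sum>e\<in>Poly_Mapping.keys (c a b). smul (Poly_Mapping.lookup (c a b) e) (sg (u @ e # v)))
    else Poly_Mapping.single w 1)"
  by auto
termination
proof (relation wrel)
  show "wf wrel" by (rule wf_wrel)
  have *: "asc w u a b v" if ex: "\<exists>u a b v. asc w u a b v" and "x = (SOME (u, a, b, v). asc w u a b v)"
    "(u, y) = x" "(a, z) = y" "(b, v) = z" for w u a b v x y z
  proof -
    have "case (SOME (u, a, b, v). asc w u a b v) of (u, a, b, v) \<Rightarrow> asc w u a b v"
      by (rule someI_ex) (use ex in auto)
    then show ?thesis using that(2-) by (metis (mono_tags, lifting) case_prod_conv)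
  qed
  show "(u @ b # a # v, w) \<in> wrel" if "\<exists>u a b v. asc w u a b v" "x = (SOME (u, a, b, v). asc w u a b v)"
    "(u, y) = x" "(a, z) = y" "(b, v) = z" for w u a b v x y z
    using *[OF that] wrel_swap by (auto simp: asc_def)
  show "(u @ e # v, w) \<in> wrel" if "\<exists>u a b v. asc w u a b v" "x = (SOME (u, a, b, v). asc w u a b v)"
    "(u, y) = x" "(a, z) = y" "(b, v) = z" for w u a b v x y z e
    using *[OF that] by (auto simp: asc_def intro!: wrelI)
qed

declare sg.simps [simp del]

definition sg_sum :: "'l list \<Rightarrow> ('l \<Rightarrow>\<^sub>0 'k) \<Rightarrow> 'l list \<Rightarrow> ('l list \<Rightarrow>\<^sub>0 'k)" where
  "sg_sum u t v = pm.lin_ext (\<lambda>e. sg (u @ e # v)) t"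

lemma sg_normal: "(\<And>u a b v. \<not> asc w u a b v) \<Longrightarrow> sg w = Poly_Mapping.single w 1"
  by (subst sg.simps) auto

lemma sg_some_asc:
  assumes "\<exists>u a b v. asc w u a b v"
  obtains u a b v where "asc w u a b v" "sg w = sg (u @ b # a # v) + sg_sum u (c a b) v"
proof -
  obtain u a b v where s: "(SOME (u, a, b, v). asc w u a b v) = (u, a, b, v)"
    by (metis surj_pair)
  have "case (SOME (u, a, b, v). asc w u a b v) of (u, a, b, v) \<Rightarrow> asc w u a b v"
    by (rule someI_ex) (use assms in auto)
  then have "asc w u a b v" using s by simp
  moreover have "sg w = sg (u @ b # a # v) + sg_sum u (c a b) v"
    by (subst sg.simps) (use assms s in \<open>auto simp: sg_sum_def pm.lin_ext_def\<close>)
  ultimately show ?thesis by (rule that)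
qed

lemma sg_sum_add: "sg_sum u (s + t) v = sg_sum u s v + sg_sum u t v"
  and sg_sum_diff: "sg_sum u (s - t) v = sg_sum u s v - sg_sum u t v"
  and sg_sum_uminus: "sg_sum u (- t) v = - sg_sum u t v"
  and sg_sum_zero [simp]: "sg_sum u 0 v = 0"
  by (simp_all add: sg_sum_def pm.lin_ext_add pm.lin_ext_diff pm.lin_ext_uminus)

section \<open>Confluence, by the diamond lemma\<close>

context
  fixes w :: "'l list"
  assumes IH: "\<And>w' u a b v. (w', w) \<in> wrel \<Longrightarrow> asc w' u a b v \<Longrightarrow>
    sg w' = sg (u @ b # a # v) + sg_sum u (c a b) v"
begin

text \<open>Shorter words than \<open>w\<close> may be rewritten at any ascent. The other two
  relative positions of \<open>a\<close> and \<open>b\<close> follow from \<open>c a a = 0\<close>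
  and antisymmetry.\<close>

lemma sg_swap_short:
  assumes "length u + length v + 2 < length w" "a \<in> B" "b \<in> B"
  shows "sg (u @ a # b # v) = sg (u @ b # a # v) + sg_sum u (c a b) v"
proof -
  consider "a = b" | "gt a b" | "gt b a" using gt_total assms by blast
  then show ?thesis
  proof cases
    case 1
    then show ?thesis using assms by (simp add: c_self)
  next
    case 2
    then show ?thesis by (intro IH) (use assms in \<open>auto simp: asc_def intro!: wrelI\<close>)
  next
    case 3
    then have "sg (u @ b # a # v) = sg (u @ a # b # v) + sg_sum u (c b a) v"
      by (intro IH) (use assms in \<open>auto simp: asc_def intro!: wrelI\<close>)
    then show ?thesis using c_anti[of a b] assms by (simp add: sg_sum_uminus)
  qed
qed

text \<open>Each letter \<open>e\<close> of \<open>t\<close> is exchanged with \<open>x\<close>,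
  which leaves the commutator \<open>c e x\<close> behind.\<close>

lemma sg_sum_commute:
  assumes "length u + length v + 2 < length w" "Poly_Mapping.keys t \<subseteq> B" "x \<in> B"
  shows "sg_sum u t (x # v) = sg_sum (u @ [x]) t v + sg_sum u (pm.lin_ext (\<lambda>e. c e x) t) v"
proof -
  have "sg_sum u t (x # v) = pm.lin_ext (\<lambda>e. sg (u @ x # e # v) + sg_sum u (c e x) v) t"
    unfolding sg_sum_def[of u t]
  proof (rule pm.lin_ext_cong)
    fix e assume "e \<in> Poly_Mapping.keys t"
    then have "e \<in> B" using assms(2) by blast
    then show "sg (u @ e # x # v) = sg (u @ x # e # v) + sg_sum u (c e x) v"
      by (rule sg_swap_short[OF assms(1) _ assms(3)])
  qed
  then show ?thesis by (simp add: pm.lin_ext_fun_add sg_sum_def pm.lin_ext_lin_ext)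
qed

text \<open>Both ways of reordering \<open>a b d\<close> end in \<open>d b a\<close>. Once the third
  letter has been moved past the bracket terms left over, the two sides differ by the Jacobi sum of
  \<open>a\<close>, \<open>b\<close>, \<open>d\<close>.\<close>

lemma asc_overlap:
  assumes w: "w = u @ a # b # d # v" and B: "a \<in> B" "b \<in> B" "d \<in> B" and gt: "gt a b" "gt b d"
  shows "sg (u @ b # a # d # v) + sg_sum u (c a b) (d # v) = sg (u @ a # d # b # v) + sg_sum (u @ [a]) (c b d) v"
proof -
  have ad: "gt a d" using gt gt_trans by blast
  have l: "length u + length v + 2 < length w" using w by simp
  have r1: "(u @ b # a # d # v, w) \<in> wrel" using w wrel_swap[of a b u "d # v"] B gt by simp
  have r2: "(u @ b # d # a # v, w) \<in> wrel"
    using r1 wrel_swap[of a d "u @ [b]" v] B ad by (auto simp: wrel_def)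
  have r3: "(u @ a # d # b # v, w) \<in> wrel" using w wrel_swap[of b d "u @ [a]" v] B gt by simp
  have r4: "(u @ d # a # b # v, w) \<in> wrel"
    using r3 wrel_swap[of a d u "b # v"] B ad by (auto simp: wrel_def)
  have e1: "sg (u @ b # a # d # v) = sg (u @ b # d # a # v) + sg_sum (u @ [b]) (c a d) v"
    using IH[OF r1, of "u @ [b]" a d v] B ad by (simp add: asc_def)
  have e2: "sg (u @ b # d # a # v) = sg (u @ d # b # a # v) + sg_sum u (c b d) (a # v)"
    using IH[OF r2, of u b d "a # v"] B gt by (simp add: asc_def)
  have e3: "sg (u @ a # d # b # v) = sg (u @ d # a # b # v) + sg_sum u (c a d) (b # v)"
    using IH[OF r3, of u a d "b # v"] B ad by (simp add: asc_def)
  have e4: "sg (u @ d # a # b # v) = sg (u @ d # b # a # v) + sg_sum (u @ [d]) (c a b) v"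
    using IH[OF r4, of "u @ [d]" a b v] B gt by (simp add: asc_def)
  have k: "Poly_Mapping.keys (c a b) \<subseteq> B" "Poly_Mapping.keys (c b d) \<subseteq> B" "Poly_Mapping.keys (c a d) \<subseteq> B"
    using c_keys B by auto
  have "sg_sum u (pm.lin_ext (\<lambda>e. c e a) (c b d) - pm.lin_ext (\<lambda>e. c e b) (c a d)
      + pm.lin_ext (\<lambda>e. c e d) (c a b)) v = 0"
    using c_jacobi[OF B] c_anti[of a d] B by (simp add: pm.lin_ext_uminus)
  then show ?thesis
    unfolding e1 e2 e3 e4 using sg_sum_commute[OF l k(1) B(3)] sg_sum_commute[OF l k(2) B(1)] sg_sum_commute[OF l k(3) B(2)]
    by (simp add: sg_sum_add sg_sum_diff algebra_simps)
qed

text \<open>Each reduction can be completed by the other one; the double sum over the letters of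
  both brackets may be taken in either order.\<close>

lemma asc_disjoint:
  assumes w: "w = u @ a # b # m @ a' # b' # v" and B: "a \<in> B" "b \<in> B" "a' \<in> B" "b' \<in> B"
    and gt: "gt a b" "gt a' b'"
  shows "sg (u @ b # a # m @ a' # b' # v) + sg_sum u (c a b) (m @ a' # b' # v) =
    sg (u @ a # b # m @ b' # a' # v) + sg_sum (u @ a # b # m) (c a' b') v"
proof -
  have r1: "(u @ b # a # m @ a' # b' # v, w) \<in> wrel"
    using w wrel_swap[of a b u "m @ a' # b' # v"] B gt by simp
  have r2: "(u @ a # b # m @ b' # a' # v, w) \<in> wrel"
    using w wrel_swap[of a' b' "u @ a # b # m" v] B gt by simp
  have e1: "sg (u @ b # a # m @ a' # b' # v) = sg (u @ b # a # m @ b' # a' # v) + sg_sum (u @ b # a # m) (c a' b') v"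
    using IH[OF r1, of "u @ b # a # m" a' b' v] B gt by (simp add: asc_def)
  have e2: "sg (u @ a # b # m @ b' # a' # v) = sg (u @ b # a # m @ b' # a' # v) + sg_sum u (c a b) (m @ b' # a' # v)"
    using IH[OF r2, of u a b "m @ b' # a' # v"] B gt by (simp add: asc_def)
  have e3: "sg_sum u (c a b) (m @ a' # b' # v) = sg_sum u (c a b) (m @ b' # a' # v)
      + pm.lin_ext (\<lambda>e. sg_sum (u @ e # m) (c a' b') v) (c a b)"
    unfolding sg_sum_def pm.lin_ext_fun_add[symmetric]
  proof (rule pm.lin_ext_cong)
    fix e
    show "sg (u @ e # m @ a' # b' # v) = sg (u @ e # m @ b' # a' # v) + pm.lin_ext (\<lambda>ea. sg ((u @ e # m) @ ea # v)) (c a' b')"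
      using IH[OF wrelI[of "u @ e # m @ a' # b' # v"], of "u @ e # m" a' b' v] B gt w
      by (simp add: asc_def sg_sum_def)
  qed
  have e4: "sg_sum (u @ a # b # m) (c a' b') v = sg_sum (u @ b # a # m) (c a' b') v
      + pm.lin_ext (\<lambda>e. sg_sum u (c a b) (m @ e # v)) (c a' b')"
    unfolding sg_sum_def pm.lin_ext_fun_add[symmetric]
  proof (rule pm.lin_ext_cong)
    fix e
    show "sg ((u @ a # b # m) @ e # v) = sg ((u @ b # a # m) @ e # v) + pm.lin_ext (\<lambda>ea. sg (u @ ea # m @ e # v)) (c a b)"
      using IH[OF wrelI[of "u @ a # b # m @ e # v"], of u a b "m @ e # v"] B gt w
      by (simp add: asc_def sg_sum_def)
  qed
  have "pm.lin_ext (\<lambda>e. sg_sum (u @ e # m) (c a' b') v) (c a b) = pm.lin_ext (\<lambda>e. sg_sum u (c a b) (m @ e # v)) (c a' b')"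
    unfolding sg_sum_def by (subst pm.lin_ext_swap) simp
  then show ?thesis unfolding e1 e2 e3 e4 by (simp add: algebra_simps)
qed

lemma asc_confluent:
  assumes "asc w u a b v" "asc w u' a' b' v'" "length u \<le> length u'"
  shows "sg (u @ b # a # v) + sg_sum u (c a b) v = sg (u' @ b' # a' # v') + sg_sum u' (c a' b') v'"
proof -
  have "u @ a # b # v = u' @ a' # b' # v'" using assms by (simp add: asc_def)
  then obtain m where m: "u' = u @ m" "a # b # v = m @ a' # b' # v'"
    using assms(3) by (auto simp: append_eq_append_conv2)
  then consider "m = []" | "m = [a]" "b = a'" "v = b' # v'" | n where "m = a # b # n" "v = n @ a' # b' # v'"
    by (cases m; cases "tl m") auto
  then show ?thesis
  proof cases
    case 1
    then show ?thesis using m by simp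
  next
    case 2
    then show ?thesis using m asc_overlap[of u a b b' v'] assms by (simp add: asc_def)
  next
    case 3
    then show ?thesis using m asc_disjoint[of u a b n a' b' v'] assms by (simp add: asc_def)
  qed
qed

end

text \<open>The given ascent is compared with the one chosen by \<open>sg\<close>. As
  \<open>asc_confluent\<close> expects the left one first, it is used in both arrangements.\<close>

lemma sg_asc: "asc w u a b v \<Longrightarrow> sg w = sg (u @ b # a # v) + sg_sum u (c a b) v"
proof (induction w arbitrary: u a b v rule: wf_induct_rule[OF wf_wrel])
  case (1 w)
  obtain u' a' b' v' where s: "asc w u' a' b' v'" "sg w = sg (u' @ b' # a' # v') + sg_sum u' (c a' b') v'"
    using sg_some_asc 1(2) by metis
  have IH: "\<And>w' u a b v. (w', w) \<in> wrel \<Longrightarrow> asc w' u a b v \<Longrightarrow>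
    sg w' = sg (u @ b # a # v) + sg_sum u (c a b) v" using 1(1) by blast
  show ?case
    using asc_confluent[OF IH s(1) 1(2)] asc_confluent[OF IH 1(2) s(1)] s(2)
    by (metis nat_le_linear)
qed

lemma sg_swap:
  assumes "a \<in> B" "b \<in> B"
  shows "sg (u @ a # b # v) = sg (u @ b # a # v) + sg_sum u (c a b) v"
  \<comment> \<open>With all ascents available, the bounding word of the local lemma is arbitrary;
    it must have at least three letters more than \<open>u v\<close>.\<close>
  by (rule sg_swap_short[of "u @ v @ replicate 3 a"]) (use sg_asc assms in auto)

text \<open>Resolving an ascent brings the larger letter forward, which raises the word, or shortens
  the word. All leading terms below come from this triangularity.\<close>

lemma sg_keys:
  "v \<in> Poly_Mapping.keys (sg w) \<Longrightarrow> v = w \<or> length v < length w \<or> length v = length w \<and> w \<sqsubset> v"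
proof (induction w arbitrary: v rule: wf_induct_rule[OF wf_wrel])
  case (1 w)
  show ?case
  proof (cases "\<exists>u a b v. asc w u a b v")
    case True
    then obtain u a b r where s: "asc w u a b r" "sg w = sg (u @ b # a # r) + sg_sum u (c a b) r"
      using sg_some_asc by metis
    then have ab: "a \<in> B" "b \<in> B" "gt a b" and w: "w = u @ a # b # r" by (auto simp: asc_def)
    consider "v \<in> Poly_Mapping.keys (sg (u @ b # a # r))" | "v \<in> Poly_Mapping.keys (sg_sum u (c a b) r)"
      using 1(2) s(2) Poly_Mapping.keys_add by fastforce
    then show ?thesis
    proof cases
      case 1
      then have "v = u @ b # a # r \<or> length v < length w \<or> length v = length w \<and> u @ b # a # r \<sqsubset> v"
        using "1.IH"[of "u @ b # a # r" v] wrel_swap[OF ab, of u r] w by auto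
      moreover have "w \<sqsubset> u @ b # a # r" using w ab by (auto intro!: lex_gt_prepend)
      ultimately show ?thesis using lex_trans w by auto
    next
      case 2
      then obtain e where "v \<in> Poly_Mapping.keys (sg (u @ e # r))"
        unfolding sg_sum_def using keys_pm_ext by metis
      then show ?thesis using "1.IH"[OF wrelI[of "u @ e # r"], of v] w by auto
    qed
  next
    case False
    then show ?thesis using 1(2) sg_normal[of w] by (auto split: if_splits)
  qed
qed

text \<open>Rewriting a suffix is rewriting within the whole word, so normalizing the suffix
  beforehand changes nothing. It follows that left multiplications compose as in an associative
  algebra.\<close>

lemma sg_sg: "pm.lin_ext (\<lambda>v. sg (u @ v)) (sg w) = sg (u @ w)"
proof (induction w rule: wf_induct_rule[OF wf_wrel])
  case (1 w)
  show ?case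
  proof (cases "\<exists>u a b v. asc w u a b v")
    case True
    then obtain p a b r where s: "asc w p a b r" "sg w = sg (p @ b # a # r) + sg_sum p (c a b) r"
      using sg_some_asc by metis
    then have ab: "a \<in> B" "b \<in> B" "gt a b" and w: "w = p @ a # b # r" by (auto simp: asc_def)
    have "pm.lin_ext (\<lambda>v. sg (u @ v)) (sg w) = sg (u @ p @ b # a # r)
        + pm.lin_ext (\<lambda>e. pm.lin_ext (\<lambda>v. sg (u @ v)) (sg (p @ e # r))) (c a b)"
      unfolding s(2) pm.lin_ext_add sg_sum_def pm.lin_ext_lin_ext
      using 1[of "p @ b # a # r"] wrel_swap[OF ab, of p r] w by simp
    also have "pm.lin_ext (\<lambda>e. pm.lin_ext (\<lambda>v. sg (u @ v)) (sg (p @ e # r))) (c a b)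
        = sg_sum (u @ p) (c a b) r"
      unfolding sg_sum_def
    proof (rule pm.lin_ext_cong)
      fix e
      show "pm.lin_ext (\<lambda>v. sg (u @ v)) (sg (p @ e # r)) = sg ((u @ p) @ e # r)"
        using 1[OF wrelI[of "p @ e # r"]] w by simp
    qed
    finally show ?thesis
      using sg_swap[OF ab(1,2), of "u @ p" r] w by simp
  next
    case False
    then show ?thesis using sg_normal[of w] by simp
  qed
qed

end


section \<open>The order on prime words\<close>

lemma wdeg_simps [simp]: "wdeg [] = 0" "wdeg (p # w) = pdeg p + wdeg w" "wdeg (u @ v) = wdeg u + wdeg v"
  by (simp_all add: wdeg_def)

lemma pdeg_PW: "pdeg (PW w) = wdeg w + 1"
  by (simp add: wdeg_def)

declare pdeg.simps(2) [simp del] pdeg_PW [simp]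

lemma pdeg_pos: "0 < pdeg p"
  by (cases p) auto

lemma lex_diffI: "gt a b \<Longrightarrow> lex_diff gt (c @ a # u) (c @ b # v)"
  unfolding lex_diff_def by blast

text \<open>Letterwise comparison takes place at equal length only, where no word is a proper prefix
  of the other; therefore \<open>lex_diff\<close> captures it.\<close>

lemma word_gt_iff:
  "word_gt u v \<longleftrightarrow> wdeg v < wdeg u \<or> wdeg u = wdeg v \<and>
     (length v < length u \<or> length u = length v \<and> lex_diff prime_gt u v)"
proof
  show "word_gt u v \<Longrightarrow> wdeg v < wdeg u \<or> wdeg u = wdeg v \<and>
     (length v < length u \<or> length u = length v \<and> lex_diff prime_gt u v)"
    by (erule word_gt.cases) (auto simp del: wdeg_simps intro: lex_diffI)
  assume "wdeg v < wdeg u \<or> wdeg u = wdeg v \<and>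
     (length v < length u \<or> length u = length v \<and> lex_diff prime_gt u v)"
  then show "word_gt u v"
    unfolding lex_diff_def using word_deg word_bre word_lex by blast
qed

lemma prime_gt_imp_deg: "prime_gt p q \<Longrightarrow> pdeg q \<le> pdeg p"
  by (cases rule: prime_gt.cases) auto

lemma word_gt_single: "word_gt [p] [q] \<longleftrightarrow> prime_gt p q"
  by (auto simp: word_gt_iff lex_diff_Cons intro: prime_deg dest: prime_gt_imp_deg)

lemma succ_prime_eq: "succ_prime = prime_gt"
  by (intro ext) (simp add: succ_prime_def word_gt_single)

lemma prime_gt_PW_PW: "prime_gt (PW a) (PW b) \<longleftrightarrow> word_gt a b"
proof
  show "prime_gt (PW a) (PW b) \<Longrightarrow> word_gt a b"
    by (cases rule: prime_gt.cases) (auto simp: word_gt_iff)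
  have "word_gt a b \<Longrightarrow> wdeg b \<le> wdeg a" by (auto simp: word_gt_iff)
  then show "word_gt a b \<Longrightarrow> prime_gt (PW a) (PW b)"
    by (cases "wdeg a = wdeg b") (auto intro: prime_P_P prime_deg)
qed

text \<open>The degrees are \<open>wdeg a + 1\<close> and \<open>m + 1\<close>. At equal degree
  \<open>P > D\<close> decides, and \<open>m = 0\<close> would mean that \<open>a\<close> is
  empty.\<close>

lemma prime_gt_PW_Letter:
  "prime_gt (PW a) (Letter (m, x)) \<longleftrightarrow> m < wdeg a \<or> m = wdeg a \<and> 0 < m"
proof
  show "prime_gt (PW a) (Letter (m, x)) \<Longrightarrow> m < wdeg a \<or> m = wdeg a \<and> 0 < m"
    by (cases rule: prime_gt.cases) auto
  show "m < wdeg a \<or> m = wdeg a \<and> 0 < m \<Longrightarrow> prime_gt (PW a) (Letter (m, x))"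
    by (cases m) (auto intro: prime_P_D prime_deg)
qed

lemma prime_gt_Letter_PW: "prime_gt (Letter (m, x)) (PW a) \<longleftrightarrow> wdeg a < m"
proof
  show "prime_gt (Letter (m, x)) (PW a) \<Longrightarrow> wdeg a < m"
    by (cases rule: prime_gt.cases) auto
qed (auto intro: prime_deg)

lemma prime_gt_Letter_Letter:
  "prime_gt (Letter (m, x)) (Letter (n, y)) \<longleftrightarrow> n < m \<or> m = n \<and> y < x"
proof (induction m arbitrary: n)
  case 0
  have "prime_gt (Letter (0, x)) (Letter (n, y)) \<Longrightarrow> n = 0 \<and> y < x"
    by (cases rule: prime_gt.cases) auto
  then show ?case by (auto intro: prime_gen)
next
  case (Suc m)
  have "prime_gt (Letter (Suc m, x)) (Letter (n, y)) \<Longrightarrow> n < Suc m \<or> Suc m = n \<and> y < x"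
    by (cases rule: prime_gt.cases) (auto simp: word_gt_single Suc)
  moreover have "n < Suc m \<Longrightarrow> prime_gt (Letter (Suc m, x)) (Letter (n, y))"
    by (rule prime_deg) simp
  moreover have "y < x \<Longrightarrow> prime_gt (Letter (Suc m, x)) (Letter (Suc m, y))"
    by (rule prime_D_D) (auto simp: word_gt_single Suc)
  ultimately show ?case by blast
qed

lemmas prime_gt_iffs = prime_gt_PW_PW prime_gt_PW_Letter prime_gt_Letter_PW prime_gt_Letter_Letter

lemma prime_gt_irrefl: "\<not> prime_gt p p"
proof (induction p)
  case (Letter d)
  then show ?case by (cases d) (simp add: prime_gt_iffs)
next
  case (PW w)
  then show ?case by (auto simp: prime_gt_iffs word_gt_iff lex_diff_def)
qed

text \<open>Transitivity is asked at the letters of \<open>u\<close> alone, because that is what an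
  induction on the prime \<open>PW u\<close> provides.\<close>

lemma lex_diff_trans_local:
  assumes "\<And>a b c. a \<in> set u \<Longrightarrow> gt a b \<Longrightarrow> gt b c \<Longrightarrow> gt a c"
    and "lex_diff gt u v" "lex_diff gt v w"
  shows "lex_diff gt u w"
  using assms
proof (induction u arbitrary: v w)
  case (Cons a u)
  from Cons.prems(2,3) obtain b v' d w' where vw: "v = b # v'" "w = d # w'"
    by (cases v; cases w) auto
  have "lex_diff gt u w'" if "lex_diff gt u v'" "lex_diff gt v' w'"
    using Cons.IH[of v' w'] Cons.prems(1) that by (meson list.set_intros(2))
  then show ?case
    using Cons.prems vw by (auto simp: lex_diff_Cons)
qed simp

lemma lex_diff_total_local:
  assumes "\<And>a b. a \<in> set u \<Longrightarrow> b \<in> set v \<Longrightarrow> a = b \<or> gt a b \<or> gt b a" and "length u = length v"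
  shows "u = v \<or> lex_diff gt u v \<or> lex_diff gt v u"
  using assms(2,1)
proof (induction u v rule: list_induct2)
  case (Cons a u b v)
  then have "a = b \<or> gt a b \<or> gt b a" "u = v \<or> lex_diff gt u v \<or> lex_diff gt v u" by auto
  then show ?case by (auto simp: lex_diff_Cons)
qed simp

lemma prime_gt_trans: "prime_gt p q \<Longrightarrow> prime_gt q r \<Longrightarrow> prime_gt p r"
proof (induction p arbitrary: q r)
  case (Letter d)
  then show ?case by (cases d; cases q; cases r) (auto simp: prime_gt_iffs word_gt_iff)
next
  case (PW a)
  have *: "lex_diff prime_gt a c" if "lex_diff prime_gt a b" "lex_diff prime_gt b c" for b c
    by (rule lex_diff_trans_local[OF _ that]) (use PW.IH in blast)
  have "word_gt a c" if "word_gt a b" "word_gt b c" for b c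
    using that * by (auto simp: word_gt_iff)
  then show ?case using PW.prems
    by (cases q; cases r) (auto simp: prime_gt_iffs word_gt_iff)
qed

text \<open>The type also contains \<open>PW []\<close>, which has degree 1 and is incomparable with
  every generator. This is why \<open>letter_order\<close> asks for totality on a set of
  letters.\<close>

fun proper_prime :: "'a prime_word \<Rightarrow> bool" where
  "proper_prime (Letter d) = True"
| "proper_prime (PW w) = (w \<noteq> [] \<and> (\<forall>p\<in>set w. proper_prime p))"

lemma wdeg_pos: "w \<noteq> [] \<Longrightarrow> 0 < wdeg w"
  using pdeg_pos by (cases w) auto

lemma prime_gt_total:
  "proper_prime p \<Longrightarrow> proper_prime q \<Longrightarrow> p = q \<or> prime_gt p q \<or> prime_gt q p"
proof (induction p arbitrary: q)
  case (Letter d)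
  then show ?case using wdeg_pos
    by (cases d; cases q) (auto simp: prime_gt_iffs)
next
  case (PW a)
  show ?case
  proof (cases q)
    case (Letter d)
    then show ?thesis using wdeg_pos[of a] PW.prems by (cases d) (auto simp: prime_gt_iffs)
  next
    case q: (PW b)
    have "a = b \<or> lex_diff prime_gt a b \<or> lex_diff prime_gt b a" if "length a = length b"
      using PW q that by (intro lex_diff_total_local) auto
    then show ?thesis using q by (auto simp: prime_gt_iffs word_gt_iff)
  qed
qed

interpretation prime_order: letter_order succ_prime "Collect proper_prime"
proof (unfold_locales, unfold succ_prime_eq)
  show "a = b \<or> prime_gt a b \<or> prime_gt b a" if "a \<in> Collect proper_prime" "b \<in> Collect proper_prime" for a b
    using prime_gt_total that by blast
qed (rule prime_gt_irrefl, rule prime_gt_trans)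

lemma succ_prime_PW: "succ_prime (PW u) (PW v) \<longleftrightarrow> word_gt u v"
  by (simp add: succ_prime_eq prime_gt_iffs)


section \<open>Bracketings of Lyndon words\<close>

text \<open>\<open>assemble\<close> applies \<open>shirshov\<close> to pairs of a prime and its
  bracketing. As \<open>tag\<close> embeds the primes into these pairs and preserves the order, the
  bracketing can be computed on the primes themselves.\<close>

definition tag :: "(nat \<times> 'x::wellorder) prime_word \<Rightarrow> (nat \<times> 'x) prime_word \<times> (nat \<times> 'x) bword" where
  "tag p = (p, bracket_prime p)"

definition tag_gt :: "(nat \<times> 'x::wellorder) prime_word \<times> (nat \<times> 'x) bword \<Rightarrow>
    (nat \<times> 'x) prime_word \<times> (nat \<times> 'x) bword \<Rightarrow> bool" where
  "tag_gt = (\<lambda>a b. succ_prime (fst a) (fst b))"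

interpretation tag_order: letter_order tag_gt "tag ` Collect proper_prime"
proof
  show "\<not> tag_gt a a" for a :: "(nat \<times> 'a) prime_word \<times> (nat \<times> 'a) bword"
    by (simp add: tag_gt_def prime_order.gt_irrefl)
  show "tag_gt a b \<Longrightarrow> tag_gt b c \<Longrightarrow> tag_gt a c" for a b c :: "(nat \<times> 'a) prime_word \<times> (nat \<times> 'a) bword"
    unfolding tag_gt_def by (rule prime_order.gt_trans)
  show "a = b \<or> tag_gt a b \<or> tag_gt b a"
    if "a \<in> tag ` Collect proper_prime" "b \<in> tag ` Collect proper_prime" for a b :: "(nat \<times> 'a) prime_word \<times> (nat \<times> 'a) bword"
    using that prime_order.gt_total unfolding tag_gt_def tag_def by force
qed

lemma snd_tag: "snd \<circ> tag = bracket_prime"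
  by (auto simp: tag_def)

lemma tag_eq_iff: "tag p = tag q \<longleftrightarrow> p = q"
  by (auto simp: tag_def)

lemma tag_gt_iff: "tag_gt (tag p) (tag q) = succ_prime p q"
  by (simp add: tag_gt_def tag_def)

lemma lex_gt_tag: "lex_gt tag_gt (map tag u) (map tag v) = lex_gt succ_prime u v"
proof (induction u arbitrary: v)
  case Nil
  then show ?case by (cases v) auto
next
  case (Cons a u)
  then show ?case by (cases v) (auto simp: tag_gt_iff tag_eq_iff)
qed

lemma lyndon_tag: "lyndon succ_prime w \<Longrightarrow> lyndon tag_gt (map tag w)"
  unfolding lyndon_def
  by (auto simp: map_eq_append_conv lex_gt_tag map_append[symmetric] simp del: map_append)

lemma und_map: "und (map_bracketing f t) = map f (und t)"
  by (induction t) auto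

lemma is_NLSW_tag:
  "is_NLSW succ_prime Z t \<Longrightarrow> is_NLSW tag_gt (tag ` Z) (map_bracketing tag t)"
proof (induction t)
  case (Atom a)
  then show ?case by (auto simp: ALSW_iff)
next
  case (Br s t)
  have "und (map_bracketing tag s2) = und (map_bracketing tag t) \<or>
      lex_gt tag_gt (und (map_bracketing tag t)) (und (map_bracketing tag s2))" if "s = Br s1 s2" for s1 s2
    using Br.prems that by (auto simp: und_map lex_gt_tag)
  then show ?case using Br lyndon_tag[of "und s @ und t"]
    by (cases s) (auto simp: ALSW_iff und_map)
qed

lemma bracket_eq_graft:
  assumes "lyndon succ_prime w" "set w \<subseteq> Collect proper_prime"
  shows "bracket w = graft (map_bracketing bracket_prime (shirshov succ_prime w))"
proof -
  have "is_NLSW succ_prime (set w) (shirshov succ_prime w)" "und (shirshov succ_prime w) = w"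
    using prime_order.shirshov_NLSW[OF assms] by auto
  then have "shirshov tag_gt (map tag w) = map_bracketing tag (shirshov succ_prime w)"
    using assms by (intro tag_order.shirshov_eqI[of "tag ` set w"] is_NLSW_tag) (auto simp: und_map)
  then show ?thesis
    by (simp add: bracket_def assemble_def tag_gt_def tag_def[abs_def, symmetric] bracketing.map_comp snd_tag)
qed

lemma bracket_single: "proper_prime p \<Longrightarrow> bracket [p] = bracket_prime p"
  by (simp add: bracket_eq_graft prime_order.shirshov_single)

lemma bracket_std:
  assumes uv: "prime_order.std u v" and "set u \<subseteq> Collect proper_prime" "set v \<subseteq> Collect proper_prime"
  shows "bracket (u @ v) = BLie (bracket u) (bracket v)"
proof -
  have "lyndon succ_prime u" "lyndon succ_prime v" "lyndon succ_prime (u @ v)"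
    using uv prime_order.std_lyndon by (auto simp: prime_order.std_def)
  then show ?thesis
    using prime_order.shirshov_std[OF assms] assms by (simp add: bracket_eq_graft)
qed

lemma bracket_prime_PW: "bracket_prime (PW w) = BP (bracket w)"
  by (simp add: bracket_def)


section \<open>Irreducible words\<close>

lemma letters_mono: "A \<subseteq> B \<Longrightarrow> set w \<subseteq> S \<union> PW ` A \<Longrightarrow> set w \<subseteq> S \<union> PW ` B"
  by blast

lemma alsw_upto_Suc_mono: "alsw_upto X n \<subseteq> alsw_upto X (Suc n)"
proof (induction n)
  case 0
  then show ?case by (auto simp: ALSW_iff)
next
  case (Suc n)
  show ?case
  proof
    fix w assume "w \<in> alsw_upto X (Suc n)"
    then show "w \<in> alsw_upto X (Suc (Suc n))"
      using letters_mono[OF Suc, of w "Letter ` Delta X"]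
      unfolding alsw_upto.simps(2) ALSW_iff by blast
  qed
qed

lemma alsw_upto_mono: "m \<le> n \<Longrightarrow> alsw_upto X m \<subseteq> alsw_upto X n"
  using alsw_upto_Suc_mono by (rule lift_Suc_mono_le[of "alsw_upto X"])

text \<open>A word has finitely many letters, so they lie in a common stage. Hence the unions over
  all stages satisfy the recursion without the index.\<close>

lemma finite_subset_stage:
  assumes mono: "\<And>m n :: nat. m \<le> n \<Longrightarrow> A m \<subseteq> A n" and "finite S" "S \<subseteq> (\<Union>n. A n)"
  shows "\<exists>n. S \<subseteq> A n"
  using assms(2,3)
proof (induction S rule: finite_induct)
  case (insert x S)
  then obtain m n where mn: "S \<subseteq> A m" "x \<in> A n" by auto
  then have "insert x S \<subseteq> A (max m n)" using mono[of m "max m n"] mono[of n "max m n"] by auto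
  then show ?case ..
qed simp

lemma alsw_iff:
  "w \<in> alsw X \<longleftrightarrow> lyndon succ_prime w \<and> set w \<subseteq> Letter ` Delta X \<union> PW ` alsw X"
proof
  assume "w \<in> alsw X"
  then obtain n where "w \<in> alsw_upto X n" by (auto simp: alsw_def)
  then have "w \<in> alsw_upto X (Suc n)" using alsw_upto_Suc_mono by blast
  then have "lyndon succ_prime w" "set w \<subseteq> Letter ` Delta X \<union> PW ` alsw_upto X n"
    by (simp_all add: ALSW_iff)
  moreover have "alsw_upto X n \<subseteq> alsw X" unfolding alsw_def by blast
  ultimately show "lyndon succ_prime w \<and> set w \<subseteq> Letter ` Delta X \<union> PW ` alsw X"
    using letters_mono by blast
next
  assume w: "lyndon succ_prime w \<and> set w \<subseteq> Letter ` Delta X \<union> PW ` alsw X"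
  have "Letter ` Delta X \<union> PW ` alsw_upto X m \<subseteq> Letter ` Delta X \<union> PW ` alsw_upto X n" if "m \<le> n" for m n
    using alsw_upto_mono[OF that] by (intro Un_mono image_mono) auto
  moreover have "set w \<subseteq> (\<Union>n. Letter ` Delta X \<union> PW ` alsw_upto X n)"
    using w unfolding alsw_def by blast
  ultimately have "\<exists>n. set w \<subseteq> Letter ` Delta X \<union> PW ` alsw_upto X n"
    using finite_subset_stage[where A = "\<lambda>n. Letter ` Delta X \<union> PW ` alsw_upto X n" and S = "set w"] by blast
  then obtain n where "set w \<subseteq> Letter ` Delta X \<union> PW ` alsw_upto X n" ..
  then have "w \<in> alsw_upto X (Suc n)" using w by (auto simp: ALSW_iff)
  then show "w \<in> alsw X" unfolding alsw_def by blast
qed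

lemma alsw_nonempty: "w \<in> alsw X \<Longrightarrow> w \<noteq> []"
  using alsw_iff unfolding lyndon_def by blast

lemma opwords_upto_Suc_mono: "opwords_upto Z n \<subseteq> opwords_upto Z (Suc n)"
proof (induction n)
  case 0
  then show ?case by (auto simp: nonempty_words_def)
next
  case (Suc n)
  show ?case
  proof
    fix w assume "w \<in> opwords_upto Z (Suc n)"
    then show "w \<in> opwords_upto Z (Suc (Suc n))"
      using letters_mono[OF Suc, of w "Letter ` Z"]
      unfolding opwords_upto.simps(2) nonempty_words_def by blast
  qed
qed

lemma opwords_upto_mono: "m \<le> n \<Longrightarrow> opwords_upto Z m \<subseteq> opwords_upto Z n"
  using opwords_upto_Suc_mono by (rule lift_Suc_mono_le[of "opwords_upto Z"])

lemma opwords_iff: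
  "w \<in> opwords Z \<longleftrightarrow> w \<noteq> [] \<and> set w \<subseteq> Letter ` Z \<union> PW ` opwords Z"
proof
  assume "w \<in> opwords Z"
  then obtain n where "w \<in> opwords_upto Z n" by (auto simp: opwords_def)
  then have "w \<in> opwords_upto Z (Suc n)" using opwords_upto_Suc_mono by blast
  then have "w \<noteq> []" "set w \<subseteq> Letter ` Z \<union> PW ` opwords_upto Z n"
    by (simp_all add: nonempty_words_def)
  moreover have "opwords_upto Z n \<subseteq> opwords Z" unfolding opwords_def by blast
  ultimately show "w \<noteq> [] \<and> set w \<subseteq> Letter ` Z \<union> PW ` opwords Z"
    using letters_mono by blast
next
  assume w: "w \<noteq> [] \<and> set w \<subseteq> Letter ` Z \<union> PW ` opwords Z"
  have "Letter ` Z \<union> PW ` opwords_upto Z m \<subseteq> Letter ` Z \<union> PW ` opwords_upto Z n" if "m \<le> n" for m n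
    using opwords_upto_mono[OF that] by (intro Un_mono image_mono) auto
  moreover have "set w \<subseteq> (\<Union>n. Letter ` Z \<union> PW ` opwords_upto Z n)"
    using w unfolding opwords_def by blast
  ultimately have "\<exists>n. set w \<subseteq> Letter ` Z \<union> PW ` opwords_upto Z n"
    using finite_subset_stage[where A = "\<lambda>n. Letter ` Z \<union> PW ` opwords_upto Z n" and S = "set w"] by blast
  then obtain n where "set w \<subseteq> Letter ` Z \<union> PW ` opwords_upto Z n" ..
  then have "w \<in> opwords_upto Z (Suc n)" using w by (auto simp: nonempty_words_def)
  then show "w \<in> opwords Z" unfolding opwords_def by blast
qed

lemma alsw_proper: "w \<in> alsw X \<Longrightarrow> p \<in> set w \<Longrightarrow> proper_prime p"
proof (induction p arbitrary: w)
  case (PW u)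
  then have u: "u \<in> alsw X" using alsw_iff by blast
  then have "u \<noteq> []" by (rule alsw_nonempty)
  then show ?case using PW.IH u by auto
qed simp

lemma alsw_opwords: "w \<in> alsw X \<Longrightarrow> w \<in> opwords (Delta X)"
proof (induction "wdeg w" arbitrary: w rule: less_induct)
  case less
  have "p \<in> Letter ` Delta X \<union> PW ` opwords (Delta X)" if p: "p \<in> set w" for p
  proof -
    have "pdeg p \<le> wdeg w" using p by (simp add: wdeg_def member_le_sum_list)
    moreover have "p \<in> Letter ` Delta X \<union> PW ` alsw X" using less.prems p alsw_iff by blast
    ultimately show ?thesis using less.hyps by auto
  qed
  moreover have "w \<noteq> []" using less.prems by (rule alsw_nonempty)
  ultimately show ?case by (subst opwords_iff) blast
qed

definition irr_words :: "'x::wellorder set \<Rightarrow> (nat \<times> 'x) opword set" where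
  "irr_words X = {w \<in> alsw X. \<forall>\<pi>\<in>star_words X. \<forall>u\<in>alsw X. \<forall>v\<in>alsw X.
     word_gt u v \<longrightarrow> w \<noteq> plug \<pi> [PW u, PW v]}"

lemma Irr_eq: "Irr X = bracket ` irr_words X"
  unfolding Irr_def irr_words_def by blast

lemma plug_simps [simp]:
  "plug [] u = []" "plug (p # \<pi>) u = plug_prime u p @ plug \<pi> u" "plug (\<pi> @ \<rho>) u = plug \<pi> u @ plug \<rho> u"
  by (simp_all add: plug_def)

lemma plug_prime_PW [simp]: "plug_prime u (PW w) = [PW (plug w u)]"
  by (simp add: plug_def)

declare plug_prime.simps(2) [simp del]

text \<open>Renaming letters by \<open>Some\<close> makes a word without holes, which
  \<open>plug\<close> turns back into the original. Such words surround the hole in the contexts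
  built below.\<close>

lemma lift_prime: "plug_prime u (map_prime_word Some p) = [p]" "stars (map_prime_word Some p) = 0"
proof (induction p)
  case (PW w)
  have "plug (map (map_prime_word Some) w) u = w" using PW by (induction w) auto
  moreover have "sum_list (map stars (map (map_prime_word Some) w)) = 0" using PW by (induction w) auto
  ultimately show "plug_prime u (map_prime_word Some (PW w)) = [PW w]"
    "stars (map_prime_word Some (PW w)) = 0" by simp_all
qed auto

lemma lift_word: "plug (map (map_prime_word Some) w) u = w"
    "sum_list (map stars (map (map_prime_word Some) w)) = 0"
  by (induction w) (auto simp: lift_prime)

lemma lift_letters:
  assumes "set w \<subseteq> Letter ` Z \<union> PW ` opwords Z"
  shows "set (map (map_prime_word Some) w) \<subseteq> Letter ` insert None (Some ` Z) \<union> PW ` opwords (insert None (Some ` Z))"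
  using assms
proof (induction "size_list size w" arbitrary: w rule: less_induct)
  case less
  have "map_prime_word Some p \<in> Letter ` insert None (Some ` Z) \<union> PW ` opwords (insert None (Some ` Z))"
    if p: "p \<in> set w" for p
  proof (cases p)
    case (Letter d)
    then show ?thesis using less.prems p by auto
  next
    case (PW u)
    then have u: "u \<in> opwords Z" using less.prems p by auto
    have "size_list size u < size p" using PW by simp
    also have "size p \<le> size_list size w" using p size_list_estimation'[of p w "size p" size] by simp
    finally have "set (map (map_prime_word Some) u)
        \<subseteq> Letter ` insert None (Some ` Z) \<union> PW ` opwords (insert None (Some ` Z))"
      using less.hyps u opwords_iff by blast
    moreover have "u \<noteq> []" using u opwords_iff by blast
    ultimately have "map (map_prime_word Some) u \<in> opwords (insert None (Some ` Z))"
      by (subst opwords_iff) simp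
    then show ?thesis using PW by auto
  qed
  then show ?case by auto
qed

lemma star_wordsI:
  assumes "set a \<union> set b \<subseteq> Letter ` Delta X \<union> PW ` alsw X"
    and "p = Letter None \<or> (\<exists>\<pi>\<in>star_words X. p = PW \<pi>)"
  shows "map (map_prime_word Some) a @ p # map (map_prime_word Some) b \<in> star_words X"
proof -
  let ?Z = "insert None (Some ` Delta X)"
  have "PW ` alsw X \<subseteq> PW ` opwords (Delta X)"
    using alsw_opwords by (intro image_mono) blast
  then have "set a \<subseteq> Letter ` Delta X \<union> PW ` opwords (Delta X)"
    "set b \<subseteq> Letter ` Delta X \<union> PW ` opwords (Delta X)"
    using assms(1) by blast+
  then have "set (map (map_prime_word Some) a) \<subseteq> Letter ` ?Z \<union> PW ` opwords ?Z"
    "set (map (map_prime_word Some) b) \<subseteq> Letter ` ?Z \<union> PW ` opwords ?Z"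
    using lift_letters by blast+
  moreover have "p \<in> Letter ` ?Z \<union> PW ` opwords ?Z" "stars p = 1"
    using assms(2) by (auto simp: star_words_def)
  ultimately show ?thesis
    unfolding star_words_def
    by (subst mem_Collect_eq, subst opwords_iff) (auto simp: lift_word simp del: map_map)
qed

text \<open>The numbers of holes add up to 1, so a prime with a hole has exactly one: it is the hole
  or \<open>PW\<close> of another star word.\<close>

lemma star_word_cases:
  assumes "\<pi> \<in> star_words X"
  obtains \<alpha> \<beta> where "\<And>u. plug \<pi> u = plug \<alpha> u @ u @ plug \<beta> u"
  | \<alpha> \<beta> \<rho> where "\<rho> \<in> star_words X" "\<And>u. plug \<pi> u = plug \<alpha> u @ PW (plug \<rho> u) # plug \<beta> u"
proof -
  have one: "sum_list (map stars \<pi>) = 1" and \<pi>: "\<pi> \<in> opwords (insert None (Some ` Delta X))"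
    using assms by (auto simp: star_words_def)
  from one have "sum_list (map stars \<pi>) \<noteq> 0" by simp
  then have "\<exists>p\<in>set \<pi>. stars p \<noteq> 0" by (induction \<pi>) auto
  then obtain p where p: "p \<in> set \<pi>" "stars p \<noteq> 0" by blast
  then obtain \<alpha> \<beta> where ab: "\<pi> = \<alpha> @ p # \<beta>" by (meson split_list)
  then have "stars p = 1" using one p by simp
  show ?thesis
  proof (cases p)
    case (Letter d)
    then have "d = None" using p by (auto split: if_splits)
    then show ?thesis using ab Letter that(1)[of \<alpha> \<beta>] by simp
  next
    case (PW \<rho>)
    then have "\<rho> \<in> opwords (insert None (Some ` Delta X))" using \<pi> p opwords_iff by blast
    then have "\<rho> \<in> star_words X" using \<open>stars p = 1\<close> PW by (simp add: star_words_def)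
    then show ?thesis using ab PW that(2)[of \<rho> \<alpha> \<beta>] by simp
  qed
qed

text \<open>A pattern P(u)P(v) occurs among the primes of \<open>w\<close> or inside one of its P.
  Everything below uses this recursion in place of the search through all contexts.\<close>

lemma irr_words_iff:
  "w \<in> irr_words X \<longleftrightarrow> lyndon succ_prime w \<and> set w \<subseteq> Letter ` Delta X \<union> PW ` irr_words X \<and>
     (\<forall>a u v b. w = a @ PW u # PW v # b \<longrightarrow> \<not> word_gt u v)"
proof (intro iffI conjI allI impI)
  assume w: "w \<in> irr_words X"
  then have "w \<in> alsw X" by (simp add: irr_words_def)
  then have 1: "lyndon succ_prime w" "set w \<subseteq> Letter ` Delta X \<union> PW ` alsw X"
    using alsw_iff by blast+
  show "lyndon succ_prime w" by (rule 1)
  show "set w \<subseteq> Letter ` Delta X \<union> PW ` irr_words X"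
  proof
    fix p assume p: "p \<in> set w"
    show "p \<in> Letter ` Delta X \<union> PW ` irr_words X"
    proof (cases p)
      case (PW x)
      then have x: "x \<in> alsw X" using 1 p by auto
      obtain a b where ab: "w = a @ p # b" using p by (meson split_list)
      have "x \<noteq> plug \<pi> [PW u, PW v]" if "\<pi> \<in> star_words X" "u \<in> alsw X" "v \<in> alsw X" "word_gt u v" for \<pi> u v
      proof
        assume "x = plug \<pi> [PW u, PW v]"
        then have "w = plug (map (map_prime_word Some) a @ PW \<pi> # map (map_prime_word Some) b) [PW u, PW v]"
          using ab PW by (simp add: lift_word)
        moreover have "map (map_prime_word Some) a @ PW \<pi> # map (map_prime_word Some) b \<in> star_words X"
          using 1 ab that by (intro star_wordsI) auto
        ultimately show False using w that unfolding irr_words_def by blast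
      qed
      then show ?thesis using x PW by (auto simp: irr_words_def)
    qed (use 1 p in auto)
  qed
  fix a u v b assume ab: "w = a @ PW u # PW v # b"
  show "\<not> word_gt u v"
  proof
    assume "word_gt u v"
    moreover have "w = plug (map (map_prime_word Some) a @ Letter None # map (map_prime_word Some) b) [PW u, PW v]"
      using ab by (simp add: lift_word)
    moreover have "map (map_prime_word Some) a @ Letter None # map (map_prime_word Some) b \<in> star_words X"
      using 1 ab by (intro star_wordsI) auto
    moreover have "u \<in> alsw X" "v \<in> alsw X" using 1 ab by auto
    ultimately show False using w unfolding irr_words_def by blast
  qed
next
  assume w: "lyndon succ_prime w \<and> set w \<subseteq> Letter ` Delta X \<union> PW ` irr_words X \<and>
     (\<forall>a u v b. w = a @ PW u # PW v # b \<longrightarrow> \<not> word_gt u v)"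
  then have "set w \<subseteq> Letter ` Delta X \<union> PW ` alsw X" by (auto simp: irr_words_def)
  then have "w \<in> alsw X" using w alsw_iff by blast
  moreover have "w \<noteq> plug \<pi> [PW u, PW v]"
    if that: "\<pi> \<in> star_words X" "u \<in> alsw X" "v \<in> alsw X" "word_gt u v" for \<pi> u v
  proof
    assume plug: "w = plug \<pi> [PW u, PW v]"
    from that(1) show False
    proof (cases rule: star_word_cases)
      case (1 \<alpha> \<beta>)
      then have "w = plug \<alpha> [PW u, PW v] @ PW u # PW v # plug \<beta> [PW u, PW v]" using plug by simp
      then show ?thesis using w that(4) by blast
    next
      case (2 \<alpha> \<beta> \<rho>)
      then have "PW (plug \<rho> [PW u, PW v]) \<in> set w" using plug by simp
      then have "plug \<rho> [PW u, PW v] \<in> irr_words X" using w by auto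
      then show ?thesis using 2 that unfolding irr_words_def by blast
    qed
  qed
  ultimately show "w \<in> irr_words X" by (simp add: irr_words_def)
qed


section \<open>The irreducible words span\<close>

lemma irr_lyndon: "w \<in> irr_words X \<Longrightarrow> lyndon succ_prime w"
  using irr_words_iff by blast

lemma irr_nonempty: "w \<in> irr_words X \<Longrightarrow> w \<noteq> []"
  using irr_lyndon unfolding lyndon_def by blast

lemma irr_proper: "w \<in> irr_words X \<Longrightarrow> set w \<subseteq> Collect proper_prime"
  using alsw_proper unfolding irr_words_def by blast

lemma irr_left:
  assumes "u @ v \<in> irr_words X" "lyndon succ_prime u"
  shows "u \<in> irr_words X"
proof (subst irr_words_iff, intro conjI allI impI assms(2))
  show "set u \<subseteq> Letter ` Delta X \<union> PW ` irr_words X" using assms irr_words_iff[of "u @ v" X] by auto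
  fix a p q b assume "u = a @ PW p # PW q # b"
  then have "u @ v = a @ PW p # PW q # (b @ v)" by simp
  then show "\<not> word_gt p q" using assms(1) irr_words_iff by blast
qed

lemma irr_right:
  assumes "u @ v \<in> irr_words X" "lyndon succ_prime v"
  shows "v \<in> irr_words X"
proof (subst irr_words_iff, intro conjI allI impI assms(2))
  show "set v \<subseteq> Letter ` Delta X \<union> PW ` irr_words X" using assms irr_words_iff[of "u @ v" X] by auto
  fix a p q b assume "v = a @ PW p # PW q # b"
  then have "u @ v = (u @ a) @ PW p # PW q # b" by simp
  then show "\<not> word_gt p q" using assms(1) irr_words_iff by blast
qed

text \<open>A new ascent can only arise where the two words meet.\<close>

lemma irr_append:
  assumes u: "u \<in> irr_words X" and v: "v \<in> irr_words X" and uv: "prime_order.lex_less u v"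
    and nj: "\<And>p q u' v'. u = u' @ [PW p] \<Longrightarrow> v = PW q # v' \<Longrightarrow> \<not> word_gt p q"
  shows "u @ v \<in> irr_words X"
proof (subst irr_words_iff, intro conjI allI impI)
  show "lyndon succ_prime (u @ v)"
    using prime_order.lyndon_concat(2) irr_lyndon u v uv by blast
  show "set (u @ v) \<subseteq> Letter ` Delta X \<union> PW ` irr_words X"
    using irr_words_iff[of u X] irr_words_iff[of v X] u v by simp
  fix a p q b assume "u @ v = a @ PW p # PW q # b"
  then consider r where "a = u @ r" "v = r @ PW p # PW q # b" | "u = a @ [PW p]" "v = PW q # b"
    | r where "u = a @ PW p # PW q # r"
    by (auto simp: append_eq_append_conv2 append_eq_Cons_conv)
  then show "\<not> word_gt p q"
  proof cases
    case 1
    then show ?thesis using v irr_words_iff by blast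
  next
    case 2
    then show ?thesis using nj by blast
  next
    case 3
    then show ?thesis using u irr_words_iff by blast
  qed
qed

lemma irr_PW: "w \<in> irr_words X \<Longrightarrow> [PW w] \<in> irr_words X"
  by (subst irr_words_iff) (auto simp: Cons_eq_append_conv)

lemma irr_Letter: "x \<in> X \<Longrightarrow> [Letter (m, x)] \<in> irr_words X"
  by (subst irr_words_iff) (auto simp: Cons_eq_append_conv Delta_def)

lemma irr_single_cases:
  assumes "[p] \<in> irr_words X"
  obtains m x where "p = Letter (m, x)" "x \<in> X" | w where "p = PW w" "w \<in> irr_words X"
  using assms irr_words_iff[of "[p]" X] by (auto simp: Delta_def)

lemma irr_std_exists:
  assumes "w \<in> irr_words X" "length w \<noteq> 1"
  obtains u v where "prime_order.std u v" "w = u @ v" "u \<in> irr_words X" "v \<in> irr_words X"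
proof -
  obtain u v where uv: "prime_order.std u v" "w = u @ v"
    using prime_order.std_exists irr_lyndon irr_proper assms by blast
  then show ?thesis
    using that irr_left irr_right assms(1) unfolding prime_order.std_def by blast
qed

text \<open>A word has finitely many rearrangements, so raising it among them lowers this number;
  the expansion of brackets, which raises words, terminates for that reason.\<close>

definition rank :: "(nat \<times> 'x::wellorder) opword \<Rightarrow> nat" where
  "rank x = card {y. mset y = mset x \<and> prime_order.lex_less x y}"

text \<open>The words that may occur in the expansion of the bracket of \<open>u\<close> and \<open>v\<close>, where \<open>x = u v\<close>.\<close>

definition below :: "'x::wellorder set \<Rightarrow> (nat \<times> 'x) opword \<Rightarrow> (nat \<times> 'x) opword set" where
  "below X x = {w \<in> irr_words X. wdeg w \<le> wdeg x \<and>
     (length w < length x \<or> mset w = mset x \<and> (w = x \<or> prime_order.lex_less x w))}"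

definition down :: "(nat \<times> 'x::wellorder) opword \<Rightarrow> (nat \<times> 'x) opword \<Rightarrow> bool" where
  "down y x \<longleftrightarrow> length y < length x \<and> wdeg y \<le> wdeg x \<or> mset y = mset x \<and> prime_order.lex_less x y"

lemma wdeg_mset: "mset w = mset x \<Longrightarrow> wdeg w = wdeg x"
  by (metis wdeg_def mset_map sum_mset_sum_list)

lemma below_down:
  assumes "down y x"
  shows "below X y \<subseteq> below X x"
proof
  fix w assume w: "w \<in> below X y"
  from assms consider "length y < length x" "wdeg y \<le> wdeg x" | "mset y = mset x" "prime_order.lex_less x y"
    unfolding down_def by blast
  then show "w \<in> below X x"
  proof cases
    case 1
    have "length w \<le> length y" using w unfolding below_def by (auto dest: mset_eq_length)
    then show ?thesis using w 1 unfolding below_def by simp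
  next
    case 2
    then have "wdeg y = wdeg x" "length y = length x" by (auto dest: wdeg_mset mset_eq_length)
    moreover have "prime_order.lex_less y w \<Longrightarrow> prime_order.lex_less x w" using 2 prime_order.lex_trans by blast
    ultimately show ?thesis using w 2 unfolding below_def by auto
  qed
qed

lemma rank_less:
  assumes "mset y = mset x" "prime_order.lex_less x y"
  shows "rank y < rank x"
  unfolding rank_def
proof (rule psubset_card_mono)
  have "{y. mset y = mset x} \<subseteq> {y. set y \<subseteq> set x \<and> length y = length x}"
    using mset_eq_setD mset_eq_length by fastforce
  then have "finite {y. mset y = mset x}"
    by (rule finite_subset) (simp add: finite_lists_length_eq)
  then show "finite {y. mset y = mset x \<and> prime_order.lex_less x y}" by simp
  have "{z. mset z = mset y \<and> prime_order.lex_less y z} \<subseteq> {y. mset y = mset x \<and> prime_order.lex_less x y}"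
    using assms prime_order.lex_trans by auto
  moreover have "y \<in> {y. mset y = mset x \<and> prime_order.lex_less x y}"
    "y \<notin> {z. mset z = mset y \<and> prime_order.lex_less y z}"
    using assms prime_order.lex_irrefl by auto
  ultimately show "{z. mset z = mset y \<and> prime_order.lex_less y z} \<subset> {y. mset y = mset x \<and> prime_order.lex_less x y}"
    by blast
qed

lemma down_measure: "down y x \<Longrightarrow> (y, x) \<in> measures [wdeg, length, rank]"
  unfolding down_def using rank_less[of y x] wdeg_mset[of y x] mset_eq_length[of y x] by auto

text \<open>The last component decides when the product \<open>u v\<close> stays the same: for
  \<open>u = u1 u2\<close>, the expansion passes from \<open>[u, v]\<close> to
  \<open>[u1, u2 v]\<close>, whose left factor is shorter.\<close>

definition pair_rel :: "(((nat \<times> 'x::wellorder) opword \<times> (nat \<times> 'x) opword) \<times>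
    ((nat \<times> 'x) opword \<times> (nat \<times> 'x) opword)) set" where
  "pair_rel = measures [\<lambda>(u, v). wdeg (u @ v), \<lambda>(u, v). length (u @ v), \<lambda>(u, v). rank (u @ v),
     \<lambda>(u, v). length u]"

lemma wf_pair_rel: "wf pair_rel"
  by (simp add: pair_rel_def)

lemma pair_rel_down: "down (u' @ v') (u @ v) \<Longrightarrow> ((u', v'), (u, v)) \<in> pair_rel"
  using down_measure[of "u' @ v'" "u @ v"] unfolding pair_rel_def by (auto simp del: wdeg_simps)

lemma pair_rel_wdeg: "wdeg (u' @ v') < wdeg (u @ v) \<Longrightarrow> ((u', v'), (u, v)) \<in> pair_rel"
  unfolding pair_rel_def by simp

lemma pair_rel_left: "u' @ v' = u @ v \<Longrightarrow> length u' < length u \<Longrightarrow> ((u', v'), (u, v)) \<in> pair_rel"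
  unfolding pair_rel_def by (simp del: wdeg_simps length_append)

lemma lex_ge_append:
  assumes "w = y \<or> prime_order.lex_less y w" "length w = length y" "prime_order.lex_less x (y @ s)"
  shows "prime_order.lex_less x (w @ s)"
  using assms lex_gt_append[of succ_prime y w s s] prime_order.lex_trans lex_diff_imp_gt
  by fastforce

context diff_lie_rb_algebra
begin

lemma smult_cl: "x \<in> carrier L \<Longrightarrow> c \<odot> x \<in> carrier L"
  by (rule smult_closed) auto

lemma smult_zero: "c \<odot> \<zero> = \<zero>"
proof -
  have "c \<odot> \<zero> = c \<odot> (\<zero> \<oplus> \<zero>)" by simp
  also have "\<dots> = c \<odot> \<zero> \<oplus> c \<odot> \<zero>" by (rule smult_r_distr) auto
  finally show ?thesis using smult_cl[of \<zero> c] by (metis add.l_cancel_one' zero_closed)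
qed

lemma smult_smult: "x \<in> carrier L \<Longrightarrow> a \<odot> (b \<odot> x) = (a * b) \<odot> x"
  using smult_assoc1[of a b x] by simp

lemma smult_one': "x \<in> carrier L \<Longrightarrow> 1 \<odot> x = x"
  using smult_one by simp

lemma smult_zero_left: "x \<in> carrier L \<Longrightarrow> 0 \<odot> x = \<zero>"
  using smult_l_null by simp

lemma smult_add: "x \<in> carrier L \<Longrightarrow> y \<in> carrier L \<Longrightarrow> c \<odot> (x \<oplus> y) = c \<odot> x \<oplus> c \<odot> y"
  by (rule smult_r_distr) auto

lemma smult_add_left: "x \<in> carrier L \<Longrightarrow> (a + b) \<odot> x = a \<odot> x \<oplus> b \<odot> x"
  using smult_l_distr[of a b x] by simp

lemma lie_anti:
  assumes "x \<in> carrier L" "y \<in> carrier L"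
  shows "lie L y x = (- 1) \<odot> lie L x y"
proof -
  have cl: "lie L x y \<in> carrier L" "lie L y x \<in> carrier L" using assms lie_closed by auto
  have "lie L (x \<oplus> y) (x \<oplus> y) = lie L x y \<oplus> lie L y x"
    using assms cl by (simp add: lie_add_left lie_add_right lie_self[of x] lie_self[of y] a_comm)
  then have "lie L x y \<oplus> lie L y x = \<zero>" using assms lie_self[of "x \<oplus> y"] by simp
  moreover have "lie L x y \<oplus> (- 1) \<odot> lie L x y = \<zero>"
    using smult_add_left[OF cl(1), of 1 "- 1"] cl smult_one'[OF cl(1)] smult_zero_left[OF cl(1)] by simp
  ultimately show ?thesis
    using cl smult_cl[OF cl(1)] by (metis a_comm add.right_cancel)
qed

text \<open>The Jacobi identity in the form that bracketing with \<open>z\<close> is a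
  derivation.\<close>

lemma jacobi_left:
  assumes x: "x \<in> carrier L" and y: "y \<in> carrier L" and z: "z \<in> carrier L"
  shows "lie L (lie L x y) z = lie L (lie L x z) y \<oplus> lie L x (lie L y z)"
proof -
  let ?a = "lie L x (lie L y z)" and ?b = "lie L (lie L x z) y" and ?c = "lie L (lie L x y) z"
  have cl: "?a \<in> carrier L" "?b \<in> carrier L" "?c \<in> carrier L"
    using assms lie_closed by auto
  have "lie L y (lie L z x) = ?b"
    using assms cl by (simp add: lie_anti[of x z] lie_anti[of _ y] lie_smult_left lie_smult_right
        lie_closed smult_smult smult_one' lie_anti[of "lie L x z" y])
  moreover have "lie L z (lie L x y) = (- 1) \<odot> ?c" using assms by (simp add: lie_anti[of _ z] lie_closed)
  ultimately have "?a \<oplus> ?b \<oplus> (- 1) \<odot> ?c = \<zero>" using jacobi[OF assms] by simp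
  moreover have "?c \<oplus> (- 1) \<odot> ?c = \<zero>"
    using smult_add_left[OF cl(3), of 1 "- 1"] cl smult_one'[OF cl(3)] smult_zero_left[OF cl(3)] by simp
  ultimately have "?a \<oplus> ?b = ?c"
    using cl smult_cl[OF cl(3)] by (metis add.m_closed add.right_cancel)
  then show ?thesis using cl by (simp add: a_comm)
qed

end

section \<open>Spans of bracketed words in an algebra with marked elements\<close>

locale drb_gens = diff_lie_rb_algebra lam L
  for lam :: "'k::field" and L :: "('k, 'a, 'm) drb_alg_scheme" (structure) +
  fixes X :: "'x::wellorder set" and g :: "'x \<Rightarrow> 'a"
  assumes g_closed: "x \<in> X \<Longrightarrow> g x \<in> carrier L"
begin

inductive_set lspan :: "'a set \<Rightarrow> 'a set" for S where
  lspan_zero: "\<zero> \<in> lspan S"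
| lspan_step: "x \<in> S \<Longrightarrow> y \<in> lspan S \<Longrightarrow> c \<odot> x \<oplus> y \<in> lspan S"

lemma lspan_closed:
  assumes "S \<subseteq> carrier L" "x \<in> lspan S"
  shows "x \<in> carrier L"
  using assms(2) by induction (use assms(1) in \<open>auto simp: smult_cl\<close>)

lemma lspan_add:
  assumes S: "S \<subseteq> carrier L" and "x \<in> lspan S" "y \<in> lspan S"
  shows "x \<oplus> y \<in> lspan S"
  using assms(2)
proof induction
  case lspan_zero
  then show ?case using lspan_closed[OF S] assms(3) by simp
next
  case (lspan_step z w c)
  then have "c \<odot> z \<oplus> (w \<oplus> y) \<in> lspan S" by (intro lspan.intros)
  then show ?case
    using a_assoc[of "c \<odot> z" w y] lspan_step S lspan_closed[OF S] assms(3) smult_cl by auto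
qed

lemma lspan_smult:
  assumes S: "S \<subseteq> carrier L" and "x \<in> lspan S"
  shows "c \<odot> x \<in> lspan S"
  using assms(2)
proof induction
  case lspan_zero
  then show ?case by (simp add: smult_zero lspan.intros)
next
  case (lspan_step z w d)
  then have "(c * d) \<odot> z \<oplus> c \<odot> w \<in> lspan S" by (intro lspan.intros)
  moreover have "z \<in> carrier L" "w \<in> carrier L" using lspan_step S lspan_closed[OF S] by auto
  ultimately show ?case by (simp add: smult_add smult_cl smult_smult)
qed

lemma lspan_base: "S \<subseteq> carrier L \<Longrightarrow> x \<in> S \<Longrightarrow> x \<in> lspan S"
  using lspan_step[of x S \<zero> 1] lspan_zero by (auto simp: smult_one')

lemma lspan_mono:
  assumes "S \<subseteq> T" "x \<in> lspan S"
  shows "x \<in> lspan T"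
  using assms(2) by induction (use assms(1) in \<open>auto intro: lspan.intros\<close>)

lemma lspan_image:
  assumes S: "S \<subseteq> carrier L" and T: "T \<subseteq> carrier L"
    and add: "\<And>x y. x \<in> carrier L \<Longrightarrow> y \<in> carrier L \<Longrightarrow> h (x \<oplus> y) = h x \<oplus> h y"
    and smult: "\<And>c x. x \<in> carrier L \<Longrightarrow> h (c \<odot> x) = c \<odot> h x"
    and closed: "\<And>x. x \<in> carrier L \<Longrightarrow> h x \<in> carrier L"
    and ST: "\<And>x. x \<in> S \<Longrightarrow> h x \<in> lspan T" and x: "x \<in> lspan S"
  shows "h x \<in> lspan T"
  using x
proof induction
  case lspan_zero
  have "h \<zero> = \<zero>"
    using smult[of \<zero> 0] smult_zero_left[of \<zero>] smult_zero_left[OF closed, of \<zero>] by simp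
  then show ?case by (simp add: lspan.intros)
next
  case (lspan_step z w c)
  then have "z \<in> carrier L" "w \<in> carrier L" using S lspan_closed[OF S] by auto
  then show ?case
    using lspan_step ST T by (simp add: add smult smult_cl lspan_add lspan_smult)
qed

lemma lie_lspan_left:
  assumes "S \<subseteq> carrier L" "T \<subseteq> carrier L" "y \<in> carrier L"
    and "\<And>x. x \<in> S \<Longrightarrow> lie L x y \<in> lspan T" "x \<in> lspan S"
  shows "lie L x y \<in> lspan T"
  by (rule lspan_image[where h = "\<lambda>x. lie L x y", OF assms(1,2)])
    (use assms(3-) in \<open>auto simp: lie_add_left lie_smult_left lie_closed\<close>)

lemma lie_lspan_right:
  assumes "S \<subseteq> carrier L" "T \<subseteq> carrier L" "x \<in> carrier L"
    and "\<And>y. y \<in> S \<Longrightarrow> lie L x y \<in> lspan T" "y \<in> lspan S"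
  shows "lie L x y \<in> lspan T"
  by (rule lspan_image[where h = "\<lambda>y. lie L x y", OF assms(1,2)])
    (use assms(3-) in \<open>auto simp: lie_add_right lie_smult_right lie_closed\<close>)

definition e :: "(nat \<times> 'x) opword \<Rightarrow> 'a" where
  "e w = beval L g (bracket w)"

lemma e_std:
  assumes "prime_order.std u v" "u \<in> irr_words X" "v \<in> irr_words X"
  shows "e (u @ v) = lie L (e u) (e v)"
  using bracket_std[OF assms(1) irr_proper[OF assms(2)] irr_proper[OF assms(3)]] by (simp add: e_def)

lemma e_PW: "w \<in> irr_words X \<Longrightarrow> e [PW w] = rb L (e w)"
  using irr_PW[THEN irr_proper, of w X] by (simp add: e_def bracket_single bracket_prime_PW del: bracket_prime.simps(2))

lemma e_Letter: "e [Letter (m, x)] = (df L ^^ m) (g x)"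
  by (simp add: e_def bracket_single)

lemma df_pow_closed: "x \<in> carrier L \<Longrightarrow> (df L ^^ m) x \<in> carrier L"
  by (induction m) (auto simp: df_closed)

lemma e_closed: "w \<in> irr_words X \<Longrightarrow> e w \<in> carrier L"
proof (induction w rule: measure_induct_rule[of "\<lambda>w. size_list size w"])
  case (less w)
  show ?case
  proof (cases "length w = 1")
    case True
    then obtain p where p: "w = [p]" by (cases w) auto
    with less.prems have "[p] \<in> irr_words X" by simp
    then show ?thesis
    proof (cases rule: irr_single_cases)
      case (1 m x)
      then show ?thesis using p by (simp add: e_Letter df_pow_closed g_closed)
    next
      case (2 v)
      then show ?thesis using p less.IH[of v] by (simp add: e_PW rb_closed)
    qed
  next
    case False
    obtain u v where uv: "prime_order.std u v" "w = u @ v" "u \<in> irr_words X" "v \<in> irr_words X"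
      using irr_std_exists[OF less.prems False] .
    then have "u \<noteq> []" "v \<noteq> []" using irr_nonempty by auto
    then have "e u \<in> carrier L" "e v \<in> carrier L" using less.IH uv by (cases u; cases v; auto)+
    then show ?thesis using uv by (simp add: e_std lie_closed)
  qed
qed

abbreviation espan :: "(nat \<times> 'x) opword set \<Rightarrow> 'a set" where
  "espan W \<equiv> lspan (e ` W)"

lemma e_image_closed: "W \<subseteq> irr_words X \<Longrightarrow> e ` W \<subseteq> carrier L"
  using e_closed by auto

lemma below_irr: "below X x \<subseteq> irr_words X"
  by (auto simp: below_def)

lemmas e_below_closed = e_image_closed[OF below_irr]

lemma espan_mono: "V \<subseteq> W \<Longrightarrow> x \<in> espan V \<Longrightarrow> x \<in> espan W"
  using lspan_mono[of "e ` V" "e ` W"] by blast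

lemma espan_lie_sym:
  assumes "W \<subseteq> irr_words X" "u \<in> irr_words X" "v \<in> irr_words X" "lie L (e u) (e v) \<in> espan W"
  shows "lie L (e v) (e u) \<in> espan W"
  using assms lie_anti[of "e u" "e v"] lspan_smult[OF e_image_closed[OF assms(1)]] e_closed by simp

definition lie_below :: "(nat \<times> 'x) opword \<Rightarrow> (nat \<times> 'x) opword \<Rightarrow> bool" where
  "lie_below u v \<longleftrightarrow> lie L (e u) (e v) \<in> espan (below X (u @ v))"

lemma irr_lex_total:
  "u \<in> irr_words X \<Longrightarrow> v \<in> irr_words X \<Longrightarrow> u = v \<or> prime_order.lex_less u v \<or> prime_order.lex_less v u"
  using prime_order.lex_total irr_proper by blast

section \<open>The bracket of two irreducible words: the induction step\<close>

context
  fixes u v :: "(nat \<times> 'x) opword"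
  assumes u: "u \<in> irr_words X" and v: "v \<in> irr_words X" and uv: "prime_order.lex_less u v"
    and IH: "\<And>u' v'. ((u', v'), (u, v)) \<in> pair_rel \<Longrightarrow> u' \<in> irr_words X \<Longrightarrow> v' \<in> irr_words X \<Longrightarrow>
      prime_order.lex_less u' v' \<Longrightarrow> lie_below u' v'"
begin

text \<open>Either of \<open>s\<close> and \<open>t\<close> may be the smaller one, so both products
  have to lie further down; antisymmetry accounts for the order.\<close>

lemma lie_down:
  assumes "s \<in> irr_words X" "t \<in> irr_words X" "down (s @ t) (u @ v)" "down (t @ s) (u @ v)"
  shows "lie L (e s) (e t) \<in> espan (below X (u @ v))"
proof -
  consider "s = t" | "prime_order.lex_less s t" | "prime_order.lex_less t s" using irr_lex_total assms by blast
  then show ?thesis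
  proof cases
    case 1
    then show ?thesis using assms by (simp add: lie_self e_closed lspan_zero)
  next
    case 2
    then have "lie_below s t" using assms by (intro IH pair_rel_down)
    then show ?thesis using espan_mono below_down assms(3) unfolding lie_below_def by blast
  next
    case 3
    then have "lie_below t s" using assms by (intro IH pair_rel_down)
    then have "lie L (e t) (e s) \<in> espan (below X (u @ v))"
      using espan_mono below_down assms(4) unfolding lie_below_def by blast
    then show ?thesis using espan_lie_sym[OF below_irr] assms by blast
  qed
qed

text \<open>After a drop in degree the arrangement of the letters no longer matters, and only the
  degree bound is retained.\<close>

lemma lie_lower_degree:
  assumes "s \<in> irr_words X" "t \<in> irr_words X" "wdeg s + wdeg t < wdeg u + wdeg v"
  shows "lie L (e s) (e t) \<in> espan {w \<in> irr_words X. wdeg w \<le> wdeg s + wdeg t}" (is "_ \<in> espan ?W")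
proof -
  have sub: "below X (s @ t) \<subseteq> ?W" "below X (t @ s) \<subseteq> ?W" by (auto simp: below_def)
  consider "s = t" | "prime_order.lex_less s t" | "prime_order.lex_less t s" using irr_lex_total assms by blast
  then show ?thesis
  proof cases
    case 1
    then show ?thesis using assms by (simp add: lie_self e_closed lspan_zero)
  next
    case 2
    then have "lie_below s t" using assms by (intro IH pair_rel_wdeg) auto
    then show ?thesis using espan_mono sub(1) unfolding lie_below_def by blast
  next
    case 3
    then have "lie_below t s" using assms by (intro IH pair_rel_wdeg) auto
    then have "lie L (e t) (e s) \<in> espan ?W" using espan_mono sub(2) unfolding lie_below_def by blast
    then show ?thesis by (rule espan_lie_sym[rotated -1]) (use assms in auto)
  qed
qed

lemma lie_shorter:
  assumes "s \<in> irr_words X" "t \<in> irr_words X" "prime_order.lex_less s t" "length (s @ t) < length (u @ v)"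
    "wdeg (s @ t) \<le> wdeg (u @ v)"
  shows "lie L (e s) (e t) \<in> espan (below X (s @ t))"
  using IH[of s t] pair_rel_down[of s t u v] assms unfolding lie_below_def down_def by blast

text \<open>In \<open>[[u1, u2], v] = [[u1, v], u2] + [u1, [u2, v]]\<close> the product
  \<open>u1 v u2\<close> is above \<open>u v\<close> since \<open>u2 v \<sqsubset> v u2\<close>, and
  products starting with \<open>u2\<close> are above it since \<open>u \<lless> u2\<close>. Only
  \<open>u1\<close> with \<open>u2 v\<close> gives the word \<open>u v\<close> again, and there the
  left factor is shorter.\<close>

lemma lie_nonstandard:
  assumes std: "prime_order.std u1 u2" and u12: "u = u1 @ u2"
    and irr: "u1 \<in> irr_words X" "u2 \<in> irr_words X" and u2v: "prime_order.lex_less u2 v"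
  shows "lie_below u v"
proof -
  have ne: "u1 \<noteq> []" "u2 \<noteq> []" "v \<noteq> []" using irr v irr_nonempty by auto
  have lyn: "lyndon succ_prime u" "lyndon succ_prime u2" "lyndon succ_prime v"
    using irr u v irr_lyndon by auto
  have u_u2: "prime_order.diff_less u u2"
    using prime_order.lyndon_suffix[of u1 u2] lyn ne u12 by simp
  have "prime_order.lex_less u1 u" using u12 ne by (simp add: lex_gt_prefix)
  then have u1v: "prime_order.lex_less u1 v" using uv prime_order.lex_trans by blast
  have rot: "prime_order.lex_less (u2 @ v) (v @ u2)"
    using prime_order.lyndon_concat_rot lyn u2v by blast
  have cl: "e u1 \<in> carrier L" "e u2 \<in> carrier L" "e v \<in> carrier L" using irr v e_closed by auto
  have 1: "lie L (e u1) (e v) \<in> espan (below X (u1 @ v))"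
    by (rule lie_shorter) (use irr v u1v ne u12 in auto)
  have 2: "lie L (e u2) (e v) \<in> espan (below X (u2 @ v))"
    by (rule lie_shorter) (use irr v u2v ne u12 in auto)
  have A: "lie L (e w) (e u2) \<in> espan (below X (u @ v))" if w: "w \<in> below X (u1 @ v)" for w
  proof (cases "length w < length (u1 @ v)")
    case True
    then show ?thesis using w irr
      by (intro lie_down) (auto simp: down_def below_def u12)
  next
    case False
    then have w': "w \<in> irr_words X" "mset w = mset (u1 @ v)" "w = u1 @ v \<or> prime_order.lex_less (u1 @ v) w"
      using w by (auto simp: below_def)
    have "prime_order.lex_less (u @ v) ((u1 @ v) @ u2)" using rot u12 by (simp add: lex_gt_prepend)
    then have "prime_order.lex_less (u @ v) (w @ u2)"
      using lex_ge_append w' mset_eq_length by blast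
    moreover have "prime_order.lex_less (u @ v) (u2 @ w)"
      using lex_diff_append[OF u_u2] by (rule lex_diff_imp_gt)
    ultimately show ?thesis using w' irr by (intro lie_down) (auto simp: down_def u12)
  qed
  have B: "lie L (e u1) (e w) \<in> espan (below X (u @ v))" if w: "w \<in> below X (u2 @ v)" for w
  proof -
    consider "length w < length (u2 @ v)" | "w = u2 @ v"
      | "mset w = mset (u2 @ v)" "prime_order.lex_less (u2 @ v) w"
      using w unfolding below_def by blast
    then show ?thesis
    proof cases
      case 1
      then show ?thesis using w irr
        by (intro lie_down) (auto simp: down_def below_def u12)
    next
      case 2
      have "prime_order.lex_less u1 u2" using std by (simp add: prime_order.std_def)
      moreover have "prime_order.lex_less u2 (u2 @ v)" using ne by (simp add: lex_gt_prefix)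
      ultimately have "prime_order.lex_less u1 w" using 2 prime_order.lex_trans by blast
      then have "lie_below u1 w"
        using w irr 2 u12 ne by (intro IH pair_rel_left) (auto simp: below_def)
      then show ?thesis using 2 u12 by (simp add: lie_below_def)
    next
      case 3
      then have "prime_order.lex_less (u @ v) (u1 @ w)" using u12 by (simp add: lex_gt_prepend)
      moreover have "prime_order.lex_less (u @ v) ((u2 @ v) @ u1)"
        using lex_diff_append[OF u_u2, of v "v @ u1"] by (simp add: lex_diff_imp_gt)
      then have "prime_order.lex_less (u @ v) (w @ u1)"
        using lex_ge_append[of w "u2 @ v"] 3 mset_eq_length by blast
      ultimately show ?thesis using w 3 irr
        by (intro lie_down) (auto simp: down_def below_def u12)
    qed
  qed
  have "lie L (e u) (e v) = lie L (lie L (e u1) (e v)) (e u2) \<oplus> lie L (e u1) (lie L (e u2) (e v))"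
    using e_std[OF std irr] jacobi_left[OF cl] u12 by simp
  moreover have "lie L (lie L (e u1) (e v)) (e u2) \<in> espan (below X (u @ v))"
    by (rule lie_lspan_left[OF e_below_closed e_below_closed cl(2) _ 1]) (use A in auto)
  moreover have "lie L (e u1) (lie L (e u2) (e v)) \<in> espan (below X (u @ v))"
    by (rule lie_lspan_right[OF e_below_closed e_below_closed cl(1) _ 2]) (use B in auto)
  ultimately show ?thesis unfolding lie_below_def using lspan_add[OF e_below_closed] by simp
qed

text \<open>By the Rota-Baxter identity the bracket is \<open>P\<close> of brackets of total degree
  at most \<open>wdeg p + wdeg q + 1\<close>, one less than the degree of \<open>u v\<close>, so
  these can be expanded. Applying \<open>P\<close> turns each resulting word into a single letter,
  which is shorter than \<open>u v\<close>.\<close>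

lemma lie_two_PW:
  assumes up: "u = [PW p]" and vq: "v = [PW q]"
  shows "lie_below u v"
proof -
  have irr: "p \<in> irr_words X" "q \<in> irr_words X"
    using u v up vq irr_words_iff[of u X] irr_words_iff[of v X] by auto
  have cl: "e p \<in> carrier L" "e q \<in> carrier L" using irr e_closed by auto
  let ?W = "{w \<in> irr_words X. wdeg w \<le> wdeg p + wdeg q + 1}"
  have W: "e ` ?W \<subseteq> carrier L" by (rule e_image_closed) auto
  have "lie L (e p) (e [PW q]) \<in> espan {w \<in> irr_words X. wdeg w \<le> wdeg p + wdeg [PW q]}"
    "lie L (e [PW p]) (e q) \<in> espan {w \<in> irr_words X. wdeg w \<le> wdeg [PW p] + wdeg q}"
    "lie L (e p) (e q) \<in> espan {w \<in> irr_words X. wdeg w \<le> wdeg p + wdeg q}"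
    by (rule lie_lower_degree; use irr irr_PW up vq in auto)+
  then have *: "lie L (e p) (e [PW q]) \<in> espan ?W" "lie L (e [PW p]) (e q) \<in> espan ?W"
    "lie L (e p) (e q) \<in> espan ?W"
    by (auto elim!: espan_mono[rotated])
  have R: "rb L y \<in> espan (below X (u @ v))" if "y \<in> espan ?W" for y
  proof (rule lspan_image[OF W e_below_closed _ _ _ _ that])
    fix y assume "y \<in> e ` ?W"
    then obtain w where w: "w \<in> ?W" "y = e w" by blast
    then have "[PW w] \<in> below X (u @ v)" using up vq irr_PW by (auto simp: below_def)
    then show "rb L y \<in> espan (below X (u @ v))"
      using w e_PW lspan_base[OF e_below_closed] by (metis (no_types, lifting) image_eqI mem_Collect_eq)
  qed (auto simp: rb_add rb_smult rb_closed)
  have "lie L (e u) (e v) = rb L (lie L (e p) (e [PW q])) \<oplus> rb L (lie L (e [PW p]) (e q))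
      \<oplus> lam \<odot> rb L (lie L (e p) (e q))"
    using rota_baxter[OF cl] irr up vq by (simp add: e_PW)
  then show ?thesis unfolding lie_below_def
    using R[OF *(1)] R[OF *(2)] R[OF *(3)] lspan_add[OF e_below_closed] lspan_smult[OF e_below_closed] by simp
qed

text \<open>When \<open>u v\<close> is reducible at the junction, \<open>u\<close> is a single letter, and \<open>ad u\<close> is distributed as
  a derivation over the standard factors of \<open>v\<close>.\<close>

lemma lie_junction_derivation:
  assumes up: "u = [PW p]" and vq: "v = PW q # v'" and pq: "word_gt p q"
    and std: "prime_order.std v1 v2" and v12: "v = v1 @ v2"
    and irr: "v1 \<in> irr_words X" "v2 \<in> irr_words X"
  shows "lie_below u v"
proof -
  have ne: "v1 \<noteq> []" "v2 \<noteq> []" using irr irr_nonempty by auto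
  have gt: "succ_prime (PW p) (PW q)" using pq by (simp add: succ_prime_PW)
  obtain t1 where t1: "v1 = PW q # t1" using ne v12 vq by (cases v1) auto
  obtain r t2 where t2: "v2 = r # t2" using ne by (cases v2) auto
  have "prime_order.diff_less v v2"
    using prime_order.lyndon_suffix[of v1 v2] v irr_lyndon ne v12 by blast
  \<comment> \<open>Being Lyndon, \<open>v\<close> lies below its suffix \<open>v2\<close>, so
    \<open>r\<close> is classically at least \<open>PW q\<close> and thus above \<open>PW p\<close>.
    Products starting with \<open>v1\<close> or \<open>v2\<close> are therefore above those starting
    with \<open>u\<close>.\<close>
  then have "succ_prime (PW q) r \<or> PW q = r" using vq t2 by (auto simp: lex_diff_Cons)
  then have gt': "succ_prime (PW p) r" using gt prime_order.gt_trans by blast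
  have u_v1: "prime_order.diff_less (u @ y) (v1 @ z)" and u_v2: "prime_order.diff_less (u @ y) (v2 @ z)" for y z
    using up t1 t2 gt gt' by (auto simp: lex_diff_Cons)
  have L: "prime_order.lex_less u v1" "prime_order.lex_less u v2"
    using u_v1[of "[]" "[]"] u_v2[of "[]" "[]"] lex_diff_imp_gt by auto
  have cl: "e u \<in> carrier L" "e v1 \<in> carrier L" "e v2 \<in> carrier L" using irr u e_closed by auto
  have 1: "lie L (e u) (e v1) \<in> espan (below X (u @ v1))"
    by (rule lie_shorter) (use irr u L ne v12 in auto)
  have 2: "lie L (e u) (e v2) \<in> espan (below X (u @ v2))"
    by (rule lie_shorter) (use irr u L ne v12 in auto)
  \<comment> \<open>The ascent of \<open>u v\<close> already lies in \<open>u v1\<close>, so the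
    expansion of \<open>[u, v1]\<close> has only shorter words and words strictly above
    \<open>u v1\<close>. The word \<open>u v1\<close> itself, followed by \<open>v2\<close>, would
    have led back to \<open>u v\<close>.\<close>
  have nirr: "u @ v1 \<notin> irr_words X"
  proof
    assume "u @ v1 \<in> irr_words X"
    moreover have "u @ v1 = [] @ PW p # PW q # t1" using up t1 by simp
    ultimately show False using pq irr_words_iff by blast
  qed
  have A: "lie L (e w) (e v2) \<in> espan (below X (u @ v))" if w: "w \<in> below X (u @ v1)" for w
  proof (cases "length w < length (u @ v1)")
    case True
    then show ?thesis using w irr
      by (intro lie_down) (auto simp: down_def below_def v12)
  next
    case False
    then have w': "w \<in> irr_words X" "mset w = mset (u @ v1)" "prime_order.lex_less (u @ v1) w"
      using w nirr by (auto simp: below_def)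
    have "prime_order.lex_less (u @ v) (w @ v2)"
      using lex_gt_append[OF w'(3), of v2 v2] mset_eq_length[OF w'(2)] v12
      by (simp add: lex_diff_imp_gt)
    moreover have "prime_order.lex_less (u @ v) (v2 @ w)" using u_v2 by (rule lex_diff_imp_gt)
    ultimately show ?thesis using w' irr by (intro lie_down) (auto simp: down_def v12)
  qed
  have B: "lie L (e v1) (e w) \<in> espan (below X (u @ v))" if w: "w \<in> below X (u @ v2)" for w
  proof (cases "length w < length (u @ v2)")
    case True
    then show ?thesis using w irr
      by (intro lie_down) (auto simp: down_def below_def v12)
  next
    case False
    then have w': "w \<in> irr_words X" "mset w = mset (u @ v2)" "w = u @ v2 \<or> prime_order.lex_less (u @ v2) w"
      using w by (auto simp: below_def)
    have "prime_order.lex_less (u @ v) ((u @ v2) @ v1)"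
      using prime_order.lyndon_concat_rot[of v1 v2] std v12
      by (auto simp: prime_order.std_def intro!: lex_gt_prepend)
    then have "prime_order.lex_less (u @ v) (w @ v1)"
      using lex_ge_append w' mset_eq_length by blast
    moreover have "prime_order.lex_less (u @ v) (v1 @ w)" using u_v1 by (rule lex_diff_imp_gt)
    ultimately show ?thesis using w' irr by (intro lie_down) (auto simp: down_def v12)
  qed
  have "lie L (e u) (lie L (e v1) (e v2)) = lie L (lie L (e u) (e v1)) (e v2) \<oplus> lie L (e v1) (lie L (e u) (e v2))"
  proof -
    have c: "lie L (lie L (e u) (e v1)) (e v2) \<in> carrier L" "lie L (lie L (e u) (e v2)) (e v1) \<in> carrier L"
      "lie L (e u) (lie L (e v1) (e v2)) \<in> carrier L"
      using cl lie_closed by auto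
    have "lie L (e v1) (lie L (e u) (e v2)) = (- 1) \<odot> lie L (lie L (e u) (e v2)) (e v1)"
      using cl by (simp add: lie_anti[of _ "e v1"] lie_closed)
    moreover have "lie L (lie L (e u) (e v2)) (e v1) \<oplus> (- 1) \<odot> lie L (lie L (e u) (e v2)) (e v1) = \<zero>"
      using smult_add_left[OF c(2), of 1 "- 1"] smult_one'[OF c(2)] smult_zero_left[OF c(2)] by simp
    ultimately show ?thesis
      using jacobi_left[OF cl] c smult_cl[OF c(2)] by (simp add: a_ac)
  qed
  then have "lie L (e u) (e v) = lie L (lie L (e u) (e v1)) (e v2) \<oplus> lie L (e v1) (lie L (e u) (e v2))"
    using e_std[OF std irr] v12 by simp
  moreover have "lie L (lie L (e u) (e v1)) (e v2) \<in> espan (below X (u @ v))"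
    by (rule lie_lspan_left[OF e_below_closed e_below_closed cl(3) _ 1]) (use A in auto)
  moreover have "lie L (e v1) (lie L (e u) (e v2)) \<in> espan (below X (u @ v))"
    by (rule lie_lspan_right[OF e_below_closed e_below_closed cl(2) _ 2]) (use B in auto)
  ultimately show ?thesis unfolding lie_below_def using lspan_add[OF e_below_closed] by simp
qed

lemma lie_standard:
  assumes std: "prime_order.std u v"
  shows "lie_below u v"
proof (cases "u @ v \<in> irr_words X")
  case True
  then have "u @ v \<in> below X (u @ v)" by (simp add: below_def)
  then show ?thesis
    using lspan_base[OF e_below_closed] e_std[OF std u v] unfolding lie_below_def by (metis image_eqI)
next
  case False
  then obtain p q u' v' where pq: "u = u' @ [PW p]" "v = PW q # v'" "word_gt p q"
    using irr_append[OF u v uv] by blast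
  have gt: "succ_prime (PW p) (PW q)" using pq by (simp add: succ_prime_PW)
  \<comment> \<open>Otherwise the right standard factor \<open>u2\<close> of \<open>u\<close> ends
    in \<open>PW p\<close>, and \<open>v \<le> u2 \<le> PW p\<close> because a Lyndon word is at
    most its last letter. But \<open>v\<close> starts with \<open>PW q\<close>, which is above
    \<open>PW p\<close>.\<close>
  have "length u = 1"
  proof (rule ccontr)
    assume "length u \<noteq> 1"
    then obtain u1 u2 where u12: "prime_order.std u1 u2" "u = u1 @ u2" "u1 \<in> irr_words X" "u2 \<in> irr_words X"
      using irr_std_exists u by metis
    then have "\<not> prime_order.lex_less u2 v" using prime_order.std_right_le std by blast
    then have 1: "u2 = v \<or> prime_order.lex_less v u2" using irr_lex_total u12 v by blast
    have "u2 \<noteq> []" using u12 irr_nonempty by blast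
    then obtain r where r: "u2 = r @ [PW p]"
      using u12(2) pq(1) by (metis append_butlast_last_id last_appendR last_snoc)
    then have "u2 = [PW p] \<or> prime_order.lex_less u2 [PW p]"
      using prime_order.lyndon_suffix[of r "[PW p]"] irr_lyndon[OF u12(4)] lex_diff_imp_gt
      by (cases "r = []") auto
    then have "v = [PW p] \<or> prime_order.lex_less v [PW p]" using 1 prime_order.lex_trans by blast
    then show False
      using pq(2) gt prime_order.gt_irrefl prime_order.gt_trans by auto
  qed
  then have up: "u = [PW p]" using pq by simp
  show ?thesis
  proof (cases "length v = 1")
    case True
    then show ?thesis using pq by (intro lie_two_PW[OF up]) auto
  next
    case False
    obtain v1 v2 where "prime_order.std v1 v2" "v = v1 @ v2" "v1 \<in> irr_words X" "v2 \<in> irr_words X"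
      using irr_std_exists[OF v False] .
    then show ?thesis using lie_junction_derivation[OF up pq(2,3)] by blast
  qed
qed

text \<open>By \<open>stdI\<close>, the factors \<open>u\<close> and \<open>v\<close> are standard
  unless the right standard factor of \<open>u\<close> is below \<open>v\<close>.\<close>

lemma lie_below_step: "lie_below u v"
proof (cases "length u = 1")
  case True
  then show ?thesis
    by (intro lie_standard prime_order.stdI) (use u v uv irr_lyndon in auto)
next
  case False
  obtain u1 u2 where u12: "prime_order.std u1 u2" "u = u1 @ u2" "u1 \<in> irr_words X" "u2 \<in> irr_words X"
    using irr_std_exists[OF u False] .
  show ?thesis
  proof (cases "prime_order.lex_less u2 v")
    case True
    then show ?thesis using lie_nonstandard u12 by blast
  next
    case False
    then have "u2 = v \<or> prime_order.lex_less v u2" using irr_lex_total u12 v by blast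
    then show ?thesis
      using u12 by (intro lie_standard prime_order.stdI) (use u v uv irr_lyndon in blast)+
  qed
qed

end

section \<open>Closure of the span under bracket, \<open>P\<close> and \<open>D\<close>\<close>

lemma lie_below: "u \<in> irr_words X \<Longrightarrow> v \<in> irr_words X \<Longrightarrow> prime_order.lex_less u v \<Longrightarrow> lie_below u v"
proof (induction "(u, v)" arbitrary: u v rule: wf_induct_rule[OF wf_pair_rel])
  case (1 u v)
  show ?case by (rule lie_below_step[OF 1(2-4)]) (rule 1(1); assumption)
qed

lemma lie_espan:
  assumes "x \<in> espan (irr_words X)" "y \<in> espan (irr_words X)"
  shows "lie L x y \<in> espan (irr_words X)"
proof -
  note cl = e_image_closed[OF subset_refl]
  have *: "lie L (e u) (e v) \<in> espan (irr_words X)" if uv: "u \<in> irr_words X" "v \<in> irr_words X" for u v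
  proof -
    have **: "lie L (e u) (e v) \<in> espan (irr_words X)"
      if "u \<in> irr_words X" "v \<in> irr_words X" "prime_order.lex_less u v" for u v
      using lie_below[OF that] espan_mono[OF below_irr] unfolding lie_below_def by blast
    consider "u = v" | "prime_order.lex_less u v" | "prime_order.lex_less v u" using irr_lex_total uv by blast
    then show ?thesis
    proof cases
      case 1
      then show ?thesis using uv by (simp add: lie_self e_closed lspan_zero)
    next
      case 2
      then show ?thesis using ** uv by blast
    next
      case 3
      then show ?thesis using ** uv espan_lie_sym by blast
    qed
  qed
  have "lie L x (e v) \<in> espan (irr_words X)" if "v \<in> irr_words X" for v
    by (rule lie_lspan_left[OF cl cl e_closed[OF that] _ assms(1)]) (use * that in auto)
  then show ?thesis
    by (intro lie_lspan_right[OF cl cl lspan_closed[OF cl assms(1)] _ assms(2)]) auto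
qed

lemma rb_espan:
  assumes "x \<in> espan (irr_words X)"
  shows "rb L x \<in> espan (irr_words X)"
proof (rule lspan_image[OF _ _ _ _ _ _ assms])
  fix y assume "y \<in> e ` irr_words X"
  then obtain w where w: "w \<in> irr_words X" "y = e w" by blast
  then have "rb L y = e [PW w]" "[PW w] \<in> irr_words X" using e_PW irr_PW by auto
  then show "rb L y \<in> espan (irr_words X)" using lspan_base[OF e_image_closed[OF subset_refl]] by simp
qed (auto simp: rb_add rb_smult rb_closed e_closed)

text \<open>\<open>D\<close> shifts the letters \<open>D^m(x)\<close>, cancels against
  \<open>P\<close> and passes into brackets by the Leibniz rule; the brackets that arise are left to
  \<open>lie_espan\<close>.\<close>

lemma df_e_espan: "w \<in> irr_words X \<Longrightarrow> df L (e w) \<in> espan (irr_words X)"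
proof (induction w rule: length_induct)
  case (1 w)
  note cl = e_image_closed[OF subset_refl]
  note base = lspan_base[OF cl imageI]
  show ?case
  proof (cases "length w = 1")
    case True
    then obtain p where p: "w = [p]" by (cases w) auto
    with "1.prems" have "[p] \<in> irr_words X" by simp
    then show ?thesis
    proof (cases rule: irr_single_cases)
      case (1 m x)
      then have "df L (e w) = e [Letter (Suc m, x)]" using p by (simp add: e_Letter)
      then show ?thesis using base[OF irr_Letter] 1 by simp
    next
      case (2 v)
      then show ?thesis using p base by (simp add: e_PW df_rb e_closed)
    qed
  next
    case False
    obtain u v where uv: "prime_order.std u v" "w = u @ v" "u \<in> irr_words X" "v \<in> irr_words X"
      using irr_std_exists[OF "1.prems" False] .
    then have "u \<noteq> []" "v \<noteq> []" using irr_nonempty by auto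
    then have D: "df L (e u) \<in> espan (irr_words X)" "df L (e v) \<in> espan (irr_words X)"
      using 1 uv by auto
    have "df L (e w) = lie L (df L (e u)) (e v) \<oplus> lie L (e u) (df L (e v)) \<oplus> lam \<odot> lie L (df L (e u)) (df L (e v))"
      using uv by (simp add: e_std leibniz e_closed)
    then show ?thesis
      using D base uv lie_espan lspan_add[OF cl] lspan_smult[OF cl] by simp
  qed
qed

lemma df_espan:
  assumes "x \<in> espan (irr_words X)"
  shows "df L x \<in> espan (irr_words X)"
  by (rule lspan_image[OF _ _ _ _ _ _ assms])
    (auto simp: df_add df_smult df_closed e_closed df_e_espan)

end


section \<open>Hurwitz series over a Lie algebra\<close>

locale lie_typed = lin_space scale
  for scale :: "'k::field \<Rightarrow> 'b::ab_group_add \<Rightarrow> 'b" (infixr "*s" 75) +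
  fixes br :: "'b \<Rightarrow> 'b \<Rightarrow> 'b"
  assumes br_add_left: "br (x + y) z = br x z + br y z"
    and br_add_right: "br x (y + z) = br x y + br x z"
    and br_scale_left: "br (c *s x) y = c *s br x y"
    and br_scale_right: "br x (c *s y) = c *s br x y"
    and br_self: "br x x = 0"
    and br_jacobi: "br x (br y z) + br y (br z x) + br z (br x y) = 0"
begin

text \<open>A sequence stands for the iterated derivatives of a series at \<open>0\<close>, the shift being the
  derivation; the Leibniz rule of weight \<open>l\<close> then dictates the recursion for the bracket.\<close>

primrec hprod :: "'k \<Rightarrow> nat \<Rightarrow> (nat \<Rightarrow> 'b) \<Rightarrow> (nat \<Rightarrow> 'b) \<Rightarrow> 'b" where
  "hprod l 0 = (\<lambda>s t. br (s 0) (t 0))"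
| "hprod l (Suc n) = (\<lambda>s t. hprod l n (\<lambda>i. s (Suc i)) t + hprod l n s (\<lambda>i. t (Suc i))
     + l *s hprod l n (\<lambda>i. s (Suc i)) (\<lambda>i. t (Suc i)))"

lemma hprod_add_left: "hprod l n (\<lambda>i. s i + s' i) t = hprod l n s t + hprod l n s' t"
  by (induction n arbitrary: s s' t) (simp_all add: br_add_left scale_right_distrib algebra_simps)

lemma hprod_add_right: "hprod l n s (\<lambda>i. t i + t' i) = hprod l n s t + hprod l n s t'"
  by (induction n arbitrary: s t t') (simp_all add: br_add_right scale_right_distrib algebra_simps)

lemma hprod_scale_left: "hprod l n (\<lambda>i. c *s s i) t = c *s hprod l n s t"
  by (induction n arbitrary: s t) (simp_all add: br_scale_left scale_right_distrib mult.commute)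

lemma hprod_scale_right: "hprod l n s (\<lambda>i. c *s t i) = c *s hprod l n s t"
  by (induction n arbitrary: s t) (simp_all add: br_scale_right scale_right_distrib mult.commute)

lemma br_anti: "br y x = - br x y"
proof -
  have "br (x + y) (x + y) = br y x + br x y"
    by (simp add: br_add_left br_add_right br_self[of x] br_self[of y])
  then show ?thesis using br_self[of "x + y"] by (simp add: eq_neg_iff_add_eq_0)
qed

lemma hprod_anti: "hprod l n t s = - hprod l n s t"
proof (induction n arbitrary: s t)
  case 0
  show ?case by (simp add: br_anti[of "s 0"])
next
  case (Suc n)
  show ?case
    by (simp add: Suc.IH[of t s] Suc.IH[of t "\<lambda>i. s (Suc i)"] Suc.IH[of "\<lambda>i. t (Suc i)" s]
        Suc.IH[of "\<lambda>i. t (Suc i)" "\<lambda>i. s (Suc i)"])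
qed

text \<open>In characteristic 2 this is stronger than antisymmetry. The mixed terms of the recursion
  cancel, and the induction hypothesis removes the term of weight \<open>l\<close>.\<close>

lemma hprod_self: "hprod l n s s = 0"
proof (induction n arbitrary: s)
  case (Suc n)
  then show ?case using hprod_anti[of l n s "\<lambda>i. s (Suc i)"] by simp
qed (simp add: br_self)

text \<open>The Leibniz rule of weight \<open>l\<close>, applied to both brackets, leaves seven
  Jacobi sums one index lower, one for each nonempty set of shifted arguments.\<close>

lemma hprod_jacobi:
  "hprod l n s (\<lambda>i. hprod l i t r) + hprod l n t (\<lambda>i. hprod l i r s) + hprod l n r (\<lambda>i. hprod l i s t) = 0"
proof (induction n arbitrary: s t r)
  case 0
  then show ?case by (simp add: br_jacobi)
next
  case (Suc n)
  have *: "hprod l n s (\<lambda>i. hprod l i t r) = - hprod l n t (\<lambda>i. hprod l i r s) - hprod l n r (\<lambda>i. hprod l i s t)" for s t r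
    using Suc.IH[of s t r] by (simp add: eq_neg_iff_add_eq_0 algebra_simps)
  show ?case
    by (simp add: hprod_add_left hprod_add_right hprod_scale_left hprod_scale_right scale_right_distrib
        *[of "\<lambda>i. s (Suc i)"] *[of s "\<lambda>i. t (Suc i)"] *[of s t "\<lambda>i. r (Suc i)"]
        *[of s "\<lambda>i. t (Suc i)" "\<lambda>i. r (Suc i)"] scale_right_diff_distrib)
qed

end


section \<open>Extending a differential Rota-Baxter algebra by Hurwitz series\<close>

context diff_lie_rb_algebra
begin

text \<open>The bracket making \<open>rb\<close> a homomorphism of Lie algebras, in closed form thanks to
  \<open>df \<circ> rb = id\<close>.\<close>

definition hb where
  "hb x y = df L (lie L (rb L x) (rb L y))"

lemma hb_eq:
  assumes "x \<in> carrier L" "y \<in> carrier L"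
  shows "hb x y = lie L x (rb L y) \<oplus> lie L (rb L x) y \<oplus> lam \<odot> lie L x y"
  using assms by (simp add: hb_def leibniz df_rb rb_closed)

lemma hb_closed: "x \<in> carrier L \<Longrightarrow> y \<in> carrier L \<Longrightarrow> hb x y \<in> carrier L"
  by (simp add: hb_def lie_closed rb_closed df_closed)

lemma rb_hb:
  assumes "x \<in> carrier L" "y \<in> carrier L"
  shows "rb L (hb x y) = lie L (rb L x) (rb L y)"
  using assms by (simp add: hb_eq rota_baxter rb_add rb_smult lie_closed rb_closed smult_cl)

end

text \<open>\<open>iota f\<close> is the constant term that is put in front of a series when
  \<open>P\<close> is applied to a pair with first component \<open>f\<close>.\<close>

locale drb_ext = diff_lie_rb_algebra lam L + S: lie_typed scale br
  for lam :: "'k::field" and L :: "('k, 'a, 'm) drb_alg_scheme" (structure)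
    and scale :: "'k \<Rightarrow> 'b::ab_group_add \<Rightarrow> 'b" (infixr "*s" 75) and br +
  fixes iota :: "'a \<Rightarrow> 'b"
  assumes iota_add: "x \<in> carrier L \<Longrightarrow> y \<in> carrier L \<Longrightarrow> iota (x \<oplus> y) = iota x + iota y"
    and iota_smult: "x \<in> carrier L \<Longrightarrow> iota (c \<odot> x) = c *s iota x"
    and iota_hb: "x \<in> carrier L \<Longrightarrow> y \<in> carrier L \<Longrightarrow> iota (hb x y) = br (iota x) (iota y)"
begin

definition ext_alg :: "('k, 'a \<times> (nat \<Rightarrow> 'b)) drb_alg" where
  "ext_alg =
   \<lparr>carrier = carrier L \<times> UNIV,
    mult = undefined,
    one = undefined,
    zero = (\<zero>, \<lambda>_. 0),
    add = (\<lambda>(x, s) (y, t). (x \<oplus> y, \<lambda>n. s n + t n)),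
    smult = (\<lambda>c (x, s). (c \<odot> x, \<lambda>n. c *s s n)),
    lie = (\<lambda>(x, s) (y, t). (lie L x y, \<lambda>n. S.hprod lam n s t)),
    rb = (\<lambda>(x, s). (rb L x, case_nat (iota x) s)),
    df = (\<lambda>(x, s). (df L x, \<lambda>n. s (Suc n)))\<rparr>"

lemma ext_alg_simps [simp]:
  "carrier ext_alg = carrier L \<times> UNIV"
  "\<zero>\<^bsub>ext_alg\<^esub> = (\<zero>, \<lambda>_. 0)"
  "(x, s) \<oplus>\<^bsub>ext_alg\<^esub> (y, t) = (x \<oplus> y, \<lambda>n. s n + t n)"
  "c \<odot>\<^bsub>ext_alg\<^esub> (x, s) = (c \<odot> x, \<lambda>n. c *s s n)"
  "lie ext_alg (x, s) (y, t) = (lie L x y, \<lambda>n. S.hprod lam n s t)"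
  "rb ext_alg (x, s) = (rb L x, case_nat (iota x) s)"
  "df ext_alg (x, s) = (df L x, \<lambda>n. s (Suc n))"
  by (simp_all add: ext_alg_def)

theorem ext_alg: "diff_lie_rb_algebra lam ext_alg"
proof -
  have "abelian_group ext_alg"
  proof (rule abelian_groupI)
    fix p assume "p \<in> carrier ext_alg"
    then obtain x s where p: "p = (x, s)" "x \<in> carrier L" by auto
    then show "\<exists>q\<in>carrier ext_alg. q \<oplus>\<^bsub>ext_alg\<^esub> p = \<zero>\<^bsub>ext_alg\<^esub>"
      by (intro bexI[of _ "(\<ominus> x, \<lambda>n. - s n)"]) (auto simp: l_neg)
  qed (auto simp: a_ac algebra_simps)
  then have "module (class_ring :: 'k ring) ext_alg"
    by (intro moduleI class_cring.is_cring)
      (auto simp: smult_cl smult_add smult_add_left smult_smult smult_one' S.scale_left_distrib S.scale_right_distrib)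
  then have "vectorspace (class_ring :: 'k ring) ext_alg"
    by (intro vectorspace.intro class_field.field_axioms)
  moreover have "diff_lie_rb_algebra_axioms lam ext_alg"
  proof
    fix p q assume "p \<in> carrier ext_alg" "q \<in> carrier ext_alg"
    then obtain x s y t where pq: "p = (x, s)" "q = (y, t)" "x \<in> carrier L" "y \<in> carrier L" by auto
    \<comment> \<open>The Rota-Baxter identity at index 0. At an index \<open>Suc n\<close> the
      shift removes the constant terms, and the identity becomes the recursion of
      \<open>hprod\<close>.\<close>
    have "br (iota x) (iota y) = iota (lie L x (rb L y)) + iota (lie L (rb L x) y) + lam *s iota (lie L x y)"
      using pq by (simp add: iota_hb[symmetric] hb_eq iota_add iota_smult lie_closed rb_closed smult_cl)
    then have "S.hprod lam n (case_nat (iota x) s) (case_nat (iota y) t) =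
        case_nat (iota (lie L x (rb L y))) (\<lambda>n. S.hprod lam n s (case_nat (iota y) t)) n
        + case_nat (iota (lie L (rb L x) y)) (\<lambda>n. S.hprod lam n (case_nat (iota x) s) t) n
        + lam *s case_nat (iota (lie L x y)) (\<lambda>n. S.hprod lam n s t) n" for n
      by (cases n) simp_all
    then show "lie ext_alg (rb ext_alg p) (rb ext_alg q) = rb ext_alg (lie ext_alg p (rb ext_alg q))
      \<oplus>\<^bsub>ext_alg\<^esub> rb ext_alg (lie ext_alg (rb ext_alg p) q)
      \<oplus>\<^bsub>ext_alg\<^esub> lam \<odot>\<^bsub>ext_alg\<^esub> rb ext_alg (lie ext_alg p q)"
      using pq by (simp add: rota_baxter)
  next
    fix p q r assume "p \<in> carrier ext_alg" "q \<in> carrier ext_alg" "r \<in> carrier ext_alg"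
    then show "lie ext_alg p (lie ext_alg q r) \<oplus>\<^bsub>ext_alg\<^esub> lie ext_alg q (lie ext_alg r p) \<oplus>\<^bsub>ext_alg\<^esub>
       lie ext_alg r (lie ext_alg p q) = \<zero>\<^bsub>ext_alg\<^esub>"
      using jacobi S.hprod_jacobi by auto
  qed (auto simp: lie_closed lie_add_left lie_add_right lie_smult_left lie_smult_right lie_self
      rb_closed rb_add rb_smult df_closed df_add df_smult leibniz df_rb
      S.hprod_add_left S.hprod_add_right S.hprod_scale_left S.hprod_scale_right S.hprod_self iota_add iota_smult
      fun_eq_iff split: nat.split)
  ultimately show ?thesis by (rule diff_lie_rb_algebra.intro)
qed

end


section \<open>Operators on words\<close>

text \<open>A function from words to combinations of words stands for a linear operator on the space
  with all words as a basis. The enveloping algebra enters only through such operators, acting by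
  left multiplication.\<close>

definition op_scale :: "'k::field \<Rightarrow> ('w \<Rightarrow> 'w \<Rightarrow>\<^sub>0 'k) \<Rightarrow> ('w \<Rightarrow> 'w \<Rightarrow>\<^sub>0 'k)" where
  "op_scale c f = (\<lambda>y. smul c (f y))"

definition op_comp :: "('w \<Rightarrow> 'w \<Rightarrow>\<^sub>0 'k::field) \<Rightarrow> ('w \<Rightarrow> 'w \<Rightarrow>\<^sub>0 'k) \<Rightarrow> ('w \<Rightarrow> 'w \<Rightarrow>\<^sub>0 'k)" where
  "op_comp f g = (\<lambda>y. pm.lin_ext f (g y))"

definition op_br :: "('w \<Rightarrow> 'w \<Rightarrow>\<^sub>0 'k::field) \<Rightarrow> ('w \<Rightarrow> 'w \<Rightarrow>\<^sub>0 'k) \<Rightarrow> ('w \<Rightarrow> 'w \<Rightarrow>\<^sub>0 'k)" where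
  "op_br f g = op_comp f g - op_comp g f"

lemma op_comp_add_left: "op_comp (f + g) h = op_comp f h + op_comp g h"
  by (simp add: fun_eq_iff op_comp_def pm.lin_ext_fun_add plus_fun_def)

lemma op_comp_add_right: "op_comp f (g + h) = op_comp f g + op_comp f h"
  by (simp add: fun_eq_iff op_comp_def pm.lin_ext_add)

lemma op_comp_diff_left: "op_comp (f - g) h = op_comp f h - op_comp g h"
  by (simp add: fun_eq_iff op_comp_def pm.lin_ext_fun_diff fun_diff_def)

lemma op_comp_diff_right: "op_comp f (g - h) = op_comp f g - op_comp f h"
  by (simp add: fun_eq_iff op_comp_def pm.lin_ext_diff)

lemma op_comp_scale_left: "op_comp (op_scale c f) h = op_scale c (op_comp f h)"
  by (simp add: fun_eq_iff op_comp_def op_scale_def pm.lin_ext_fun_scale)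

lemma op_comp_scale_right: "op_comp f (op_scale c g) = op_scale c (op_comp f g)"
  by (simp add: fun_eq_iff op_comp_def op_scale_def pm.lin_ext_smul)

lemma op_comp_assoc: "op_comp (op_comp f g) h = op_comp f (op_comp g h)"
  by (simp add: fun_eq_iff op_comp_def pm.lin_ext_lin_ext)

interpretation op: lie_typed "op_scale :: 'k::field \<Rightarrow> ('w \<Rightarrow> 'w \<Rightarrow>\<^sub>0 'k) \<Rightarrow> _" op_br
proof
  show "op_scale a (x + y) = op_scale a x + op_scale a y" "op_scale (a + b) x = op_scale a x + op_scale b x"
    "op_scale a (op_scale b x) = op_scale (a * b) x" "op_scale 1 x = x"
    for a b and x y :: "'w \<Rightarrow> 'w \<Rightarrow>\<^sub>0 'k"
    by (simp_all add: fun_eq_iff op_scale_def pm.scale_right_distrib pm.scale_left_distrib)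
  show "op_br (op_scale c x) y = op_scale c (op_br x y)" "op_br x (op_scale c y) = op_scale c (op_br x y)"
    for c and x y :: "'w \<Rightarrow> 'w \<Rightarrow>\<^sub>0 'k"
    unfolding op_br_def op_comp_scale_left op_comp_scale_right
    by (simp_all add: fun_eq_iff op_scale_def pm.scale_right_diff_distrib)
qed (simp_all add: op_br_def op_comp_add_left op_comp_add_right op_comp_diff_left op_comp_diff_right
    op_comp_assoc algebra_simps)

lemma op_lin_ext_apply: "op.lin_ext f t y = pm.lin_ext (\<lambda>a. f a y) t"
proof -
  have "sum h A y = (\<Sum>a\<in>A. h a y)" if "finite A" for h :: "'c \<Rightarrow> 'a \<Rightarrow> 'a \<Rightarrow>\<^sub>0 'b" and A
    using that by (induction A rule: finite_induct) auto
  then show ?thesis by (simp add: op.lin_ext_def pm.lin_ext_def op_scale_def)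
qed


section \<open>Linear combinations of bracketed words\<close>

context drb_gens
begin

definition ev :: "((nat \<times> 'x) opword \<Rightarrow>\<^sub>0 'k) \<Rightarrow> 'a" where
  "ev t = (\<Oplus>w\<in>Poly_Mapping.keys t. Poly_Mapping.lookup t w \<odot> e w)"

text \<open>Independence of \<open>e\<close> as a family: two words with the same value count as
  dependent. Injectivity of \<open>e\<close> is deduced from this later.\<close>

definition indep :: "(nat \<times> 'x) opword set \<Rightarrow> bool" where
  "indep V \<longleftrightarrow> (\<forall>t. Poly_Mapping.keys t \<subseteq> V \<longrightarrow> ev t = \<zero> \<longrightarrow> t = 0)"

lemma ev_superset:
  assumes A: "finite A" "Poly_Mapping.keys t \<subseteq> A" "A \<subseteq> irr_words X"
  shows "ev t = (\<Oplus>w\<in>A. Poly_Mapping.lookup t w \<odot> e w)"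
  unfolding ev_def
proof (rule add.finprod_mono_neutral_cong_left[OF A(1,2)])
  show "Poly_Mapping.lookup t w \<odot> e w = \<zero>" if "w \<in> A - Poly_Mapping.keys t" for w
    using that A e_closed by (auto simp: in_keys_iff smult_zero_left)
  show "(\<lambda>w. Poly_Mapping.lookup t w \<odot> e w) \<in> A \<rightarrow> carrier L"
    using A e_closed smult_cl by auto
qed simp

lemma ev_zero [simp]: "ev 0 = \<zero>"
  by (simp add: ev_def)

lemma ev_closed: "Poly_Mapping.keys t \<subseteq> irr_words X \<Longrightarrow> ev t \<in> carrier L"
  unfolding ev_def using e_closed smult_cl by (intro finsum_closed) auto

lemma ev_add:
  assumes "Poly_Mapping.keys s \<subseteq> irr_words X" "Poly_Mapping.keys t \<subseteq> irr_words X"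
  shows "ev (s + t) = ev s \<oplus> ev t"
proof -
  let ?A = "Poly_Mapping.keys s \<union> Poly_Mapping.keys t"
  have A: "?A \<subseteq> irr_words X" "finite ?A" using assms by auto
  have cl: "c \<odot> e w \<in> carrier L" if "w \<in> ?A" for c w
    using that A(1) e_closed smult_cl by blast
  have "ev (s + t) = (\<Oplus>w\<in>?A. Poly_Mapping.lookup s w \<odot> e w \<oplus> Poly_Mapping.lookup t w \<odot> e w)"
    unfolding ev_superset[OF A(2) Poly_Mapping.keys_add A(1)]
  proof (rule finsum_cong'[OF HOL.refl])
    show "(\<lambda>w. Poly_Mapping.lookup s w \<odot> e w \<oplus> Poly_Mapping.lookup t w \<odot> e w) \<in> ?A \<rightarrow> carrier L"
      by (intro Pi_I a_closed cl)
    show "Poly_Mapping.lookup (s + t) w \<odot> e w = Poly_Mapping.lookup s w \<odot> e w \<oplus> Poly_Mapping.lookup t w \<odot> e w"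
      if "w \<in> ?A" for w
    proof -
      have "w \<in> irr_words X" using that A(1) by blast
      then show ?thesis by (simp add: lookup_add smult_add_left e_closed)
    qed
  qed
  also have "\<dots> = ev s \<oplus> ev t"
    unfolding ev_superset[OF A(2) Un_upper1 A(1)] ev_superset[OF A(2) Un_upper2 A(1)]
    by (rule finsum_addf) (intro Pi_I cl; assumption)+
  finally show ?thesis .
qed

lemma ev_smul:
  assumes "Poly_Mapping.keys t \<subseteq> irr_words X"
  shows "ev (smul c t) = c \<odot> ev t"
proof -
  have "ev (smul c t) = (\<Oplus>w\<in>Poly_Mapping.keys t. c \<odot> (Poly_Mapping.lookup t w \<odot> e w))"
    unfolding ev_superset[OF finite_keys keys_smul_subset assms]
    using assms e_closed smult_cl smult_smult
    by (intro finsum_cong') (auto simp: subset_iff)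
  also have "\<dots> = c \<odot> ev t"
    unfolding ev_def using assms e_closed smult_cl by (subst finsum_smult) auto
  finally show ?thesis .
qed

lemma ev_single: "w \<in> irr_words X \<Longrightarrow> ev (Poly_Mapping.single w c) = c \<odot> e w"
  using ev_superset[of "{w}" "Poly_Mapping.single w c"] smult_cl[OF e_closed] by auto

lemma ev_diff:
  assumes "Poly_Mapping.keys s \<subseteq> irr_words X" "Poly_Mapping.keys t \<subseteq> irr_words X"
  shows "ev (s - t) = ev s \<oplus> (- 1) \<odot> ev t"
proof -
  have "s - t = s + smul (- 1) t" by (rule poly_mapping_eqI) (simp add: lookup_add lookup_minus)
  then show ?thesis
    using assms ev_add[of s "smul (- 1) t"] ev_smul[of t "- 1"] keys_smul_subset[of "- 1" t] by simp
qed

lemma hom_ev: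
  fixes scale :: "'k \<Rightarrow> 'b::ab_group_add \<Rightarrow> 'b" and h :: "'a \<Rightarrow> 'b"
  assumes sp: "lin_space scale"
    and add: "\<And>x y. x \<in> carrier L \<Longrightarrow> y \<in> carrier L \<Longrightarrow> h (x \<oplus> y) = h x + h y"
    and smult: "\<And>c x. x \<in> carrier L \<Longrightarrow> h (c \<odot> x) = scale c (h x)"
    and t: "Poly_Mapping.keys t \<subseteq> irr_words X"
  shows "h (ev t) = lin_space.lin_ext scale (\<lambda>w. h (e w)) t"
proof -
  interpret S: lin_space scale by (rule sp)
  have h0: "h \<zero> = 0" using add[of \<zero> \<zero>] by simp
  have "h (\<Oplus>w\<in>A. Poly_Mapping.lookup t w \<odot> e w) = (\<Sum>w\<in>A. scale (Poly_Mapping.lookup t w) (h (e w)))"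
    if "finite A" "A \<subseteq> irr_words X" for A
    using that
  proof (induction A rule: finite_induct)
    case empty
    show ?case by (simp add: h0)
  next
    case (insert w A)
    have cl: "(\<lambda>w. Poly_Mapping.lookup t w \<odot> e w) \<in> A \<rightarrow> carrier L" "e w \<in> carrier L"
      using insert.prems e_closed smult_cl by auto
    have "(\<Oplus>w\<in>insert w A. Poly_Mapping.lookup t w \<odot> e w) =
        Poly_Mapping.lookup t w \<odot> e w \<oplus> (\<Oplus>w\<in>A. Poly_Mapping.lookup t w \<odot> e w)"
      by (intro finsum_insert insert.hyps smult_cl cl)
    moreover have "(\<Oplus>w\<in>A. Poly_Mapping.lookup t w \<odot> e w) \<in> carrier L" by (rule finsum_closed[OF cl(1)])
    ultimately show ?case using insert cl by (simp add: add smult smult_cl)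
  qed
  then show ?thesis unfolding ev_def S.lin_ext_def using t by simp
qed

lemma espan_iff_ev:
  assumes V: "V \<subseteq> irr_words X"
  shows "x \<in> espan V \<longleftrightarrow> (\<exists>t. Poly_Mapping.keys t \<subseteq> V \<and> x = ev t)"
proof
  assume "x \<in> espan V"
  then show "\<exists>t. Poly_Mapping.keys t \<subseteq> V \<and> x = ev t"
  proof induction
    case lspan_zero
    show ?case by (intro exI[of _ 0]) simp
  next
    case (lspan_step z y c)
    then obtain w t where wt: "w \<in> V" "z = e w" "Poly_Mapping.keys t \<subseteq> V" "y = ev t" by auto
    have k: "Poly_Mapping.keys (Poly_Mapping.single w c) \<subseteq> V" using wt by simp
    have "ev (Poly_Mapping.single w c + t) = c \<odot> z \<oplus> y"
      using wt k V by (subst ev_add) (auto simp: ev_single)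
    moreover have "Poly_Mapping.keys (Poly_Mapping.single w c + t) \<subseteq> V"
      using Poly_Mapping.keys_add[of "Poly_Mapping.single w c" t] wt k by blast
    ultimately show ?case by metis
  qed
next
  assume "\<exists>t. Poly_Mapping.keys t \<subseteq> V \<and> x = ev t"
  then obtain t where t: "Poly_Mapping.keys t \<subseteq> V" "x = ev t" by blast
  have "(\<Oplus>w\<in>A. Poly_Mapping.lookup t w \<odot> e w) \<in> espan V" if "finite A" "A \<subseteq> V" for A
    using that
  proof (induction A rule: finite_induct)
    case empty
    show ?case by (simp add: lspan_zero)
  next
    case (insert w A)
    have "(\<lambda>w. Poly_Mapping.lookup t w \<odot> e w) \<in> A \<rightarrow> carrier L" "e w \<in> carrier L"
      using insert.prems V e_closed smult_cl by auto
    then have "(\<Oplus>w\<in>insert w A. Poly_Mapping.lookup t w \<odot> e w) =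
        Poly_Mapping.lookup t w \<odot> e w \<oplus> (\<Oplus>w\<in>A. Poly_Mapping.lookup t w \<odot> e w)"
      by (intro finsum_insert insert.hyps smult_cl)
    moreover have "e w \<in> e ` V" "(\<Oplus>w\<in>A. Poly_Mapping.lookup t w \<odot> e w) \<in> espan V"
      using insert by auto
    ultimately show ?case using lspan_step by simp
  qed
  then show "x \<in> espan V" using t by (simp add: ev_def)
qed

lemma lspan_trans:
  assumes S: "S \<subseteq> lspan T" and T: "T \<subseteq> carrier L" and x: "x \<in> lspan S"
  shows "x \<in> lspan T"
  using x
proof induction
  case (lspan_step z y c)
  then show ?case using S T lspan_add lspan_smult by blast
qed (rule lspan_zero)

text \<open>Zorn's lemma is applied to sets of irreducible words rather than to sets of vectors, so
  that the elements added are again values \<open>e w\<close> and supply letters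
  \<open>PW w\<close>.\<close>

lemma maximal_indep:
  assumes V0: "V0 \<subseteq> irr_words X" "indep V0"
  obtains V where "V0 \<subseteq> V" "V \<subseteq> irr_words X" "indep V" "espan (irr_words X) \<subseteq> espan V"
proof -
  let ?A = "{V. V0 \<subseteq> V \<and> V \<subseteq> irr_words X \<and> indep V}"
  have "\<exists>M\<in>?A. \<forall>Z\<in>?A. M \<subseteq> Z \<longrightarrow> Z = M"
  proof (rule subset_Zorn_nonempty)
    show "?A \<noteq> {}" using V0 by blast
    fix C assume C: "C \<noteq> {}" "subset.chain ?A C"
    then have sub: "C \<subseteq> ?A" by (simp add: subset.chain_def)
    have "indep (\<Union>C)" unfolding indep_def
    proof (intro allI impI)
      fix t assume t: "Poly_Mapping.keys t \<subseteq> \<Union>C" "ev t = \<zero>"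
      then obtain V where "V \<in> C" "Poly_Mapping.keys t \<subseteq> V"
        using finite_subset_Union_chain[OF finite_keys t(1) C] by metis
      then show "t = 0" using sub t(2) unfolding indep_def by blast
    qed
    then show "\<Union>C \<in> ?A" using sub C(1) by blast
  qed
  then obtain V where VA: "V \<in> ?A" and max: "\<forall>Z\<in>?A. V \<subseteq> Z \<longrightarrow> Z = V" by (rule bexE)
  then have V: "V0 \<subseteq> V" "V \<subseteq> irr_words X" "indep V" by simp_all
  have "e w \<in> espan V" if w: "w \<in> irr_words X" for w
  proof (cases "w \<in> V")
    case True
    then show ?thesis by (intro lspan_base[OF e_image_closed[OF V(2)]] imageI)
  next
    case False
    have "insert w V \<notin> ?A"
    proof
      assume "insert w V \<in> ?A"
      then have "insert w V = V" using max[rule_format, of "insert w V"] by blast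
      then show False using False by blast
    qed
    then have "\<not> indep (insert w V)" using V w by auto
    then obtain t where t: "Poly_Mapping.keys t \<subseteq> insert w V" "ev t = \<zero>" "t \<noteq> 0"
      unfolding indep_def by blast
    let ?c = "Poly_Mapping.lookup t w"
    have "?c \<noteq> 0"
    proof
      assume "?c = 0"
      then have "Poly_Mapping.keys t \<subseteq> V" using t(1) by (auto simp: in_keys_iff)
      then show False using V(3) t unfolding indep_def by blast
    qed
    \<comment> \<open>The dependence \<open>t\<close>, solved for \<open>e w\<close>.\<close>
    define s where "s = Poly_Mapping.single w 1 - smul (1 / ?c) t"
    have "Poly_Mapping.keys s \<subseteq> V"
    proof
      fix v assume "v \<in> Poly_Mapping.keys s"
      then have "Poly_Mapping.lookup s v \<noteq> 0" by (simp add: in_keys_iff)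
      then have "v \<noteq> w" "v \<in> Poly_Mapping.keys t"
        using \<open>?c \<noteq> 0\<close> unfolding s_def
        by (auto simp: lookup_minus lookup_single in_keys_iff when_def split: if_splits)
      then show "v \<in> V" using t(1) by blast
    qed
    moreover have "ev s = e w"
    proof -
      have tk: "Poly_Mapping.keys t \<subseteq> irr_words X" using t(1) V(2) w by blast
      then have "Poly_Mapping.keys (smul (1 / ?c) t) \<subseteq> irr_words X"
        by (rule subset_trans[OF keys_smul_subset])
      then have "ev s = 1 \<odot> e w \<oplus> (- 1) \<odot> ((1 / ?c) \<odot> \<zero>)"
        unfolding s_def using w tk t(2) by (subst ev_diff) (auto simp: ev_single ev_smul)
      then show ?thesis using e_closed[OF w] by (simp add: smult_zero smult_one')
    qed
    ultimately show ?thesis unfolding espan_iff_ev[OF V(2)] by (intro exI[of _ s]) simp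
  qed
  then have "espan (irr_words X) \<subseteq> espan V"
    using lspan_trans[of "e ` irr_words X" "e ` V"] e_image_closed[OF V(2)] by blast
  then show ?thesis using that V by blast
qed

end


section \<open>The action on words\<close>

context diff_lie_rb_algebra
begin

lemma hb_add_left: "x \<in> carrier L \<Longrightarrow> y \<in> carrier L \<Longrightarrow> z \<in> carrier L \<Longrightarrow> hb (x \<oplus> y) z = hb x z \<oplus> hb y z"
  and hb_add_right: "x \<in> carrier L \<Longrightarrow> y \<in> carrier L \<Longrightarrow> z \<in> carrier L \<Longrightarrow> hb x (y \<oplus> z) = hb x y \<oplus> hb x z"
  and hb_smult_left: "x \<in> carrier L \<Longrightarrow> y \<in> carrier L \<Longrightarrow> hb (c \<odot> x) y = c \<odot> hb x y"
  and hb_smult_right: "x \<in> carrier L \<Longrightarrow> y \<in> carrier L \<Longrightarrow> hb x (c \<odot> y) = c \<odot> hb x y"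
  by (simp_all add: hb_def rb_add rb_smult lie_add_left lie_add_right lie_smult_left lie_smult_right
      df_add df_smult rb_closed lie_closed)

lemma df_zero: "df L \<zero> = \<zero>"
  using df_smult[of \<zero> 0] smult_zero_left[of \<zero>] smult_zero_left[OF df_closed, of \<zero>] by simp

lemma hb_self: "x \<in> carrier L \<Longrightarrow> hb x x = \<zero>"
  by (simp add: hb_def lie_self rb_closed df_zero)

lemma hb_anti: "x \<in> carrier L \<Longrightarrow> y \<in> carrier L \<Longrightarrow> hb y x = (- 1) \<odot> hb x y"
  using lie_anti[of "rb L x" "rb L y"] by (simp add: hb_def df_smult rb_closed lie_closed)

text \<open>\<open>rb\<close> carries \<open>hb\<close> to the bracket of \<open>L\<close> and has
  the left inverse \<open>df\<close>, so \<open>df\<close> is applied to the Jacobi identity of the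
  images. The sum is nested on the left to match \<open>c_jacobi\<close>, where the structure
  constants are extended linearly in the first argument.\<close>

lemma hb_jacobi:
  assumes x: "x \<in> carrier L" and y: "y \<in> carrier L" and z: "z \<in> carrier L"
  shows "hb (hb y z) x \<oplus> hb (hb z x) y \<oplus> hb (hb x y) z = \<zero>"
proof -
  define a b c where "a = rb L x" and "b = rb L y" and "c = rb L z"
  have cl: "a \<in> carrier L" "b \<in> carrier L" "c \<in> carrier L"
    using assms by (simp_all add: a_def b_def c_def rb_closed)
  note cl2 = lie_closed[OF cl(1) lie_closed[OF cl(2,3)]] lie_closed[OF cl(2) lie_closed[OF cl(3,1)]]
    lie_closed[OF cl(3) lie_closed[OF cl(1,2)]]
  have "lie L (lie L b c) a \<oplus> lie L (lie L c a) b \<oplus> lie L (lie L a b) c =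
      (- 1) \<odot> (lie L a (lie L b c) \<oplus> lie L b (lie L c a) \<oplus> lie L c (lie L a b))"
    using cl cl2 lie_anti[of a "lie L b c"] lie_anti[of b "lie L c a"] lie_anti[of c "lie L a b"]
    by (simp add: smult_add lie_closed)
  also have "\<dots> = \<zero>" using jacobi[OF cl] by (simp add: smult_zero)
  finally have "df L (lie L (lie L b c) a \<oplus> lie L (lie L c a) b \<oplus> lie L (lie L a b) c) = \<zero>"
    by (simp add: df_zero)
  then show ?thesis
    using cl lie_closed by (simp add: hb_def[of "hb _ _"] rb_hb assms df_add a_def b_def c_def)
qed

end

text \<open>A basis of \<open>L\<close> chosen among the values of irreducible words; that all of
  them belong to one basis is the goal of the induction on the degree.\<close>

locale drb_basis = drb_gens lam L X g
  for lam :: "'k::field" and L :: "('k, 'a, 'm) drb_alg_scheme" (structure)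
    and X :: "'x::wellorder set" and g +
  fixes V :: "(nat \<times> 'x) opword set"
  assumes V_irr: "V \<subseteq> irr_words X" and V_indep: "indep V" and V_span: "carrier L \<subseteq> espan V"
begin

definition coord :: "'a \<Rightarrow> (nat \<times> 'x) opword \<Rightarrow>\<^sub>0 'k" where
  "coord f = (THE t. Poly_Mapping.keys t \<subseteq> V \<and> ev t = f)"

lemma ev_inject:
  assumes "Poly_Mapping.keys s \<subseteq> V" "Poly_Mapping.keys t \<subseteq> V" "ev s = ev t"
  shows "s = t"
proof -
  have k: "Poly_Mapping.keys s \<subseteq> irr_words X" "Poly_Mapping.keys t \<subseteq> irr_words X"
    using assms V_irr by auto
  have "ev (s - t) = (1 + - 1) \<odot> ev t"
    using ev_diff[OF k] assms(3) smult_add_left[OF ev_closed[OF k(2)], of 1 "- 1"]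
      smult_one'[OF ev_closed[OF k(2)]] by simp
  then have "ev (s - t) = \<zero>" using smult_zero_left[OF ev_closed[OF k(2)]] by simp
  moreover have "Poly_Mapping.keys (s - t) \<subseteq> V"
  proof
    fix w assume "w \<in> Poly_Mapping.keys (s - t)"
    then have "Poly_Mapping.lookup s w \<noteq> 0 \<or> Poly_Mapping.lookup t w \<noteq> 0"
      by (auto simp: in_keys_iff lookup_minus)
    then show "w \<in> V" using assms(1,2) by (auto simp: in_keys_iff)
  qed
  ultimately have "s - t = 0" using V_indep unfolding indep_def by blast
  then show ?thesis by simp
qed

lemma coord_ev: "Poly_Mapping.keys t \<subseteq> V \<Longrightarrow> coord (ev t) = t"
  unfolding coord_def by (rule the_equality) (auto intro: ev_inject)

lemma coord: "f \<in> carrier L \<Longrightarrow> Poly_Mapping.keys (coord f) \<subseteq> V \<and> ev (coord f) = f"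
  using V_span espan_iff_ev[OF V_irr, of f] coord_ev by auto

lemma keys_coord_irr: "f \<in> carrier L \<Longrightarrow> Poly_Mapping.keys (coord f) \<subseteq> irr_words X"
  using coord V_irr by blast

lemma coord_add:
  assumes "x \<in> carrier L" "y \<in> carrier L"
  shows "coord (x \<oplus> y) = coord x + coord y"
proof -
  have "Poly_Mapping.keys (coord x + coord y) \<subseteq> V"
    using Poly_Mapping.keys_add[of "coord x" "coord y"] coord assms by blast
  moreover have "ev (coord x + coord y) = x \<oplus> y"
    using ev_add[OF keys_coord_irr keys_coord_irr] coord assms by simp
  ultimately show ?thesis using coord_ev by metis
qed

lemma coord_smult:
  assumes "x \<in> carrier L"
  shows "coord (c \<odot> x) = smul c (coord x)"
proof -
  have "Poly_Mapping.keys (smul c (coord x)) \<subseteq> V"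
    using keys_smul_subset[of c "coord x"] coord assms by blast
  moreover have "ev (smul c (coord x)) = c \<odot> x"
    using ev_smul[OF keys_coord_irr] coord assms by simp
  ultimately show ?thesis using coord_ev by metis
qed

lemma coord_e: "w \<in> V \<Longrightarrow> coord (e w) = Poly_Mapping.single w 1"
  using coord_ev[of "Poly_Mapping.single w 1"] V_irr by (auto simp: ev_single smult_one' e_closed subset_iff)

lemma hom_coord:
  assumes "lin_space scale"
    and "\<And>x y. x \<in> carrier L \<Longrightarrow> y \<in> carrier L \<Longrightarrow> h (x \<oplus> y) = h x + h y"
    and "\<And>c x. x \<in> carrier L \<Longrightarrow> h (c \<odot> x) = scale c (h x)"
    and "f \<in> carrier L"
  shows "h f = lin_space.lin_ext scale (\<lambda>w. h (e w)) (coord f)"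
  using hom_ev[of scale h "coord f"] assms keys_coord_irr coord by simp

lemma hom_eqI:
  assumes sp: "lin_space scale"
    and "\<And>x y. x \<in> carrier L \<Longrightarrow> y \<in> carrier L \<Longrightarrow> h (x \<oplus> y) = h x + h y"
    and "\<And>c x. x \<in> carrier L \<Longrightarrow> h (c \<odot> x) = scale c (h x)"
    and "\<And>x y. x \<in> carrier L \<Longrightarrow> y \<in> carrier L \<Longrightarrow> h' (x \<oplus> y) = h' x + h' y"
    and "\<And>c x. x \<in> carrier L \<Longrightarrow> h' (c \<odot> x) = scale c (h' x)"
    and eq: "\<And>w. w \<in> V \<Longrightarrow> h (e w) = h' (e w)" and f: "f \<in> carrier L"
  shows "h f = h' f"
proof -
  have "lin_space.lin_ext scale (\<lambda>w. h (e w)) (coord f) = lin_space.lin_ext scale (\<lambda>w. h' (e w)) (coord f)"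
    using coord[OF f] by (intro lin_space.lin_ext_cong[OF sp] eq) blast
  then show ?thesis using hom_coord[of scale h f] hom_coord[of scale h' f] assms by simp
qed

text \<open>Coordinates with the basis element \<open>e w\<close> written as the letter
  \<open>PW w\<close>, which stands for the image of P(\<open>e w\<close>).\<close>

definition lcoord :: "'a \<Rightarrow> (nat \<times> 'x) prime_word \<Rightarrow>\<^sub>0 'k" where
  "lcoord f = pm.lin_ext (\<lambda>w. Poly_Mapping.single (PW w) 1) (coord f)"

lemma lcoord_add: "x \<in> carrier L \<Longrightarrow> y \<in> carrier L \<Longrightarrow> lcoord (x \<oplus> y) = lcoord x + lcoord y"
  by (simp add: lcoord_def coord_add pm.lin_ext_add)

lemma lcoord_smult: "x \<in> carrier L \<Longrightarrow> lcoord (c \<odot> x) = smul c (lcoord x)"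
  by (simp add: lcoord_def coord_smult pm.lin_ext_smul)

lemma lcoord_zero: "lcoord \<zero> = 0"
  using lcoord_add[of \<zero> \<zero>] by simp

lemma lcoord_e: "w \<in> V \<Longrightarrow> lcoord (e w) = Poly_Mapping.single (PW w) 1"
  by (simp add: lcoord_def coord_e)

lemma lcoord_keys:
  assumes "f \<in> carrier L"
  shows "Poly_Mapping.keys (lcoord f) \<subseteq> PW ` V"
proof
  fix p assume "p \<in> Poly_Mapping.keys (lcoord f)"
  then obtain w where "w \<in> Poly_Mapping.keys (coord f)" "p \<in> Poly_Mapping.keys (Poly_Mapping.single (PW w) (1 :: 'k))"
    unfolding lcoord_def using keys_pm_ext by metis
  then show "p \<in> PW ` V" using coord[OF assms] by auto
qed

definition unPW :: "(nat \<times> 'x) prime_word \<Rightarrow> (nat \<times> 'x) opword" where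
  "unPW p = (THE w. p = PW w)"

lemma unPW [simp]: "unPW (PW w) = w"
  by (simp add: unPW_def)

text \<open>The structure constants of the Lie algebra \<open>L\<close> with the bracket
  \<open>hb\<close>.\<close>

definition cst :: "(nat \<times> 'x) prime_word \<Rightarrow> (nat \<times> 'x) prime_word \<Rightarrow> (nat \<times> 'x) prime_word \<Rightarrow>\<^sub>0 'k" where
  "cst a b = lcoord (hb (e (unPW a)) (e (unPW b)))"

lemma e_V_closed: "w \<in> V \<Longrightarrow> e w \<in> carrier L"
  using V_irr e_closed by blast

lemma lin_ext_cst:
  assumes f: "f \<in> carrier L" and w: "w \<in> V"
  shows "pm.lin_ext (\<lambda>p. cst p (PW w)) (lcoord f) = lcoord (hb f (e w))"
proof -
  have "pm.lin_ext (\<lambda>p. cst p (PW w)) (lcoord f) = pm.lin_ext (\<lambda>v. lcoord (hb (e v) (e w))) (coord f)"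
    by (simp add: lcoord_def[of f] pm.lin_ext_lin_ext cst_def)
  also have "\<dots> = lcoord (hb f (e w))"
    using e_V_closed[OF w] f
    by (intro hom_coord[symmetric] pm.lin_space_axioms)
      (auto simp: hb_add_left hb_smult_left lcoord_add lcoord_smult hb_closed)
  finally show ?thesis .
qed

sublocale P: pbw succ_prime "PW ` V" cst
proof
  show "\<not> succ_prime a a" for a :: "(nat \<times> 'x) prime_word" by (rule prime_order.gt_irrefl)
  show "succ_prime a b \<Longrightarrow> succ_prime b d \<Longrightarrow> succ_prime a d" for a b d :: "(nat \<times> 'x) prime_word"
    by (rule prime_order.gt_trans)
  fix a b d :: "(nat \<times> 'x) prime_word"
  assume a: "a \<in> PW ` V" and b: "b \<in> PW ` V"
  then obtain u v where uv: "a = PW u" "b = PW v" "u \<in> V" "v \<in> V" by blast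
  have cl: "e u \<in> carrier L" "e v \<in> carrier L" using uv e_V_closed by auto
  have "[a] \<in> irr_words X" "[b] \<in> irr_words X" using uv V_irr irr_PW by auto
  then have "a \<in> Collect proper_prime" "b \<in> Collect proper_prime" using irr_proper by fastforce+
  then show "a = b \<or> succ_prime a b \<or> succ_prime b a" by (rule prime_order.gt_total)
  show "Poly_Mapping.keys (cst a b) \<subseteq> PW ` V"
    unfolding cst_def using cl uv by (intro lcoord_keys hb_closed) auto
  show "cst b a = - cst a b"
    using cl uv hb_anti[OF cl] by (simp add: cst_def lcoord_smult hb_closed smul_minus_one)
  show "cst a a = 0" using cl uv by (simp add: cst_def hb_self lcoord_zero)
  assume "d \<in> PW ` V"
  then obtain w where w: "d = PW w" "w \<in> V" by blast
  then have cw: "e w \<in> carrier L" using e_V_closed by auto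
  have c: "cst a b = lcoord (hb (e u) (e v))" "cst b d = lcoord (hb (e v) (e w))" "cst d a = lcoord (hb (e w) (e u))"
    using uv w by (simp_all add: cst_def)
  have "lcoord (hb (hb (e v) (e w)) (e u) \<oplus> hb (hb (e w) (e u)) (e v) \<oplus> hb (hb (e u) (e v)) (e w)) = 0"
    using hb_jacobi[OF cl cw] by (simp add: lcoord_zero)
  then show "pm.lin_ext (\<lambda>e. cst e a) (cst b d) + pm.lin_ext (\<lambda>e. cst e b) (cst d a) + pm.lin_ext (\<lambda>e. cst e d) (cst a b) = 0"
    unfolding c using uv w cl cw by (simp add: lin_ext_cst hb_closed lcoord_add)
qed

text \<open>Left multiplication by the letter \<open>a\<close> in the enveloping algebra, in terms
  of normal forms.\<close>

definition lop :: "(nat \<times> 'x) prime_word \<Rightarrow> (nat \<times> 'x) opword \<Rightarrow> (nat \<times> 'x) opword \<Rightarrow>\<^sub>0 'k" where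
  "lop a y = P.sg (a # y)"

definition iota :: "'a \<Rightarrow> (nat \<times> 'x) opword \<Rightarrow> (nat \<times> 'x) opword \<Rightarrow>\<^sub>0 'k" where
  "iota f = op.lin_ext lop (lcoord f)"

lemma iota_e: "w \<in> V \<Longrightarrow> iota (e w) = lop (PW w)"
  by (simp add: iota_def lcoord_e)

lemma op_comp_lop: "op_comp (lop a) (lop b) y = P.sg (a # b # y)"
  using P.sg_sg[of "[a]" "b # y"] by (simp add: op_comp_def lop_def[abs_def])

lemma op_br_lop:
  assumes "a \<in> PW ` V" "b \<in> PW ` V"
  shows "op_br (lop a) (lop b) = op.lin_ext lop (cst a b)"
proof
  fix y
  show "op_br (lop a) (lop b) y = op.lin_ext lop (cst a b) y"
    using P.sg_swap[OF assms, of "[]" y]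
    by (simp add: op_br_def op_comp_lop op_lin_ext_apply lop_def P.sg_sum_def)
qed

lemma iota_add: "x \<in> carrier L \<Longrightarrow> y \<in> carrier L \<Longrightarrow> iota (x \<oplus> y) = iota x + iota y"
  by (simp add: iota_def lcoord_add op.lin_ext_add)

lemma iota_smult: "x \<in> carrier L \<Longrightarrow> iota (c \<odot> x) = op_scale c (iota x)"
  by (simp add: iota_def lcoord_smult op.lin_ext_smul)

text \<open>Both sides are bilinear, so basis elements suffice, and for these the claim is the
  exchange relation \<open>sg_swap\<close>.\<close>

lemma iota_hom:
  assumes x: "x \<in> carrier L" and y: "y \<in> carrier L"
  shows "iota (hb x y) = op_br (iota x) (iota y)"
proof -
  note lin = iota_add iota_smult op.br_add_left op.br_add_right op.br_scale_left op.br_scale_right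
    hb_add_left hb_add_right hb_smult_left hb_smult_right hb_closed e_V_closed
  have 1: "iota (hb (e u) (e v)) = op_br (iota (e u)) (iota (e v))" if "u \<in> V" "v \<in> V" for u v
    using op_br_lop[of "PW u" "PW v"] that by (simp add: iota_e) (simp add: iota_def cst_def)
  have 2: "iota (hb x (e v)) = op_br (iota x) (iota (e v))" if "v \<in> V" for v
    by (rule hom_eqI[OF op.lin_space_axioms, where h = "\<lambda>x. iota (hb x (e v))" and h' = "\<lambda>x. op_br (iota x) (iota (e v))"])
      (use that x 1 in \<open>auto simp: lin\<close>)
  show ?thesis
    by (rule hom_eqI[OF op.lin_space_axioms, where h = "\<lambda>y. iota (hb x y)" and h' = "\<lambda>y. op_br (iota x) (iota y)"])
      (use x y 2 in \<open>auto simp: lin\<close>)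
qed

sublocale E: drb_ext lam L op_scale op_br iota
  by unfold_locales (rule iota_add iota_smult iota_hom; assumption)+

text \<open>The order in which leading terms come first: longer words precede shorter ones, and at
  equal length classically smaller words precede larger ones.\<close>

definition later :: "(nat \<times> 'x) opword \<Rightarrow> (nat \<times> 'x) opword \<Rightarrow> bool" where
  "later x v \<longleftrightarrow> length v < length x \<or> length v = length x \<and> prime_order.lex_less x v"

lemma later_trans: "later x y \<Longrightarrow> later y z \<Longrightarrow> later x z"
  unfolding later_def using prime_order.lex_trans by auto

lemma later_irrefl: "\<not> later x x"
  unfolding later_def using prime_order.lex_irrefl by simp

lemma later_prepend: "later x y \<Longrightarrow> later (u @ x) (u @ y)"
  unfolding later_def by (auto intro: lex_gt_prepend)

abbreviation normal :: "(nat \<times> 'x) opword \<Rightarrow> bool" where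
  "normal x \<equiv> (\<forall>u a b v. \<not> P.asc x u a b v)"

text \<open>All arguments \<open>y\<close> are included because operators will be composed, although
  only \<open>y = []\<close> matters in the end. The coefficient is prescribed for normal
  \<open>w y\<close> only, as any other product is itself rewritten.\<close>

definition leading :: "((nat \<times> 'x) opword \<Rightarrow> (nat \<times> 'x) opword \<Rightarrow>\<^sub>0 'k) \<Rightarrow> (nat \<times> 'x) opword \<Rightarrow> bool" where
  "leading f w \<longleftrightarrow> (\<forall>y. (\<forall>x\<in>Poly_Mapping.keys (f y). x = w @ y \<or> later (w @ y) x) \<and>
     (normal (w @ y) \<longrightarrow> Poly_Mapping.lookup (f y) (w @ y) = 1))"

lemma leading_keysD: "leading f w \<Longrightarrow> x \<in> Poly_Mapping.keys (f y) \<Longrightarrow> x = w @ y \<or> later (w @ y) x"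
  unfolding leading_def by blast

lemma leading_lookupD: "leading f w \<Longrightarrow> normal (w @ y) \<Longrightarrow> Poly_Mapping.lookup (f y) (w @ y) = 1"
  unfolding leading_def by blast

lemma leading_lop: "leading (lop a) [a]"
  unfolding leading_def
proof (intro allI conjI ballI impI)
  fix y x assume "x \<in> Poly_Mapping.keys (lop a y)"
  then show "x = [a] @ y \<or> later ([a] @ y) x"
    using P.sg_keys[of x "a # y"] by (auto simp: lop_def later_def)
next
  fix y assume "normal ([a] @ y)"
  then show "Poly_Mapping.lookup (lop a y) ([a] @ y) = 1"
    using P.sg_normal[of "a # y"] by (simp add: lop_def)
qed

lemma leading_comp_keys:
  assumes "leading f u" "leading h v" "x \<in> Poly_Mapping.keys (op_comp f h y)"
  shows "x = u @ v @ y \<or> later (u @ v @ y) x"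
proof -
  obtain z where z: "z \<in> Poly_Mapping.keys (h y)" "x \<in> Poly_Mapping.keys (f z)"
    using assms(3) unfolding op_comp_def by (rule keys_pm_ext)
  then have "z = v @ y \<or> later (v @ y) z" "x = u @ z \<or> later (u @ z) x"
    using assms(1,2) unfolding leading_def by blast+
  then show ?thesis using later_prepend later_trans by blast
qed

lemma leading_comp_lookup:
  assumes fu: "leading f u" and hv: "leading h v" and n: "normal (u @ v @ y)"
  shows "Poly_Mapping.lookup (op_comp f h y) (u @ v @ y) = 1"
proof -
  have "normal (v @ y)"
  proof (intro allI notI)
    fix p a b r assume "P.asc (v @ y) p a b r"
    then have "P.asc (u @ v @ y) (u @ p) a b r" by (simp add: P.asc_def)
    then show False using n by blast
  qed
  then have hy: "Poly_Mapping.lookup (h y) (v @ y) = 1" using hv by (simp add: leading_def)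
  have fy: "Poly_Mapping.lookup (f (v @ y)) (u @ v @ y) = 1" using fu n by (simp add: leading_def)
  \<comment> \<open>Any other term \<open>z\<close> of \<open>h y\<close> is later than
    \<open>v y\<close>, so all terms of \<open>f z\<close> are later than
    \<open>u v y\<close>.\<close>
  have z: "Poly_Mapping.lookup (f z) (u @ v @ y) = 0" if "z \<in> Poly_Mapping.keys (h y) - {v @ y}" for z
  proof (rule ccontr)
    assume "Poly_Mapping.lookup (f z) (u @ v @ y) \<noteq> 0"
    then have "u @ v @ y \<in> Poly_Mapping.keys (f z)" by (simp add: in_keys_iff)
    then have "u @ v @ y = u @ z \<or> later (u @ z) (u @ v @ y)" using fu unfolding leading_def by blast
    moreover have "later (v @ y) z" using hv that unfolding leading_def by blast
    then have "later (u @ v @ y) (u @ z)" by (rule later_prepend)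
    ultimately show False using that later_trans later_irrefl by blast
  qed
  have "Poly_Mapping.lookup (op_comp f h y) (u @ v @ y) =
      (\<Sum>z\<in>Poly_Mapping.keys (h y). Poly_Mapping.lookup (h y) z * Poly_Mapping.lookup (f z) (u @ v @ y))"
    by (simp add: op_comp_def pm.lin_ext_def lookup_sum)
  also have "\<dots> = (\<Sum>z\<in>{v @ y}. Poly_Mapping.lookup (h y) z * Poly_Mapping.lookup (f z) (u @ v @ y))"
    by (rule sum.mono_neutral_right) (use hy z in \<open>auto simp: in_keys_iff\<close>)
  finally show ?thesis using hy fy by simp
qed

text \<open>The second product of the commutator has only terms from \<open>v u y\<close> on, which
  are later than \<open>u v y\<close> and do not touch its coefficient.\<close>

lemma leading_br:
  assumes fu: "leading f u" and hv: "leading h v" and rot: "prime_order.lex_less (u @ v) (v @ u)"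
  shows "leading (op_br f h) (u @ v)"
  unfolding leading_def
proof (intro allI conjI ballI impI)
  have "prime_order.diff_less (u @ v @ y) (v @ u @ y)" for y
    using lex_gt_append[OF rot, of y y] by simp
  then have later: "later (u @ v @ y) (v @ u @ y)" for y
    by (simp add: later_def lex_diff_imp_gt)
  have k2: "later (u @ v @ y) x" if "x \<in> Poly_Mapping.keys (op_comp h f y)" for x y
    using leading_comp_keys[OF hv fu that] later later_trans by blast
  fix y
  {
    fix x assume "x \<in> Poly_Mapping.keys (op_br f h y)"
    then have "x \<in> Poly_Mapping.keys (op_comp f h y) \<or> x \<in> Poly_Mapping.keys (op_comp h f y)"
      by (auto simp: op_br_def in_keys_iff lookup_minus)
    then show "x = (u @ v) @ y \<or> later ((u @ v) @ y) x"
      using leading_comp_keys[OF fu hv] k2 by auto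
  }
  assume "normal ((u @ v) @ y)"
  then have "Poly_Mapping.lookup (op_comp f h y) (u @ v @ y) = 1"
    using leading_comp_lookup[OF fu hv] by simp
  moreover have "Poly_Mapping.lookup (op_comp h f y) (u @ v @ y) = 0"
    using k2[of "u @ v @ y" y] later_irrefl by (auto simp: in_keys_iff)
  ultimately show "Poly_Mapping.lookup (op_br f h y) ((u @ v) @ y) = 1"
    by (simp add: op_br_def lookup_minus)
qed

section \<open>The representation of \<open>L\<close> by operators on words\<close>

context
  fixes h
  assumes h: "h \<in> drb_hom L E.ext_alg"
    and h_fst: "\<And>x. x \<in> carrier L \<Longrightarrow> fst (h x) = x"
    and h_gen: "\<And>x. x \<in> X \<Longrightarrow> h (g x) = (g x, \<lambda>m. lop (Letter (m, x)))"
begin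

text \<open>The constant term of the series attached to \<open>x\<close>. Since \<open>hprod\<close>
  at index 0 is the commutator, this is a representation of the Lie algebra
  \<open>L\<close>.\<close>

definition rho :: "'a \<Rightarrow> (nat \<times> 'x) opword \<Rightarrow> (nat \<times> 'x) opword \<Rightarrow>\<^sub>0 'k" where
  "rho x = snd (h x) 0"

lemma h_pair: "x \<in> carrier L \<Longrightarrow> h x = (x, snd (h x))"
  using h_fst by (metis prod.collapse)

lemma rho_add: "x \<in> carrier L \<Longrightarrow> y \<in> carrier L \<Longrightarrow> rho (x \<oplus> y) = rho x + rho y"
proof -
  assume "x \<in> carrier L" "y \<in> carrier L"
  then have "h (x \<oplus> y) = (x, snd (h x)) \<oplus>\<^bsub>E.ext_alg\<^esub> (y, snd (h y))"
    using h h_pair unfolding drb_hom_def by auto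
  then show ?thesis by (simp add: rho_def)
qed

lemma rho_smult: "x \<in> carrier L \<Longrightarrow> rho (c \<odot> x) = op_scale c (rho x)"
proof -
  assume "x \<in> carrier L"
  then have "h (c \<odot> x) = c \<odot>\<^bsub>E.ext_alg\<^esub> (x, snd (h x))"
    using h h_pair unfolding drb_hom_def by auto
  then show ?thesis by (simp add: rho_def)
qed

lemma rho_lie: "x \<in> carrier L \<Longrightarrow> y \<in> carrier L \<Longrightarrow> rho (lie L x y) = op_br (rho x) (rho y)"
proof -
  assume "x \<in> carrier L" "y \<in> carrier L"
  then have "h (lie L x y) = lie E.ext_alg (x, snd (h x)) (y, snd (h y))"
    using h h_pair unfolding drb_hom_def by auto
  then show ?thesis by (simp add: rho_def)
qed

lemma rho_rb: "x \<in> carrier L \<Longrightarrow> rho (rb L x) = iota x"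
proof -
  assume "x \<in> carrier L"
  then have "h (rb L x) = rb E.ext_alg (x, snd (h x))"
    using h h_pair unfolding drb_hom_def by auto
  then show ?thesis by (simp add: rho_def)
qed

text \<open>\<open>D\<close> shifts series, so the constant term at \<open>D^m(x)\<close> is entry
  \<open>m\<close> of the series at \<open>x\<close>. For generators these entries are the left
  multiplications by the letters \<open>D^m(x)\<close>.\<close>

lemma h_df_pow: "x \<in> carrier L \<Longrightarrow> snd (h ((df L ^^ m) x)) n = snd (h x) (n + m)"
proof (induction m arbitrary: n)
  case (Suc m)
  let ?y = "(df L ^^ m) x"
  have y: "?y \<in> carrier L" using df_pow_closed Suc.prems by blast
  then have "h (df L ?y) = df E.ext_alg (?y, snd (h ?y))"
    using h h_pair unfolding drb_hom_def by auto
  then show ?case using Suc by simp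
qed simp

text \<open>Induction along standard factorizations, where \<open>u v \<sqsubset> v u\<close>
  selects the leading product. For a letter P(p) the hypothesis \<open>p \<in> V\<close> makes
  \<open>iota (e p)\<close> the left multiplication by \<open>PW p\<close> alone.\<close>

lemma rho_leading:
  "w \<in> irr_words X \<Longrightarrow> (\<And>p. PW p \<in> set w \<Longrightarrow> p \<in> V) \<Longrightarrow> leading (rho (e w)) w"
proof (induction w rule: length_induct)
  case (1 w)
  show ?case
  proof (cases "length w = 1")
    case True
    then obtain p where p: "w = [p]" by (cases w) auto
    with "1.prems"(1) have "[p] \<in> irr_words X" by simp
    then show ?thesis
    proof (cases rule: irr_single_cases)
      case (1 m x)
      then have "rho (e w) = lop (Letter (m, x))"
        using p h_df_pow[OF g_closed, of x m 0] h_gen by (simp add: e_Letter rho_def)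
      then show ?thesis using leading_lop p 1 by simp
    next
      case (2 v)
      then have "v \<in> V" using "1.prems"(2) p by auto
      then have "rho (e w) = lop (PW v)"
        using 2 p by (simp add: e_PW rho_rb e_closed iota_e)
      then show ?thesis using leading_lop p 2 by simp
    qed
  next
    case False
    obtain u v where uv: "prime_order.std u v" "w = u @ v" "u \<in> irr_words X" "v \<in> irr_words X"
      using irr_std_exists[OF "1.prems"(1) False] .
    then have "u \<noteq> []" "v \<noteq> []" using irr_nonempty by auto
    then have "leading (rho (e u)) u" "leading (rho (e v)) v" using 1 uv by auto
    moreover have "prime_order.lex_less (u @ v) (v @ u)"
      using uv(1) prime_order.lyndon_concat_rot unfolding prime_order.std_def by blast
    ultimately show ?thesis
      using uv leading_br by (simp add: e_std rho_lie e_closed)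
  qed
qed

lemma irr_normal:
  assumes "w \<in> irr_words X"
  shows "normal w"
proof (intro allI notI)
  fix u a b v assume "P.asc w u a b v"
  then obtain p q where "w = u @ PW p # PW q # v" "succ_prime (PW p) (PW q)"
    by (auto simp: P.asc_def)
  then show False using assms irr_words_iff succ_prime_PW by blast
qed

text \<open>The operators \<open>rho (e w)\<close> are applied to the empty word. Irreducible words
  are normal, so \<open>w\<close> has coefficient 1 in its own image, and all other terms there are
  later.\<close>

lemma indep_of_letters:
  assumes W: "W \<subseteq> irr_words X" and letters: "\<And>w p. w \<in> W \<Longrightarrow> PW p \<in> set w \<Longrightarrow> p \<in> V"
  shows "indep W"
  unfolding indep_def
proof (intro allI impI)
  fix t assume t: "Poly_Mapping.keys t \<subseteq> W" "ev t = \<zero>"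
  have lead: "leading (rho (e w)) w" if "w \<in> W" for w using rho_leading W letters that by blast
  have tk: "Poly_Mapping.keys t \<subseteq> irr_words X" using t W by blast
  have "rho \<zero> = 0" using rho_add[of \<zero> \<zero>] by simp
  then have "op.lin_ext (\<lambda>w. rho (e w)) t = 0"
    using hom_ev[OF op.lin_space_axioms, of rho t] tk t(2) by (simp add: rho_add rho_smult)
  then have 0: "pm.lin_ext (\<lambda>w. rho (e w) []) t = 0"
    by (metis op_lin_ext_apply zero_fun_apply)
  show "t = 0"
  proof (rule ccontr)
    assume "t \<noteq> 0"
    then have "Poly_Mapping.keys t \<noteq> {}" by simp
    moreover have "asymp_on (Poly_Mapping.keys t) later" "transp_on (Poly_Mapping.keys t) later"
      using later_trans later_irrefl by (blast intro: asymp_onI transp_onI)+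
    \<comment> \<open>The earliest word in the support of \<open>t\<close>: no other word there
      precedes \<open>m\<close>, so no other image contains it.\<close>
    ultimately obtain m where m: "m \<in> Poly_Mapping.keys t"
      "\<forall>w\<in>Poly_Mapping.keys t. w \<noteq> m \<longrightarrow> \<not> later w m"
      using Finite_Set.bex_min_element[OF finite_keys] by metis
    have z: "Poly_Mapping.lookup (rho (e w) []) m = 0" if "w \<in> Poly_Mapping.keys t - {m}" for w
    proof (rule ccontr)
      assume "Poly_Mapping.lookup (rho (e w) []) m \<noteq> 0"
      then have "m \<in> Poly_Mapping.keys (rho (e w) [])" by (simp add: in_keys_iff)
      then have "m = w \<or> later w m" using leading_keysD[OF lead, of w m "[]"] that t(1) by auto
      then show False using m that by blast
    qed
    have "m \<in> W" "m \<in> irr_words X" using m(1) t(1) tk by auto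
    then have one: "Poly_Mapping.lookup (rho (e m) []) m = 1"
      using leading_lookupD[OF lead, of m "[]"] irr_normal[of m] by simp
    have "0 = Poly_Mapping.lookup (pm.lin_ext (\<lambda>w. rho (e w) []) t) m" using 0 by simp
    also have "\<dots> = (\<Sum>w\<in>Poly_Mapping.keys t. Poly_Mapping.lookup t w * Poly_Mapping.lookup (rho (e w) []) m)"
      by (simp add: pm.lin_ext_def lookup_sum)
    also have "\<dots> = (\<Sum>w\<in>{m}. Poly_Mapping.lookup t w * Poly_Mapping.lookup (rho (e w) []) m)"
      by (rule sum.mono_neutral_right) (use m(1) z in auto)
    also have "\<dots> = Poly_Mapping.lookup t m" using one by simp
    finally show False using m(1) by (simp add: in_keys_iff)
  qed
qed

end

end


section \<open>The basis of the free algebra\<close>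

lemma (in drb_gens) lincomb_e:
  assumes "inj_on e (irr_words X)" "S \<subseteq> irr_words X"
  shows "lincomb a (e ` S) = (\<Oplus>w\<in>S. a (e w) \<odot> e w)"
proof -
  have "inj_on e S" using assms inj_on_subset by blast
  then show ?thesis
    unfolding lincomb_def using assms(2) e_closed smult_cl
    by (subst add.finprod_reindex) auto
qed

text \<open>Since \<open>basis\<close> speaks of a set of vectors, injectivity is settled before
  coefficients on words are transferred to coefficients on values.\<close>

lemma (in drb_gens) basis_if_indep:
  assumes ind: "indep (irr_words X)" and sp: "carrier L \<subseteq> espan (irr_words X)"
  shows "inj_on e (irr_words X)" and "basis (e ` irr_words X)"
proof -
  show inj: "inj_on e (irr_words X)"
  proof (rule inj_onI, rule ccontr)
    fix u v assume uv: "u \<in> irr_words X" "v \<in> irr_words X" "e u = e v" "u \<noteq> v"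
    let ?t = "Poly_Mapping.single u (1 :: 'k) - Poly_Mapping.single v 1"
    have "ev ?t = (1 + - 1) \<odot> e v"
      using uv smult_add_left[OF e_closed[OF uv(2)], of 1 "- 1"] by (subst ev_diff) (auto simp: ev_single e_closed smult_one')
    then have "ev ?t = \<zero>" using smult_zero_left[OF e_closed[OF uv(2)]] by simp
    moreover have "Poly_Mapping.keys ?t \<subseteq> irr_words X"
      using uv by (auto simp: in_keys_iff lookup_minus lookup_single when_def split: if_splits)
    ultimately have "?t = 0" using ind unfolding indep_def by blast
    then have "Poly_Mapping.lookup ?t u = 0" by simp
    then show False using uv(4) by (simp add: lookup_minus lookup_single)
  qed
  have cl: "e ` irr_words X \<subseteq> carrier L" using e_closed by auto
  have "\<not> lin_dep (e ` irr_words X)"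
  proof
    assume "lin_dep (e ` irr_words X)"
    then obtain A a v where A: "finite A" "A \<subseteq> e ` irr_words X" "lincomb a A = \<zero>" "v \<in> A" "a v \<noteq> 0"
      unfolding lin_dep_def by auto
    then obtain S where S: "S \<subseteq> irr_words X" "finite S" "A = e ` S"
      using finite_subset_image by metis
    define t where "t = (\<Sum>w\<in>S. Poly_Mapping.single w (a (e w)))"
    have lt: "Poly_Mapping.lookup t w = (if w \<in> S then a (e w) else 0)" for w
      unfolding t_def using S(2) by (simp add: lookup_sum lookup_single when_def)
    then have k: "Poly_Mapping.keys t \<subseteq> S" by (auto simp: in_keys_iff split: if_splits)
    have "ev t = (\<Oplus>w\<in>S. a (e w) \<odot> e w)"
      unfolding ev_superset[OF S(2) k S(1)]
      using S(1) e_closed smult_cl by (intro finsum_cong') (auto simp: lt subset_iff)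
    also have "\<dots> = \<zero>" using A(3) lincomb_e[OF inj S(1)] S(3) by simp
    finally have "t = 0" using ind k S(1) unfolding indep_def by blast
    then have "a (e w) = 0" if "w \<in> S" for w using lt[of w] that by simp
    then show False using A(4,5) S(3) by blast
  qed
  moreover have "span (e ` irr_words X) = carrier L"
  proof
    show "span (e ` irr_words X) \<subseteq> carrier L"
      using cl by (auto simp: span_def)
    show "carrier L \<subseteq> span (e ` irr_words X)"
    proof
      fix x assume "x \<in> carrier L"
      then obtain t where t: "Poly_Mapping.keys t \<subseteq> irr_words X" "x = ev t"
        using sp espan_iff_ev[OF subset_refl] by blast
      define a where "a v = Poly_Mapping.lookup t (inv_into (irr_words X) e v)" for v
      have "x = (\<Oplus>w\<in>Poly_Mapping.keys t. a (e w) \<odot> e w)"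
        unfolding t(2) ev_def using t(1) e_closed smult_cl inj
        by (intro finsum_cong') (auto simp: a_def subset_iff)
      then have "x = lincomb a (e ` Poly_Mapping.keys t)" using lincomb_e[OF inj t(1)] by simp
      moreover have "e ` Poly_Mapping.keys t \<subseteq> e ` irr_words X" using t(1) by (rule image_mono)
      ultimately show "x \<in> span (e ` irr_words X)" 
        unfolding span_def by (intro CollectI exI[of _ a] exI[of _ "e ` Poly_Mapping.keys t"]) auto
    qed
  qed
  ultimately show "basis (e ` irr_words X)" using cl by (simp add: basis_def)
qed

lemma gens_DRBL: "drb_gens lam (DRBL lam X) X (gen lam X)"
  by (intro drb_gens.intro DRBL_algebra drb_gens_axioms.intro) (simp add: gen_def carrier_DRBL)

lemma DRBL_endo_id:
  assumes "h \<in> drb_hom (DRBL lam X) (DRBL lam X)" "\<And>x. x \<in> X \<Longrightarrow> h (gen lam X x) = gen lam X x"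
    and "A \<in> carrier (DRBL lam X)"
  shows "h A = A"
proof -
  interpret F: diff_lie_rb_algebra lam "DRBL lam X" by (rule DRBL_algebra)
  have "gen lam X \<in> X \<rightarrow> carrier (DRBL lam X)" by (auto simp: gen_def carrier_DRBL)
  from DRBL_free[OF DRBL_algebra this] obtain h0 where
    h0: "\<forall>h'\<in>drb_hom (DRBL lam X) (DRBL lam X). (\<forall>x\<in>X. h' (gen lam X x) = gen lam X x) \<longrightarrow>
      (\<forall>B\<in>carrier (DRBL lam X). h' B = h0 B)"
    by (elim bexE conjE)
  have "(\<lambda>x. x) \<in> drb_hom (DRBL lam X) (DRBL lam X)" by (auto simp: drb_hom_def)
  then show ?thesis using h0[rule_format, of "\<lambda>x. x" A] h0[rule_format, of h A] assms by simp
qed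

lemma DRBL_espan:
  "carrier (DRBL lam X) \<subseteq> drb_gens.espan (DRBL lam X) (gen lam X) (irr_words X)"
proof
  interpret drb_gens lam "DRBL lam X" X "gen lam X" by (rule gens_DRBL)
  note cl = e_image_closed[OF subset_refl]
  fix A assume "A \<in> carrier (DRBL lam X)"
  then obtain s where s: "s \<in> tms X" "A = drb_class lam X s" by (auto simp: carrier_DRBL)
  have "drb_class lam X s \<in> espan (irr_words X)" using s(1)
  proof (induction s)
    case (Gen x)
    then have "drb_class lam X (Gen x) = e [Letter (0, x)]" "[Letter (0, x)] \<in> irr_words X"
      using irr_Letter by (auto simp: e_Letter gen_def)
    then show ?case using lspan_base[OF cl] by simp
  next
    case Zero
    then show ?case using lspan_zero[of "e ` irr_words X"] by simp
  next
    case (Add s t)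
    then show ?case using lspan_add[OF cl, of "drb_class lam X s" "drb_class lam X t"] by simp
  next
    case (Scale c s)
    then show ?case using lspan_smult[OF cl, of "drb_class lam X s" c] by simp
  next
    case (Lie s t)
    then show ?case using lie_espan[of "drb_class lam X s" "drb_class lam X t"] by simp
  next
    case (RB s)
    then show ?case using rb_espan[of "drb_class lam X s"] by simp
  next
    case (Df s)
    then show ?case using df_espan[of "drb_class lam X s"] by simp
  qed
  then show "A \<in> espan (irr_words X)" using s by simp
qed

text \<open>Freeness yields the homomorphism into the extended algebra. Its first component is an
  endomorphism fixing the generators, hence the identity.\<close>

lemma DRBL_indep_step:
  assumes basis: "drb_basis lam (DRBL lam X) X (gen lam X) V"
    and W: "W \<subseteq> irr_words X" "\<And>w p. w \<in> W \<Longrightarrow> PW p \<in> set w \<Longrightarrow> p \<in> V"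
  shows "drb_gens.indep (DRBL lam X) (gen lam X) W"
proof -
  interpret drb_basis lam "DRBL lam X" X "gen lam X" V by (rule basis)
  let ?f = "\<lambda>x. (gen lam X x, \<lambda>m. lop (Letter (m, x)))"
  have "?f \<in> X \<rightarrow> carrier E.ext_alg" using g_closed by auto
  then obtain h where h: "h \<in> drb_hom (DRBL lam X) E.ext_alg" "\<And>x. x \<in> X \<Longrightarrow> h (gen lam X x) = ?f x"
    using DRBL_free[OF E.ext_alg, of ?f X] by blast
  have "(\<lambda>x. fst (h x)) \<in> drb_hom (DRBL lam X) (DRBL lam X)"
  proof -
    have "fst (p \<oplus>\<^bsub>E.ext_alg\<^esub> q) = fst p \<oplus>\<^bsub>DRBL lam X\<^esub> fst q" "fst (c \<odot>\<^bsub>E.ext_alg\<^esub> p) = c \<odot>\<^bsub>DRBL lam X\<^esub> fst p"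
      "fst (lie E.ext_alg p q) = lie (DRBL lam X) (fst p) (fst q)"
      "fst (rb E.ext_alg p) = rb (DRBL lam X) (fst p)" "fst (df E.ext_alg p) = df (DRBL lam X) (fst p)" for p q c
      by (cases p; cases q; simp del: DRBL_simps)+
    then show ?thesis using h(1) unfolding drb_hom_def by (auto simp del: DRBL_simps simp: mem_Times_iff Pi_iff)
  qed
  then have "fst (h x) = x" if "x \<in> carrier (DRBL lam X)" for x
    using DRBL_endo_id[of "\<lambda>x. fst (h x)" lam X x] h(2) that by simp
  then show ?thesis by (rule indep_of_letters[OF h(1) _ h(2) W])
qed

lemma DRBL_indep: "drb_gens.indep (DRBL lam X) (gen lam X) (irr_words X)"
proof -
  interpret drb_gens lam "DRBL lam X" X "gen lam X" by (rule gens_DRBL)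
  have *: "indep {w \<in> irr_words X. wdeg w \<le> n}" (is "indep (?D n)") for n
  proof (induction n)
    case 0
    have "w \<notin> ?D 0" for w using wdeg_pos[of w] irr_nonempty[of w X] by auto
    then have D: "?D 0 = {}" by blast
    show ?case unfolding D indep_def by auto
  next
    case (Suc n)
    obtain V where V: "?D n \<subseteq> V" "V \<subseteq> irr_words X" "indep V" "espan (irr_words X) \<subseteq> espan V"
      by (rule maximal_indep[OF _ Suc]) auto
    have "drb_basis lam (DRBL lam X) X (gen lam X) V"
      using V DRBL_espan[of lam X] by (intro drb_basis.intro gens_DRBL drb_basis_axioms.intro) auto
    then show ?case
    proof (rule DRBL_indep_step)
      fix w p assume w: "w \<in> ?D (Suc n)" "PW p \<in> set w"
      then have "p \<in> irr_words X" using irr_words_iff[of w X] by auto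
      moreover have "pdeg (PW p) \<le> wdeg w" 
        unfolding wdeg_def by (rule member_le_sum_list) (use w(2) in force)+
      ultimately show "p \<in> V" using V(1) w(1) by auto
    qed auto
  qed
  show ?thesis unfolding indep_def
  proof (intro allI impI)
    fix t assume t: "Poly_Mapping.keys t \<subseteq> irr_words X" "ev t = \<zero>\<^bsub>DRBL lam X\<^esub>"
    \<comment> \<open>A finite support has bounded degree; the additional 0 keeps the set nonempty
      for \<open>Max\<close>.\<close>
    have "Poly_Mapping.keys t \<subseteq> ?D (Max (insert 0 (wdeg ` Poly_Mapping.keys t)))"
      using t(1) by auto
    then show "t = 0" using * t(2) unfolding indep_def by blast
  qed
qed

theorem theorem4p4:
  fixes lam :: "'k::field" and X :: "'x::wellorder set"
  shows "inj_on (beval (DRBL lam X) (gen lam X)) (Irr X) \<and>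
    vectorspace.basis class_ring (DRBL lam X) (beval (DRBL lam X) (gen lam X) ` Irr X)"
proof -
  interpret drb_gens lam "DRBL lam X" X "gen lam X" by (rule gens_DRBL)
  have e: "e = (\<lambda>w. beval (DRBL lam X) (gen lam X) (bracket w))" by (simp add: e_def fun_eq_iff)
  note b = basis_if_indep[OF DRBL_indep DRBL_espan]
  have "inj_on (beval (DRBL lam X) (gen lam X)) (Irr X)"
    using b(1) unfolding Irr_eq e by (auto simp: inj_on_def)
  moreover have "beval (DRBL lam X) (gen lam X) ` Irr X = e ` irr_words X"
    unfolding Irr_eq e by (simp add: image_image)
  ultimately show ?thesis using b(2) by simp
qed

end
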